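(* Let $2<p<3$ and $u_0\in L^2(\mathbb{T}^2)$. Then there exists $0<T\le 1$, depending only on $\|u_0\|_{L^2}$ (and $p$), such that the equation $$\partial_t u+\Delta^2 u=-\nabla\cdot(|\nabla u|^{p-2}\nabla u),\qquad u(0)=u_0,$$ admits a mild solution $u$ on $[0,T]$, and this mild solution is unique in $\tilde{\mathcal S}_T$.
   Context: $\mathbb{T}^2=[0,1]^2$ periodic. $\mathcal{L}=\Delta^2$, $e^{-t\mathcal{L}}f=\mathcal{F}^{-1}(e^{-t|\mathbf k|^4}\hat f(\mathbf k))$ (Fourier multiplier on $\mathbb{Z}^2$). Mild solution: for $p>2$, a function $u\in C([0,T];L^2(\mathbb{T}^2))$ with $\nabla u$ locally integrable is a mild solution on $[0,T]$ with initial data $u_0\in L^2$ if for every $0\le t\le T$, $$u(t)=e^{-t\mathcal{L}}u_0-\int_0^t\nabla\cdot e^{-(t-s)\mathcal{L}}\big(|\nabla u(s)|^{p-2}\nabla u(s)\big)\,ds$$ in $L^2$, the integral being a Bochner integral. For $0<T<1$ (or $T\le1$), $\tilde{\mathcal S}_T$ is the Banach space of $u\in C([0,T];L^2(\mathbb{T}^2))$ with $\sup_{0<t\le T}t^{1/4}\|\nabla u(t)\|_{L^2}<\infty$, with norm $\|u\|_{\tilde{\mathcal S}_T}=\max\{\sup_{0\le t\le T}\|u(t)\|_{L^2},\ \sup_{0<t\le T}t^{1/4}\|\nabla u(t)\|_{L^2}\}$. *)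

theory Defs
  imports "HOL-Analysis.Analysis"
begin

text \<open>The torus T^2 = [0,1]^2 (periodic); functions on it are represented by their
  restriction to the closed unit square (the boundary is a null set).\<close>

definition Tor :: "(real \<times> real) set" where
  "Tor = {0..1} \<times> {0..1}"

definition kdot :: "int \<times> int \<Rightarrow> real \<times> real \<Rightarrow> real" where
  "kdot k x = real_of_int (fst k) * fst x + real_of_int (snd k) * snd x"

definition knorm4 :: "int \<times> int \<Rightarrow> real" where
  "knorm4 k = (real_of_int (fst k) ^ 2 + real_of_int (snd k) ^ 2) ^ 2"

definition L2fun :: "(real \<times> real \<Rightarrow> real) \<Rightarrow> bool" where
  "L2fun f \<longleftrightarrow> f \<in> borel_measurable (lebesgue_on Tor) \<and>
     integrable (lebesgue_on Tor) (\<lambda>x. (f x)\<^sup>2)"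

definition L2vec :: "(real \<times> real \<Rightarrow> real \<times> real) \<Rightarrow> bool" where
  "L2vec G \<longleftrightarrow> G \<in> borel_measurable (lebesgue_on Tor) \<and>
     integrable (lebesgue_on Tor) (\<lambda>x. (norm (G x))\<^sup>2)"

definition L2norm :: "(real \<times> real \<Rightarrow> real) \<Rightarrow> real" where
  "L2norm f = sqrt (\<integral>x. (f x)\<^sup>2 \<partial>lebesgue_on Tor)"

definition L2normv :: "(real \<times> real \<Rightarrow> real \<times> real) \<Rightarrow> real" where
  "L2normv G = sqrt (\<integral>x. (norm (G x))\<^sup>2 \<partial>lebesgue_on Tor)"

definition L1normv :: "(real \<times> real \<Rightarrow> real \<times> real) \<Rightarrow> real" where
  "L1normv G = (\<integral>x. norm (G x) \<partial>lebesgue_on Tor)"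

definition fcoef :: "(real \<times> real \<Rightarrow> real) \<Rightarrow> int \<times> int \<Rightarrow> complex" where
  "fcoef f k = (\<integral>x. complex_of_real (f x) * cis (- 2 * pi * kdot k x) \<partial>lebesgue_on Tor)"

text \<open>Weak (distributional) gradient on the torus, tested against the trigonometric
  system: G in L^1(T^2;R^2) and the Fourier coefficients of its components are
  2 pi i k_j times those of f.\<close>
definition is_wgrad :: "(real \<times> real \<Rightarrow> real) \<Rightarrow> (real \<times> real \<Rightarrow> real \<times> real) \<Rightarrow> bool" where
  "is_wgrad f G \<longleftrightarrow> integrable (lebesgue_on Tor) G \<and>
     (\<forall>k. fcoef (\<lambda>x. fst (G x)) k = 2 * pi * \<i> * of_int (fst k) * fcoef f k \<and>
          fcoef (\<lambda>x. snd (G x)) k = 2 * pi * \<i> * of_int (snd k) * fcoef f k)"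

definition has_wgrad :: "(real \<times> real \<Rightarrow> real) \<Rightarrow> bool" where
  "has_wgrad f \<longleftrightarrow> (\<exists>G. is_wgrad f G)"

text \<open>A chosen representative of the weak gradient (unique up to null sets; all
  quantities below are independent of the representative).\<close>
definition wgrad :: "(real \<times> real \<Rightarrow> real) \<Rightarrow> (real \<times> real \<Rightarrow> real \<times> real)" where
  "wgrad f = (SOME G. is_wgrad f G)"

definition nonlin :: "real \<Rightarrow> (real \<Rightarrow> real \<times> real \<Rightarrow> real) \<Rightarrow> real \<Rightarrow> (real \<times> real \<Rightarrow> real \<times> real)" where
  "nonlin p u s = (\<lambda>x. (norm (wgrad (u s) x)) powr (p - 2) *\<^sub>R wgrad (u s) x)"

text \<open>k-th Fourier coefficient of  \<nabla>\<cdot>e^{-(t-s)L}(|\<nabla>u(s)|^(p-2)\<nabla>u(s)),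
  where e^{-\<tau>L} is the Fourier multiplier e^{-\<tau>|k|^4}.\<close>
definition duh_coef :: "real \<Rightarrow> (real \<Rightarrow> real \<times> real \<Rightarrow> real) \<Rightarrow> real \<Rightarrow> real \<Rightarrow> int \<times> int \<Rightarrow> complex" where
  "duh_coef p u t s k = complex_of_real (exp (- (t - s) * knorm4 k)) *
     (2 * pi * \<i> * of_int (fst k) * fcoef (\<lambda>x. fst (nonlin p u s x)) k +
      2 * pi * \<i> * of_int (snd k) * fcoef (\<lambda>x. snd (nonlin p u s x)) k)"

text \<open>Bochner integrability over [0,t] of the L^2(T^2)-valued map
  s \<mapsto> \<nabla>\<cdot>e^{-(t-s)L}(|\<nabla>u(s)|^(p-2)\<nabla>u(s)), expressed through Fourier coefficients:
  for a.e. s the integrand is defined (nonlinearity in L^1) and lies in L^2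
  (square-summable coefficients); it is strongly measurable (every coefficient is
  measurable, Pettis); and its L^2 norm (Parseval) is integrable.\<close>
definition duhamel_bochner :: "real \<Rightarrow> (real \<Rightarrow> real \<times> real \<Rightarrow> real) \<Rightarrow> real \<Rightarrow> bool" where
  "duhamel_bochner p u t \<longleftrightarrow>
     (AE s in lebesgue_on {0..t}. integrable (lebesgue_on Tor) (nonlin p u s) \<and>
        (\<lambda>k. (cmod (duh_coef p u t s k))\<^sup>2) summable_on UNIV) \<and>
     (\<forall>k. (\<lambda>s. duh_coef p u t s k) \<in> borel_measurable (lebesgue_on {0..t})) \<and>
     integrable (lebesgue_on {0..t})
        (\<lambda>s. sqrt (\<Sum>\<^sub>\<infinity>k. (cmod (duh_coef p u t s k))\<^sup>2))"

definition C_L2 :: "real \<Rightarrow> (real \<Rightarrow> real \<times> real \<Rightarrow> real) \<Rightarrow> bool" where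
  "C_L2 T u \<longleftrightarrow> (\<forall>t\<in>{0..T}. L2fun (u t)) \<and>
     (\<forall>t\<in>{0..T}. \<forall>e>0. \<exists>d>0. \<forall>s\<in>{0..T}. \<bar>s - t\<bar> < d \<longrightarrow> L2norm (\<lambda>x. u s x - u t x) < e)"

definition mild_solution :: "real \<Rightarrow> real \<Rightarrow> (real \<times> real \<Rightarrow> real) \<Rightarrow> (real \<Rightarrow> real \<times> real \<Rightarrow> real) \<Rightarrow> bool" where
  "mild_solution p T u0 u \<longleftrightarrow>
     C_L2 T u \<and>
     (\<forall>t\<in>{0<..T}. has_wgrad (u t)) \<and>
     (\<forall>a b. 0 < a \<and> a \<le> b \<and> b \<le> T \<longrightarrow>
        integrable (lebesgue_on {a..b}) (\<lambda>s. L1normv (wgrad (u s)))) \<and>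
     (\<forall>t\<in>{0..T}. duhamel_bochner p u t \<and>
        (\<forall>k. fcoef (u t) k =
               complex_of_real (exp (- t * knorm4 k)) * fcoef u0 k
               - (\<integral>s. duh_coef p u t s k \<partial>lebesgue_on {0..t})))"

definition S_tilde :: "real \<Rightarrow> (real \<Rightarrow> real \<times> real \<Rightarrow> real) \<Rightarrow> bool" where
  "S_tilde T u \<longleftrightarrow> C_L2 T u \<and>
     (\<forall>t\<in>{0<..T}. has_wgrad (u t) \<and> L2vec (wgrad (u t))) \<and>
     (\<exists>C. \<forall>t\<in>{0<..T}. t powr (1/4) * L2normv (wgrad (u t)) \<le> C)"

end

theory Submission
  imports Defs
begin

text \<open>
  Only the trivial bound of Fourier coefficients by the mean of the modulus is used for the
  nonlinearity. Put \<open>\<delta> = (3 - p)/4\<close>. If \<open>s\<^bsup>1/4\<^esup> |\<nabla>u(s)|\<^sub>2\<close> stays bounded, then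
  \<open>|\<nabla>u|\<^bsup>p-2\<^esup>\<nabla>u\<close> has \<open>L\<^sup>1\<close> norm of order \<open>s\<^bsup>-(p-1)/4\<^esup>\<close>, and is locally Lipschitz in
  \<open>\<nabla>u\<close> with the same weight. Since \<open>|k|\<^sup>2 exp(-\<tau>|k|\<^sup>4) \<le> |k|\<^bsup>-1-2\<delta>\<^esup> \<tau>\<^bsup>-3/4-\<delta>/2\<^esup>\<close> and
  \<open>|k|\<^bsup>-1-2\<delta>\<^esup>\<close> is square summable over \<open>\<int>\<^sup>2\<close>, every Fourier mode of the gradient of the Duhamel
  integral is bounded, after multiplication by \<open>t\<^bsup>1/4\<^esup>\<close>, by a Beta integral of order \<open>t\<^bsup>\<delta>/2\<^esup>\<close>.
  Hence for small \<open>T\<close> the Duhamel map is a contraction in a weighted supremum norm over all modes and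
  times. For two arbitrary solutions the same estimate is applied with an additional weight
  \<open>exp(-\<mu>t)\<close>: as \<open>exp(-\<mu>\<tau>) \<le> (\<mu>\<tau>)\<^bsup>-\<delta>/2\<^esup>\<close>, the contraction constant becomes small for large \<open>\<mu>\<close>
  whatever the size of the solutions, which gives uniqueness on all of \<open>[0,T]\<close>.
\<close>

subsection \<open>Fourier coefficients determine integrable functions\<close>

text \<open>The value of \<delta> is an accounting of powers of time. The flux is controlled in L^1
  only, so its Fourier coefficients are bounded without decay, and the heat kernel must supply both
  the two derivatives and the square summability over the lattice. As |k|^(-1) just fails to be
  square summable over \<int>^2, a little more decay has to be bought with a little more singularity
  at s = t. Without that surcharge the rescaled gradient of the Duhamel integral would gain t^(1/4 +
  1 - 3/4 - (p-1)/4) = t^((3-p)/4), a positive power because p < 3; so (3-p)/4 is the whole budget.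
  One half pays for summability. The other half is the small power of T in the existence proof, and
  in the uniqueness proof it pays for the exponential weight.

  A second obstacle is regularity in time: the weak gradient is a representative chosen separately
  at each time, so measurability of the nonlinear coefficients in s does not come for free. With
  continuous families of modes as unknowns, every coefficient is continuous in time on (0,T], and
  measurability follows.\<close>

abbreviation TM :: "(real \<times> real) measure" where "TM \<equiv> lebesgue_on Tor"

definition ek :: "int \<times> int \<Rightarrow> real \<times> real \<Rightarrow> complex" where
  "ek k x = cis (2 * pi * kdot k x)"

lemma Tor_cbox: "Tor = cbox (0, 0) (1, 1)"
  unfolding Tor_def by (auto simp: cbox_Pair_eq)

lemma Tor_sets [simp, measurable]: "Tor \<in> sets lebesgue"
  unfolding Tor_cbox by simp

lemma emeasure_Tor: "emeasure lebesgue Tor = 1"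
  unfolding Tor_cbox by (subst emeasure_completion) (auto simp: emeasure_lborel_cbox_eq Basis_prod_def)

interpretation TM: finite_measure TM
  by standard (simp add: emeasure_restrict_space emeasure_Tor)

lemma measure_TM: "measure TM Tor = 1"
  by (simp add: measure_restrict_space measure_def emeasure_restrict_space emeasure_Tor)

lemma continuous_borel_measurable_TM:
  fixes f :: "real \<times> real \<Rightarrow> 'b::metric_space"
  assumes "continuous_on UNIV f"
  shows "f \<in> borel_measurable TM"
proof -
  have "f \<in> borel_measurable lebesgue"
    using assms by (intro measurable_completion) (simp add: borel_measurable_continuous_onI)
  then show ?thesis by (rule measurable_restrict_space1)
qed

lemma continuous_on_ek [continuous_intros]: "continuous_on S (ek k)"
  unfolding ek_def kdot_def by (intro continuous_intros)

lemma ek_measurable [measurable]: "ek k \<in> borel_measurable TM"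
  by (intro continuous_borel_measurable_TM continuous_on_ek)

lemma norm_ek [simp]: "norm (ek k x) = 1"
  by (simp add: ek_def)

lemma ek_add: "ek (k + l) x = ek k x * ek l x"
  by (simp add: ek_def kdot_def cis_mult algebra_simps)

lemma ek_0 [simp]: "ek 0 x = 1"
  by (simp add: ek_def kdot_def)

lemma cnj_ek: "cnj (ek k x) = ek (- k) x"
  by (simp add: ek_def kdot_def cis_cnj algebra_simps)

lemma fcoef_ek: "fcoef f k = (\<integral>x. complex_of_real (f x) * ek (- k) x \<partial>TM)"
  by (simp add: fcoef_def ek_def kdot_def algebra_simps)

lemma integrable_mult_ek:
  assumes "integrable TM F"
  shows "integrable TM (\<lambda>x. F x * ek k x)"
  by (rule Bochner_Integration.integrable_bound[OF assms]) (use assms in \<open>auto simp: norm_mult\<close>)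

lemma integrable_ek [simp]: "integrable TM (ek k)"
  using integrable_mult_ek[of "\<lambda>_. 1" k] by simp

lemma integral_cis_01:
  "integral {0..1} (\<lambda>y. cis (2 * pi * (of_int n * y))) = (if n = 0 then 1 else 0)"
proof (cases "n = 0")
  case False
  have "((\<lambda>y. cis (2 * pi * (of_int n * y))) has_integral
      cis (2 * pi * (of_int n * 1)) / (2 * pi * of_int n * \<i>) - cis (2 * pi * (of_int n * 0)) / (2 * pi * of_int n * \<i>)) {0..1}"
  proof (rule fundamental_theorem_of_calculus)
    fix x :: real
    have "((\<lambda>z. exp (\<i> * (2 * pi * (of_int n * z))) / (2 * pi * of_int n * \<i>)) has_field_derivative
       exp (\<i> * (2 * pi * (of_int n * of_real x)))) (at (complex_of_real x))"
      using False by (auto intro!: derivative_eq_intros simp: field_simps)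
    from has_vector_derivative_real_field[OF this, of "{0..1}"]
    show "((\<lambda>x. cis (2 * pi * (of_int n * x)) / (2 * pi * of_int n * \<i>)) has_vector_derivative
       cis (2 * pi * (of_int n * x))) (at x within {0..1})"
      by (simp add: cis_conv_exp)
  qed simp
  moreover have "cis (2 * pi * (of_int n * 1)) = 1"
    using cis_multiple_2pi[of "of_int n"] by simp
  ultimately show ?thesis
    using False by (auto dest!: integral_unique)
qed simp

lemma integral_ek: "(\<integral>x. ek k x \<partial>TM) = (if k = 0 then 1 else 0)"
proof -
  have "(\<integral>x. ek k x \<partial>TM) = integral Tor (ek k)"
    by (rule lebesgue_integral_eq_integral) auto
  also have "\<dots> = integral {0..1} (\<lambda>x. integral {0..1} (\<lambda>y. ek k (x, y)))"
    unfolding Tor_cbox by (subst integral_prod_continuous) (auto intro: continuous_on_ek)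
  also have "\<dots> = integral {0..1} (\<lambda>x. integral {0..1} (\<lambda>y. cis (2 * pi * (of_int (fst k) * x)) * cis (2 * pi * (of_int (snd k) * y))))"
    by (simp add: ek_def kdot_def cis_mult algebra_simps)
  also have "\<dots> = (if k = 0 then 1 else 0)"
    by (simp add: integral_cis_01 integral_mult_right integral_mult_left prod_eq_iff)
  finally show ?thesis .
qed

section \<open>Functions orthogonal to all characters of the torus\<close>

definition allcoef0 :: "(real \<times> real \<Rightarrow> complex) \<Rightarrow> bool" where
  "allcoef0 F \<longleftrightarrow> integrable TM F \<and> (\<forall>k. (\<integral>x. F x * ek k x \<partial>TM) = 0)"

text \<open>Injective on the interior of the square, so that compact sets there are preimages of closed sets of the torus.\<close>

definition tor_emb :: "real \<times> real \<Rightarrow> complex \<times> complex" where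
  "tor_emb x = (ek (1, 0) x, ek (0, 1) x)"

text \<open>A character factor only shifts the index of the coefficient. This is why
  \<open>allcoef0\<close> takes complex-valued functions: \<open>fcoef\<close> accepts real ones
  only, and those are not closed under this operation.\<close>

lemma allcoef0_shift: "allcoef0 F \<Longrightarrow> allcoef0 (\<lambda>x. F x * ek l x)"
  unfolding allcoef0_def
  by (auto simp: integrable_mult_ek mult.assoc simp del: split_paired_All simp flip: ek_add)

lemma allcoef0_scale: "allcoef0 F \<Longrightarrow> allcoef0 (\<lambda>x. F x * c)"
  unfolding allcoef0_def by (simp add: mult.commute[of _ c] mult.assoc)

lemma allcoef0_add: "allcoef0 F \<Longrightarrow> allcoef0 G \<Longrightarrow> allcoef0 (\<lambda>x. F x + G x)"
  unfolding allcoef0_def by (auto simp: distrib_right integrable_mult_ek)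

text \<open>Real and imaginary parts of both coordinates of \<open>tor_emb\<close> are combinations
  of the characters with indices \<open>(1, 0)\<close>, \<open>(-1, 0)\<close>,
  \<open>(0, 1)\<close>, \<open>(0, -1)\<close>, so a linear factor preserves
  \<open>allcoef0\<close>. The induction keeps \<open>F\<close> arbitrary because a product is
  absorbed one factor at a time.\<close>

lemma allcoef0_polynomial:
  assumes "real_polynomial_function g" "allcoef0 F"
  shows "allcoef0 (\<lambda>x. F x * complex_of_real (g (tor_emb x)))"
  using assms
proof (induction arbitrary: F)
  case (linear f)
  interpret f: bounded_linear f by fact
  define a1 a2 b1 b2 where "a1 = f (1, 0)" and "a2 = f (\<i>, 0)" and "b1 = f (0, 1)" and "b2 = f (0, \<i>)"
  have "f (z, w) = Re z * a1 + Im z * a2 + Re w * b1 + Im w * b2" for z w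
  proof -
    have "(z, w) = Re z *\<^sub>R (1, 0) + Im z *\<^sub>R (\<i>, 0) + Re w *\<^sub>R (0, 1) + Im w *\<^sub>R (0, \<i>)"
      by (simp add: complex_eq_iff)
    then show ?thesis
      unfolding a1_def a2_def b1_def b2_def by (metis f.add f.scaleR real_scaleR_def)
  qed
  moreover have re: "complex_of_real (Re z) = (z + cnj z) / 2" and im: "complex_of_real (Im z) = (z - cnj z) / (2 * \<i>)" for z
    by (simp_all add: complex_eq_iff)
  ultimately have eq: "complex_of_real (f (tor_emb x)) =
     ek (1, 0) x * ((a1 - \<i> * a2) / 2) + ek (-1, 0) x * ((a1 + \<i> * a2) / 2)
     + ek (0, 1) x * ((b1 - \<i> * b2) / 2) + ek (0, -1) x * ((b1 + \<i> * b2) / 2)" for x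
    by (simp add: tor_emb_def re im cnj_ek field_simps)
  show ?case
    unfolding eq distrib_left mult.assoc[symmetric]
    by (intro allcoef0_add allcoef0_scale allcoef0_shift linear)
next
  case (const c)
  then show ?case by (rule allcoef0_scale)
next
  case (add f g)
  from allcoef0_add[OF add.IH[OF add.prems]] show ?case by (simp add: distrib_left)
next
  case (mult f g)
  from mult.IH(2)[OF mult.IH(1)[OF mult.prems]] show ?case by (simp add: mult.assoc)
qed

lemma continuous_on_tor_emb [continuous_intros]: "continuous_on S tor_emb"
  unfolding tor_emb_def by (intro continuous_intros)

lemma compact_torus: "compact (sphere (0::complex) 1 \<times> sphere (0::complex) 1)"
  by (intro compact_Times compact_sphere)

text \<open>Stone-Weierstrass on the torus in \<complex>^2: a real polynomial \<open>h\<close>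
  approximates \<open>g\<close> uniformly, its product with \<open>F\<close> has integral 0, and the
  error is at most \<open>e\<close> times the integral of the modulus of \<open>F\<close>.\<close>

lemma allcoef0_continuous:
  assumes F: "allcoef0 F" and g: "continuous_on UNIV (g :: complex \<times> complex \<Rightarrow> real)"
  shows "(\<integral>x. F x * complex_of_real (g (tor_emb x)) \<partial>TM) = 0"
proof -
  let ?I = "\<integral>x. norm (F x) \<partial>TM"
  have intF: "integrable TM F" using F by (simp add: allcoef0_def)
  have emb: "tor_emb x \<in> sphere 0 1 \<times> sphere 0 1" for x
    by (simp add: tor_emb_def)
  obtain B where B: "\<And>z. z \<in> sphere (0::complex) 1 \<times> sphere (0::complex) 1 \<Longrightarrow> norm (g z) \<le> B"
    using compact_continuous_image[OF continuous_on_subset[OF g] compact_torus]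
    by (metis bounded_iff compact_imp_bounded imageI subset_UNIV)
  have gm: "(\<lambda>x. g (tor_emb x)) \<in> borel_measurable TM"
    by (intro continuous_borel_measurable_TM continuous_on_compose2[OF g] continuous_on_tor_emb) auto
  have intFg: "integrable TM (\<lambda>x. F x * complex_of_real (g (tor_emb x)))"
  proof (rule Bochner_Integration.integrable_bound)
    show "integrable TM (\<lambda>x. B * norm (F x))" using intF by simp
    show "(\<lambda>x. F x * complex_of_real (g (tor_emb x))) \<in> borel_measurable TM"
      using intF gm by measurable
    show "AE x in TM. norm (F x * complex_of_real (g (tor_emb x))) \<le> norm (B * norm (F x))"
      using B[OF emb] by (intro AE_I2) (auto simp: norm_mult mult.commute[of "cmod _"] abs_mult intro!: mult_right_mono order_trans[OF _ abs_ge_self])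
  qed
  have "norm (\<integral>x. F x * complex_of_real (g (tor_emb x)) \<partial>TM) \<le> e * ?I" if e: "e > 0" for e
  proof -
    obtain h where h: "real_polynomial_function h"
      and gh: "\<And>z. z \<in> sphere (0::complex) 1 \<times> sphere (0::complex) 1 \<Longrightarrow> \<bar>g z - h z\<bar> < e"
      using Stone_Weierstrass_real_polynomial_function[OF compact_torus continuous_on_subset[OF g] e] by blast
    have Fh: "allcoef0 (\<lambda>x. F x * complex_of_real (h (tor_emb x)))"
      by (rule allcoef0_polynomial[OF h F])
    then have "integrable TM (\<lambda>x. F x * complex_of_real (h (tor_emb x)))"
      and "(\<integral>x. F x * complex_of_real (h (tor_emb x)) * ek 0 x \<partial>TM) = 0"
      unfolding allcoef0_def by blast+
    then have "(\<integral>x. F x * complex_of_real (g (tor_emb x)) \<partial>TM) =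
        (\<integral>x. F x * complex_of_real (g (tor_emb x)) - F x * complex_of_real (h (tor_emb x)) \<partial>TM)"
      using intFg by simp
    also have "norm \<dots> \<le> (\<integral>x. e * norm (F x) \<partial>TM)"
    proof (rule Bochner_Integration.integral_norm_bound_integral)
      show "integrable TM (\<lambda>x. F x * complex_of_real (g (tor_emb x)) - F x * complex_of_real (h (tor_emb x)))"
        using intFg Fh by (simp add: allcoef0_def)
      show "integrable TM (\<lambda>x. e * norm (F x))" using intF by simp
      fix x
      have "norm (F x * complex_of_real (g (tor_emb x)) - F x * complex_of_real (h (tor_emb x))) = norm (F x) * \<bar>g (tor_emb x) - h (tor_emb x)\<bar>"
        by (metis norm_mult norm_of_real of_real_diff right_diff_distrib)
      also have "\<dots> \<le> norm (F x) * e"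
        using gh[OF emb[of x]] by (intro mult_left_mono) auto
      finally show "norm (F x * complex_of_real (g (tor_emb x)) - F x * complex_of_real (h (tor_emb x))) \<le> e * norm (F x)"
        by (simp add: mult.commute)
    qed
    finally show ?thesis by simp
  qed
  note small = this
  \<comment> \<open>Dividing by \<open>1 + ?I\<close> avoids a case distinction on
    \<open>?I = 0\<close>; the sum \<open>0 + d\<close> is the shape that
    \<open>field_le_epsilon\<close> expects.\<close>
  have "norm (\<integral>x. F x * complex_of_real (g (tor_emb x)) \<partial>TM) \<le> 0 + d" if "d > 0" for d
  proof -
    have I: "?I \<ge> 0" by simp
    have "d / (1 + ?I) > 0" using that I by (intro divide_pos_pos) linarith+
    then have "norm (\<integral>x. F x * complex_of_real (g (tor_emb x)) \<partial>TM) \<le> d / (1 + ?I) * ?I"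
      by (rule small)
    also have "\<dots> \<le> d / (1 + ?I) * (1 + ?I)"
      using \<open>d / (1 + ?I) > 0\<close> by (intro mult_left_mono) auto
    also have "\<dots> = d"
      using \<open>d / (1 + ?I) > 0\<close> by (cases "1 + ?I = 0") auto
    finally show ?thesis by simp
  qed
  then show ?thesis
    using field_le_epsilon[of "norm (\<integral>x. F x * complex_of_real (g (tor_emb x)) \<partial>TM)" 0] by auto
qed

text \<open>The two numbers differ by an integer, and with one of them strictly inside the unit
  interval that integer lies strictly between -1 and 1. Two endpoints 0 and 1 would be
  identified.\<close>

lemma cis_2pi_inj:
  assumes "cis (2 * pi * a) = cis (2 * pi * b)" "0 \<le> a" "a \<le> 1" "0 < b" "b < 1"
  shows "a = b"
proof -
  obtain n :: int where n: "2 * pi * a = 2 * pi * b + 2 * pi * of_int n"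
    using assms(1) by (metis cis.code complex.inject sin_cos_eq_iff)
  then have "a = b + of_int n" by (simp flip: distrib_left)
  moreover from this have "of_int n < (1::real)" "of_int n > (-1::real)" using assms by linarith+
  ultimately show ?thesis by auto
qed


lemma tor_emb_eq_imp:
  assumes "tor_emb x = tor_emb y" "x \<in> Tor" "y \<in> box (0, 0) (1, 1)"
  shows "x = y"
  using assms cis_2pi_inj[of "fst x" "fst y"] cis_2pi_inj[of "snd x" "snd y"]
  by (auto simp: tor_emb_def ek_def kdot_def Tor_def mem_box Basis_prod_def prod_eq_iff inner_prod_def)

text \<open>The functions \<open>g n\<close> are distance cutoffs on \<complex>^2 that decrease to
  the indicator of the compact image of \<open>K\<close>. As \<open>K\<close> lies in the open
  square, a point of \<open>Tor\<close> with image in that set belongs to \<open>K\<close>; hence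
  the cutoffs composed with \<open>tor_emb\<close> tend to the indicator of \<open>K\<close>, and
  dominated convergence applies.\<close>

lemma allcoef0_compact:
  assumes F: "allcoef0 F" and K: "compact K" "K \<subseteq> box (0, 0) (1, 1)"
  shows "(\<integral>x. F x * indicator K x \<partial>TM) = 0"
\<comment> \<open>The empty set is split off because \<open>infdist\<close> to it is 0 by
  convention, which would make every cutoff equal to 1.\<close>
proof (cases "K = {}")
  case False
  define g where "g n z = max 0 (1 - real n * infdist z (tor_emb ` K))" for n :: nat and z
  have intF: "integrable TM F" using F by (simp add: allcoef0_def)
  have gc: "continuous_on UNIV (g n)" for n
    unfolding g_def by (intro continuous_intros)
  have closed: "closed (tor_emb ` K)"
    by (intro compact_imp_closed compact_continuous_image continuous_on_tor_emb K)
  have lim: "(\<lambda>n. F x * complex_of_real (g n (tor_emb x))) \<longlonglongrightarrow> F x * indicator K x" if "x \<in> Tor" for x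
  proof (cases "x \<in> K")
    case True
    then have "infdist (tor_emb x) (tor_emb ` K) = 0"
      by (simp add: infdist_zero)
    then show ?thesis using True by (simp add: g_def)
  next
    case nK: False
    then have "tor_emb x \<notin> tor_emb ` K"
      using K(2) that tor_emb_eq_imp by blast
    then have "infdist (tor_emb x) (tor_emb ` K) \<noteq> 0"
      using False in_closed_iff_infdist_zero[OF closed] by simp
    then have pos: "infdist (tor_emb x) (tor_emb ` K) > 0"
      using infdist_nonneg[of "tor_emb x" "tor_emb ` K"] by linarith
    then obtain N :: nat where N: "real N * infdist (tor_emb x) (tor_emb ` K) > 1"
      using reals_Archimedean3 by blast
    have "g n (tor_emb x) = 0" if "n \<ge> N" for n
    proof -
      have "real N * infdist (tor_emb x) (tor_emb ` K) \<le> real n * infdist (tor_emb x) (tor_emb ` K)"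
        using that pos by (intro mult_right_mono) auto
      then show ?thesis using N by (simp add: g_def)
    qed
    then have "\<forall>\<^sub>F n in sequentially. F x * complex_of_real (g n (tor_emb x)) = 0"
      unfolding eventually_sequentially by auto
    then show ?thesis using nK by (simp add: tendsto_eventually)
  qed
  have "(\<lambda>n. \<integral>x. F x * complex_of_real (g n (tor_emb x)) \<partial>TM) \<longlonglongrightarrow> (\<integral>x. F x * indicator K x \<partial>TM)"
  proof (rule integral_dominated_convergence)
    show "integrable TM (\<lambda>x. norm (F x))" using intF by simp
    have [measurable]: "K \<inter> Tor \<in> sets TM"
      using K(1) by (auto simp: sets_restrict_space compact_imp_closed)
    have "(\<lambda>x. F x * indicator (K \<inter> Tor) x) \<in> borel_measurable TM"
      using intF by measurable
    then show "(\<lambda>x. F x * indicator K x) \<in> borel_measurable TM"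
      by (rule measurable_cong[THEN iffD1, rotated]) (auto simp: indicator_def)
    have [measurable]: "(\<lambda>x. g n (tor_emb x)) \<in> borel_measurable TM" for n
      by (intro continuous_borel_measurable_TM continuous_on_compose2[OF gc] continuous_on_tor_emb) auto
    show "(\<lambda>x. F x * complex_of_real (g n (tor_emb x))) \<in> borel_measurable TM" for n
      using intF by measurable
    show "AE x in TM. (\<lambda>n. F x * complex_of_real (g n (tor_emb x))) \<longlonglongrightarrow> F x * indicator K x"
      using lim by (intro AE_I2) auto
    have "norm (F x * complex_of_real (g n (tor_emb x))) \<le> norm (F x)" for n x
      using infdist_nonneg[of "tor_emb x" "tor_emb ` K"]
      by (auto simp: norm_mult g_def intro!: mult_left_le)
    then show "AE x in TM. norm (F x * complex_of_real (g n (tor_emb x))) \<le> norm (F x)" for n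
      by (intro AE_I2) auto
  qed
  then show ?thesis
    using allcoef0_continuous[OF F gc] by (simp add: LIMSEQ_const_iff)
qed simp

lemma AE_TM_box: "AE x in TM. x \<in> box (0, 0) (1, 1)"
proof -
  have "negligible (cbox (0::real, 0::real) (1, 1) - box (0, 0) (1, 1))"
    by (rule negligible_frontier_interval)
  then have "AE x in lebesgue. x \<notin> cbox (0::real, 0::real) (1, 1) - box (0, 0) (1, 1)"
    by (intro AE_not_in) (simp add: negligible_iff_null_sets)
  then show ?thesis
    by (subst AE_restrict_space_iff) (auto simp: Tor_cbox)
qed

text \<open>Inner regularity: up to a null set, the part of \<open>{f > 0}\<close> in the open
  square is a countable union of compact sets. On each of them \<open>f\<close> is positive with
  integral 0, so each is null.\<close>

lemma fcoef_0_imp_AE_nonpos: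
  assumes f: "integrable TM f" and 0: "\<And>k. fcoef f k = 0"
  shows "AE x in TM. f x \<le> 0"
proof -
  have F: "allcoef0 (\<lambda>x. complex_of_real (f x))"
    using f 0[of "- _"] by (simp add: allcoef0_def fcoef_ek)
  define P where "P = {x \<in> Tor. f x > 0} \<inter> box (0, 0) (1, 1)"
  have "{x \<in> space TM. f x > 0} \<in> sets TM"
    using f by measurable
  then have "{x \<in> Tor. f x > 0} \<in> sets lebesgue"
    by (auto simp: sets_restrict_space)
  then have "P \<in> sets lebesgue"
    unfolding P_def by auto
  then obtain C N where CN: "fsigma C" "N \<in> null_sets lebesgue" "C \<union> N = P"
    using lebesgue_set_almost_fsigma by metis
  then obtain K :: "nat \<Rightarrow> (real \<times> real) set" where "range K \<subseteq> Collect compact" and "C = (\<Union>n. K n)"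
    unfolding fsigma_Union_compact by blast
  then have K: "\<And>n. compact (K n)" "C = (\<Union>n. K n)"
    by auto
  have "AE x in TM. x \<notin> K n" for n
  proof -
    have sub: "K n \<subseteq> P" using K CN by auto
    have [measurable]: "K n \<in> sets TM"
      using sub K(1)[of n] by (auto simp: sets_restrict_space P_def compact_imp_closed intro!: image_eqI[of _ _ "K n"])
    have int: "integrable TM (\<lambda>x. f x * indicator (K n) x)"
      using f by (intro integrable_real_mult_indicator) auto
    have "complex_of_real (\<integral>x. f x * indicator (K n) x \<partial>TM) = (\<integral>x. complex_of_real (f x) * indicator (K n) x \<partial>TM)"
      by (subst integral_complex_of_real[symmetric]) (auto intro!: Bochner_Integration.integral_cong simp: indicator_def)
    also have "\<dots> = 0"
      using allcoef0_compact[OF F K(1)] sub by (auto simp: P_def)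
    finally have "(\<integral>x. f x * indicator (K n) x \<partial>TM) = 0" by simp
    then have "AE x in TM. f x * indicator (K n) x = 0"
      using sub by (subst (asm) integral_nonneg_eq_0_iff_AE[OF int]) (auto simp: P_def indicator_def intro!: AE_I2)
    then show ?thesis
      by eventually_elim (use sub in \<open>auto simp: P_def indicator_def split: if_splits\<close>)
  qed
  then have "AE x in TM. \<forall>n. x \<notin> K n"
    by (simp add: AE_all_countable)
  moreover have "AE x in TM. x \<notin> N"
    using AE_not_in[OF CN(2)] by (subst AE_restrict_space_iff) auto
  ultimately show ?thesis
    using AE_TM_box AE_space[of TM]
  proof eventually_elim
    case (elim x)
    then have "x \<notin> P" using CN K by auto
    then show ?case using elim by (auto simp: P_def)
  qed
qed

lemma fcoef_uminus: "fcoef (\<lambda>x. - f x) k = - fcoef f k"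
  by (simp add: fcoef_ek)

lemma fcoef_diff:
  "integrable TM f \<Longrightarrow> integrable TM g \<Longrightarrow> fcoef (\<lambda>x. f x - g x) k = fcoef f k - fcoef g k"
  by (simp add: fcoef_ek left_diff_distrib integrable_mult_ek)

theorem fcoef_0_imp_AE_0:
  assumes f: "integrable TM f" and 0: "\<And>k. fcoef f k = 0"
  shows "AE x in TM. f x = 0"
proof -
  have "AE x in TM. - f x \<le> 0"
    using f 0 by (intro fcoef_0_imp_AE_nonpos) (auto simp: fcoef_uminus)
  with fcoef_0_imp_AE_nonpos[OF assms] show ?thesis
    by eventually_elim auto
qed

corollary fcoef_eq_imp_AE_eq:
  assumes "integrable TM f" "integrable TM g" "\<And>k. fcoef f k = fcoef g k"
  shows "AE x in TM. f x = g x"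
  using fcoef_0_imp_AE_0[of "\<lambda>x. f x - g x"] assms by (simp add: fcoef_diff)

subsection \<open>Square integrable functions and the Riesz--Fischer theorem\<close>

lemma integrable_mult_square_integrable:
  fixes f g :: "'a \<Rightarrow> real"
  assumes [measurable]: "f \<in> borel_measurable M" "g \<in> borel_measurable M"
    and "integrable M (\<lambda>x. (f x)\<^sup>2)" "integrable M (\<lambda>x. (g x)\<^sup>2)"
  shows "integrable M (\<lambda>x. f x * g x)"
proof (rule Bochner_Integration.integrable_bound)
  show "integrable M (\<lambda>x. (f x)\<^sup>2 + (g x)\<^sup>2)" using assms by simp
  have "\<bar>a * b\<bar> \<le> a\<^sup>2 + b\<^sup>2" for a b :: real
  proof -
    have "2 * (\<bar>a\<bar> * \<bar>b\<bar>) \<le> a\<^sup>2 + b\<^sup>2"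
      using sum_squares_bound[of "\<bar>a\<bar>" "\<bar>b\<bar>"] by simp
    moreover have "0 \<le> \<bar>a\<bar> * \<bar>b\<bar>" by simp
    ultimately show ?thesis unfolding abs_mult by linarith
  qed
  then show "AE x in M. norm (f x * g x) \<le> norm ((f x)\<^sup>2 + (g x)\<^sup>2)"
    by (intro AE_I2) auto
qed measurable

text \<open>The integral of \<open>(t * \<bar>f x\<bar> - \<bar>g x\<bar>)\<^sup>2\<close> is a
  nonnegative quadratic polynomial in \<open>t\<close>; its value at the minimiser
  \<open>I / A\<close> gives the inequality.\<close>

lemma Cauchy_Schwarz_integral_abs:
  fixes f g :: "'a \<Rightarrow> real"
  assumes f: "f \<in> borel_measurable M" and g: "g \<in> borel_measurable M"
    and f2: "integrable M (\<lambda>x. (f x)\<^sup>2)" and g2: "integrable M (\<lambda>x. (g x)\<^sup>2)"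
  shows "(\<integral>x. \<bar>f x * g x\<bar> \<partial>M) \<le> sqrt (\<integral>x. (f x)\<^sup>2 \<partial>M) * sqrt (\<integral>x. (g x)\<^sup>2 \<partial>M)"
proof -
  define A B I where "A = (\<integral>x. (f x)\<^sup>2 \<partial>M)" and "B = (\<integral>x. (g x)\<^sup>2 \<partial>M)" and "I = (\<integral>x. \<bar>f x * g x\<bar> \<partial>M)"
  have fg: "integrable M (\<lambda>x. \<bar>f x * g x\<bar>)"
    using integrable_mult_square_integrable[OF f g f2 g2] by simp
  have nn: "A \<ge> 0" "B \<ge> 0" "I \<ge> 0" by (auto simp: A_def B_def I_def)
  have quad: "A * t\<^sup>2 - 2 * t * I + B \<ge> 0" for t
  proof -
    have "0 \<le> (\<integral>x. (t * \<bar>f x\<bar> - \<bar>g x\<bar>)\<^sup>2 \<partial>M)" by simp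
    also have "\<dots> = (\<integral>x. t\<^sup>2 * (f x)\<^sup>2 - 2 * t * \<bar>f x * g x\<bar> + (g x)\<^sup>2 \<partial>M)"
      by (intro Bochner_Integration.integral_cong) (auto simp: power2_diff power_mult_distrib abs_mult)
    also have "\<dots> = A * t\<^sup>2 - 2 * t * I + B"
      using f2 g2 fg by (simp add: A_def B_def I_def)
    finally show ?thesis .
  qed
  have "I\<^sup>2 \<le> A * B"
  proof (cases "A = 0")
    case True
    have "I = 0"
    proof (rule ccontr)
      assume "I \<noteq> 0"
      \<comment> \<open>With \<open>A = 0\<close> the polynomial is affine in \<open>t\<close>, and
        this \<open>t\<close> gives it the value -1.\<close>
      then have "A * ((B + 1) / (2 * I))\<^sup>2 - 2 * ((B + 1) / (2 * I)) * I + B = -1" 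
        using True by (simp add: field_simps)
      with quad[of "(B + 1) / (2 * I)"] show False by simp
    qed
    then show ?thesis using nn by simp
  next
    case False
    have "A * (I / A)\<^sup>2 - 2 * (I / A) * I + B = B - I\<^sup>2 / A"
      using False by (simp add: power2_eq_square field_simps)
    with quad[of "I / A"] have "I\<^sup>2 / A \<le> B" by simp
    then show ?thesis using False nn by (simp add: field_simps)
  qed
  then have "sqrt (I\<^sup>2) \<le> sqrt (A * B)" by (rule real_sqrt_le_mono)
  then show ?thesis using nn by (simp add: real_sqrt_mult A_def B_def I_def)
qed

lemma L2fun_integrable: "L2fun f \<Longrightarrow> integrable TM f"
  using integrable_mult_square_integrable[of f TM "\<lambda>_. 1"] by (simp add: L2fun_def)

lemma L2norm_nonneg [simp]: "L2norm f \<ge> 0"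
  by (simp add: L2norm_def)

lemma L2norm_square: "(L2norm f)\<^sup>2 = (\<integral>x. (f x)\<^sup>2 \<partial>TM)"
  by (simp add: L2norm_def)

lemma L2fun_diff:
  assumes "L2fun f" "L2fun g"
  shows "L2fun (\<lambda>x. f x - g x)"
proof -
  have "integrable TM (\<lambda>x. (f x)\<^sup>2 - 2 * (f x * g x) + (g x)\<^sup>2)"
    using assms integrable_mult_square_integrable[of f TM g] by (simp add: L2fun_def)
  then show ?thesis
    using assms by (auto simp: L2fun_def power2_diff algebra_simps)
qed

lemma integral_abs_le_L2norm:
  assumes "L2fun f"
  shows "(\<integral>x. \<bar>f x\<bar> \<partial>TM) \<le> L2norm f"
  using Cauchy_Schwarz_integral_abs[of f TM "\<lambda>_. 1"] assms measure_TM
  by (simp add: L2fun_def L2norm_def)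

lemma fcoef_minus: "fcoef f (- k) = cnj (fcoef f k)"
proof -
  have "fcoef f (- k) = (\<integral>x. cnj (complex_of_real (f x) * ek (- k) x) \<partial>TM)"
    by (simp add: fcoef_ek cnj_ek)
  then show ?thesis by (simp only: fcoef_ek Bochner_Integration.integral_cnj)
qed

lemma norm_fcoef_le: "cmod (fcoef f k) \<le> (\<integral>x. \<bar>f x\<bar> \<partial>TM)"
proof -
  have "cmod (fcoef f k) \<le> (\<integral>x. norm (complex_of_real (f x) * ek (- k) x) \<partial>TM)"
    unfolding fcoef_ek by (rule integral_norm_bound)
  then show ?thesis by (simp add: norm_mult)
qed

section \<open>Trigonometric polynomials, Bessel, Riesz-Fischer and Parseval\<close>

definition trigpoly :: "(int \<times> int \<Rightarrow> complex) \<Rightarrow> (int \<times> int) set \<Rightarrow> real \<times> real \<Rightarrow> complex" where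
  "trigpoly c A x = (\<Sum>k\<in>A. c k * ek k x)"

lemma continuous_on_trigpoly: "continuous_on S (trigpoly c A)"
  unfolding trigpoly_def by (intro continuous_intros)

lemma trigpoly_measurable [measurable]: "trigpoly c A \<in> borel_measurable TM"
  by (intro continuous_borel_measurable_TM continuous_on_trigpoly)

lemma integral_norm_trigpoly_square:
  assumes "finite A"
  shows "integrable TM (\<lambda>x. (cmod (trigpoly c A x))\<^sup>2)"
    and "(\<integral>x. (cmod (trigpoly c A x))\<^sup>2 \<partial>TM) = (\<Sum>k\<in>A. (cmod (c k))\<^sup>2)"
proof -
  show int: "integrable TM (\<lambda>x. (cmod (trigpoly c A x))\<^sup>2)"
    unfolding Tor_cbox by (intro continuous_imp_integrable continuous_intros continuous_on_trigpoly)
  have "complex_of_real (\<integral>x. (cmod (trigpoly c A x))\<^sup>2 \<partial>TM) = (\<integral>x. complex_of_real ((cmod (trigpoly c A x))\<^sup>2) \<partial>TM)"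
    by (rule integral_complex_of_real[symmetric])
  also have "\<dots> = (\<integral>x. (\<Sum>k\<in>A. \<Sum>l\<in>A. c k * cnj (c l) * ek (k - l) x) \<partial>TM)"
  proof (intro Bochner_Integration.integral_cong refl)
    fix x
    have "complex_of_real ((cmod (trigpoly c A x))\<^sup>2) = trigpoly c A x * cnj (trigpoly c A x)"
      by (simp only: complex_norm_square)
    also have "\<dots> = (\<Sum>k\<in>A. \<Sum>l\<in>A. (c k * ek k x) * cnj (c l * ek l x))"
      by (simp add: trigpoly_def sum_product)
    also have "\<dots> = (\<Sum>k\<in>A. \<Sum>l\<in>A. c k * cnj (c l) * ek (k - l) x)"
      using ek_add[of _ "- _" x] by (intro sum.cong) (auto simp: cnj_ek algebra_simps)
    finally show "complex_of_real ((cmod (trigpoly c A x))\<^sup>2) = (\<Sum>k\<in>A. \<Sum>l\<in>A. c k * cnj (c l) * ek (k - l) x)" .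
  qed
  also have "\<dots> = (\<Sum>k\<in>A. \<Sum>l\<in>A. c k * cnj (c l) * (if k = l then 1 else 0))"
    by (simp add: integral_ek Bochner_Integration.integral_sum)
  also have "\<dots> = (\<Sum>k\<in>A. c k * cnj (c k))"
    using assms by (intro sum.cong) (auto simp: if_distrib sum.delta cong: if_cong)
  also have "\<dots> = complex_of_real (\<Sum>k\<in>A. (cmod (c k))\<^sup>2)"
    by (simp add: complex_norm_square flip: of_real_power)
  finally show "(\<integral>x. (cmod (trigpoly c A x))\<^sup>2 \<partial>TM) = (\<Sum>k\<in>A. (cmod (c k))\<^sup>2)"
    using of_real_eq_iff by blast
qed

text \<open>The squared distance from \<open>f\<close> to its partial Fourier sum \<open>t\<close>
  is nonnegative. As \<open>f\<close> is real only \<open>Re (t x)\<close> enters the cross term,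
  and \<open>fcoef_minus\<close> turns that term into the sum of squared moduli.\<close>

lemma Bessel_finite:
  assumes f: "L2fun f" and A: "finite A"
  shows "(\<Sum>k\<in>A. (cmod (fcoef f k))\<^sup>2) \<le> (L2norm f)\<^sup>2"
proof -
  define t where "t = trigpoly (fcoef f) A"
  have int: "integrable TM (\<lambda>x. complex_of_real (f x) * t x)"
    using f A unfolding t_def trigpoly_def sum_distrib_left
    by (intro Bochner_Integration.integrable_sum)
       (simp add: mult.left_commute[of "complex_of_real _"] L2fun_integrable integrable_mult_ek)
  have "(\<integral>x. complex_of_real (f x) * t x \<partial>TM) = (\<Sum>k\<in>A. (\<integral>x. fcoef f k * (complex_of_real (f x) * ek k x) \<partial>TM))"
    using f A unfolding t_def trigpoly_def sum_distrib_left
    by (subst Bochner_Integration.integral_sum)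
       (auto simp: mult.left_commute[of "complex_of_real _"] L2fun_integrable integrable_mult_ek)
  also have "\<dots> = (\<Sum>k\<in>A. fcoef f k * fcoef f (- k))"
    by (simp add: fcoef_ek)
  also have "\<dots> = complex_of_real (\<Sum>k\<in>A. (cmod (fcoef f k))\<^sup>2)"
    by (simp add: fcoef_minus complex_norm_square flip: of_real_power)
  finally have 1: "(\<integral>x. f x * Re (t x) \<partial>TM) = (\<Sum>k\<in>A. (cmod (fcoef f k))\<^sup>2)"
    using integral_Re[OF int] by simp
  have int1: "integrable TM (\<lambda>x. f x * Re (t x))"
    using integrable_Re[OF int] by simp
  have "0 \<le> (\<integral>x. (cmod (complex_of_real (f x) - t x))\<^sup>2 \<partial>TM)" by simp
  also have "\<dots> = (\<integral>x. (f x)\<^sup>2 - 2 * (f x * Re (t x)) + (cmod (t x))\<^sup>2 \<partial>TM)"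
    by (intro Bochner_Integration.integral_cong) (auto simp: cmod_power2 power2_diff)
  also have "\<dots> = (L2norm f)\<^sup>2 - (\<Sum>k\<in>A. (cmod (fcoef f k))\<^sup>2)"
    using f int1 integral_norm_trigpoly_square[OF A, of "fcoef f"] 1
    by (simp add: L2fun_def L2norm_square t_def)
  finally show ?thesis by simp
qed

lemma Bessel:
  assumes "L2fun f"
  shows "(\<lambda>k. (cmod (fcoef f k))\<^sup>2) summable_on UNIV" "(\<Sum>\<^sub>\<infinity>k. (cmod (fcoef f k))\<^sup>2) \<le> (L2norm f)\<^sup>2"
proof -
  show *: "(\<lambda>k. (cmod (fcoef f k))\<^sup>2) summable_on UNIV"
    by (rule nonneg_bdd_above_summable_on) (auto intro!: bdd_aboveI2 Bessel_finite[OF assms])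
  show "(\<Sum>\<^sub>\<infinity>k. (cmod (fcoef f k))\<^sup>2) \<le> (L2norm f)\<^sup>2"
    by (rule infsum_le_finite_sums[OF *]) (rule Bessel_finite[OF assms])
qed

text \<open>\<open>Re z\<close> is the mean of \<open>z\<close> and \<open>cnj z\<close>, and
  conjugating a character reverses its index. This is the origin of the symmetrised coefficients
  \<open>(c k + cnj (c (- k))) / 2\<close> in the results that follow.\<close>

lemma fcoef_Re_trigpoly:
  assumes "finite A"
  shows "fcoef (\<lambda>x. Re (trigpoly c A x)) l = ((if l \<in> A then c l else 0) + cnj (if - l \<in> A then c (- l) else 0)) / 2"
proof -
  have "complex_of_real (Re (trigpoly c A x)) * ek (- l) x =
     (\<Sum>k\<in>A. c k / 2 * ek (k - l) x) + (\<Sum>k\<in>A. cnj (c k) / 2 * ek (- k - l) x)" for x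
  proof -
    have "complex_of_real (Re (trigpoly c A x)) * ek (- l) x = (trigpoly c A x + cnj (trigpoly c A x)) / 2 * ek (- l) x"
      by (simp add: complex_add_cnj)
    also have "\<dots> = (\<Sum>k\<in>A. c k / 2 * (ek k x * ek (- l) x)) + (\<Sum>k\<in>A. cnj (c k) / 2 * (ek (- k) x * ek (- l) x))"
      by (simp add: trigpoly_def cnj_ek sum_distrib_left sum_distrib_right sum_divide_distrib add_divide_distrib distrib_right distrib_left mult_ac)
    finally show ?thesis by (simp flip: ek_add)
  qed
  then have "fcoef (\<lambda>x. Re (trigpoly c A x)) l =
     (\<Sum>k\<in>A. c k / 2 * (if k - l = 0 then 1 else 0)) + (\<Sum>k\<in>A. cnj (c k) / 2 * (if - k - l = 0 then 1 else 0))"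
    by (simp add: fcoef_ek integral_ek Bochner_Integration.integral_sum)
  also have "(\<Sum>k\<in>A. c k / 2 * (if k - l = 0 then 1 else 0)) = (\<Sum>k\<in>A. if k = l then c k / 2 else 0)"
    by (intro sum.cong) auto
  also have "\<dots> = (if l \<in> A then c l else 0) / 2"
    using assms by simp
  also have "(\<Sum>k\<in>A. cnj (c k) / 2 * (if - k - l = 0 then 1 else 0)) = (\<Sum>k\<in>A. if k = - l then cnj (c k) / 2 else 0)"
    by (intro sum.cong) (auto simp: eq_neg_iff_add_eq_0 neg_eq_iff_add_eq_0 diff_eq_eq)
  also have "\<dots> = cnj (if - l \<in> A then c (- l) else 0) / 2"
    using assms by simp
  finally show ?thesis by (simp add: add_divide_distrib)
qed


text \<open>Real parts of partial sums are taken over nested finite sets \<open>A n\<close> whose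
  tails fall like 4^(-n). The increments then have L^1 norm at most 2^(-n), so their series
  converges absolutely almost everywhere and can be integrated term by term against a character.
  Fatou's lemma gives the norm bound, an inequality because taking real parts may lose mass.\<close>

theorem Riesz_Fischer:
  assumes c: "(\<lambda>k. (cmod (c k))\<^sup>2) summable_on UNIV"
  obtains f where "L2fun f" "\<And>k. fcoef f k = (c k + cnj (c (- k))) / 2"
    "(L2norm f)\<^sup>2 \<le> (\<Sum>\<^sub>\<infinity>k. (cmod (c k))\<^sup>2)"
proof -
  define S where "S = (\<Sum>\<^sub>\<infinity>k. (cmod (c k))\<^sup>2)"
  have le_S: "(\<Sum>k\<in>B. (cmod (c k))\<^sup>2) \<le> S" if "finite B" for B
    unfolding S_def by (rule finite_sum_le_infsum[OF c that]) auto
  \<comment> \<open>\<open>(1/4) ^ n\<close> bounds squared norms, so that the norms themselves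
    decay like the summable \<open>(1/2) ^ n\<close>.\<close>
  have "\<exists>F. finite F \<and> (\<Sum>k\<in>F. (cmod (c k))\<^sup>2) \<ge> S - (1/4) ^ n" for n :: nat
    using infsum_finite_approximation[OF c, of "(1/4) ^ n"] unfolding S_def dist_real_def
    by (auto simp: abs_le_iff)
  then obtain F where F: "\<And>n. finite (F n)" "\<And>n. (\<Sum>k\<in>F n. (cmod (c k))\<^sup>2) \<ge> S - (1/4) ^ n"
    by metis
  define A where "A n = (\<Union>i\<le>n. F i)" for n
  have A: "finite (A n)" for n using F by (simp add: A_def)
  have A_mono: "A n \<subseteq> A (Suc n)" for n unfolding A_def by (intro UN_mono) auto
  have outside: "(\<Sum>k\<in>B. (cmod (c k))\<^sup>2) \<le> (1/4) ^ n" if B: "finite B" "B \<inter> A n = {}" for B n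
  proof -
    have "B \<inter> F n = {}" using B by (auto simp: A_def)
    then have "(\<Sum>k\<in>B. (cmod (c k))\<^sup>2) + (\<Sum>k\<in>F n. (cmod (c k))\<^sup>2) = (\<Sum>k\<in>B \<union> F n. (cmod (c k))\<^sup>2)"
      using B F by (simp add: sum.union_disjoint)
    also have "\<dots> \<le> S" using B F by (intro le_S) auto
    finally show ?thesis using F(2)[of n] by simp
  qed
  define s where "s n x = Re (trigpoly c (A n) x)" for n x
  define d where "d n x = s (Suc n) x - s n x" for n x
  have d_eq: "d n x = Re (trigpoly c (A (Suc n) - A n) x)" for n x
    unfolding d_def s_def trigpoly_def using A A_mono[of n]
    by (subst sum_diff) auto
  have Re_L2: "L2fun (\<lambda>x. Re (trigpoly c B x))" and Re_norm: "(L2norm (\<lambda>x. Re (trigpoly c B x)))\<^sup>2 \<le> (\<Sum>k\<in>B. (cmod (c k))\<^sup>2)"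
    if "finite B" for B
  proof -
    have le: "(Re z)\<^sup>2 \<le> (cmod z)\<^sup>2" for z
      by (simp add: cmod_power2)
    have int: "integrable TM (\<lambda>x. (Re (trigpoly c B x))\<^sup>2)"
      by (rule Bochner_Integration.integrable_bound[OF integral_norm_trigpoly_square(1)[OF that, of c]])
         (use le in auto)
    then show "L2fun (\<lambda>x. Re (trigpoly c B x))" by (simp add: L2fun_def)
    have "(\<integral>x. (Re (trigpoly c B x))\<^sup>2 \<partial>TM) \<le> (\<integral>x. (cmod (trigpoly c B x))\<^sup>2 \<partial>TM)"
      by (intro integral_mono int integral_norm_trigpoly_square(1) that le)
    then show "(L2norm (\<lambda>x. Re (trigpoly c B x)))\<^sup>2 \<le> (\<Sum>k\<in>B. (cmod (c k))\<^sup>2)"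
      using integral_norm_trigpoly_square(2)[OF that, of c] by (simp add: L2norm_square)
  qed
  have sL2: "L2fun (s n)" and dL2: "L2fun (d n)" for n
    unfolding s_def d_eq using A by (auto intro!: Re_L2)
  have s_int [measurable, simp]: "integrable TM (s n)" and d_int [measurable, simp]: "integrable TM (d n)" for n
    using sL2 dL2 by (auto intro: L2fun_integrable)
  have d_small: "(\<integral>x. \<bar>d n x\<bar> \<partial>TM) \<le> (1/2) ^ n" for n
  proof -
    have "(L2norm (d n))\<^sup>2 \<le> (1/4) ^ n"
      unfolding d_eq using A by (intro order_trans[OF Re_norm outside]) auto
    also have "(1/4::real) ^ n = ((1/2) ^ n)\<^sup>2"
      by (simp add: power2_eq_square flip: power_mult_distrib)
    finally have "L2norm (d n) \<le> (1/2) ^ n"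
      by (rule power2_le_imp_le) simp
    then show ?thesis using integral_abs_le_L2norm[OF dL2[of n]] by linarith
  qed
  have sum_d: "summable (\<lambda>n. \<integral>x. \<bar>d n x\<bar> \<partial>TM)"
    by (rule summable_comparison_test'[of "\<lambda>n. (1/2::real) ^ n" 0]) (use d_small in auto)
  have AE_sum: "AE x in TM. summable (\<lambda>n. \<bar>d n x\<bar>)"
  proof -
    have "(\<integral>\<^sup>+x. (\<Sum>n. ennreal \<bar>d n x\<bar>) \<partial>TM) = (\<Sum>n. \<integral>\<^sup>+x. ennreal \<bar>d n x\<bar> \<partial>TM)"
      by (rule nn_integral_suminf) measurable
    also have "\<dots> = (\<Sum>n. ennreal (\<integral>x. \<bar>d n x\<bar> \<partial>TM))"
      by (intro suminf_cong nn_integral_eq_integral) auto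
    also have "\<dots> \<noteq> \<infinity>"
      using sum_d by (simp add: ennreal_suminf_neq_top)
    finally have "AE x in TM. (\<Sum>n. ennreal \<bar>d n x\<bar>) \<noteq> \<infinity>"
      by (intro nn_integral_PInf_AE) measurable
    then show ?thesis
      by eventually_elim (auto intro: summable_suminf_not_top)
  qed
  define f where "f x = s 0 x + (\<Sum>n. d n x)" for x
  have f_int: "integrable TM f"
    unfolding f_def using AE_sum sum_d by (intro Bochner_Integration.integrable_add integrable_suminf) auto
  have s_tele: "s n x = s 0 x + (\<Sum>i<n. d i x)" for n x
    by (induction n) (auto simp: d_def)
  have AE_lim: "AE x in TM. (\<lambda>n. s n x) \<longlonglongrightarrow> f x"
    using AE_sum
  proof eventually_elim
    case (elim x)
    then have "(\<lambda>n. \<Sum>i<n. d i x) \<longlonglongrightarrow> (\<Sum>n. d n x)"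
      by (rule summable_LIMSEQ[OF summable_rabs_cancel])
    then have "(\<lambda>n. s 0 x + (\<Sum>i<n. d i x)) \<longlonglongrightarrow> f x"
      unfolding f_def by (intro tendsto_intros)
    then show ?case by (simp only: s_tele[symmetric])
  qed
  have coef: "fcoef f l = (c l + cnj (c (- l))) / 2" for l
  proof -
    define e where "e n x = complex_of_real (d n x) * ek (- l) x" for n x
    have e_int: "integrable TM (e n)" for n
      unfolding e_def by (intro integrable_mult_ek) simp
    have norm_e: "norm (e n x) = \<bar>d n x\<bar>" for n x by (simp add: e_def norm_mult)
    have "(\<lambda>n. integral\<^sup>L TM (e n)) sums (\<integral>x. (\<Sum>n. e n x) \<partial>TM)"
      by (intro sums_integral e_int) (use AE_sum sum_d in \<open>auto simp: norm_e\<close>)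
    moreover have "(\<integral>x. (\<Sum>n. e n x) \<partial>TM) = fcoef f l - fcoef (s 0) l"
    proof -
      have "(\<integral>x. (\<Sum>n. e n x) \<partial>TM) = (\<integral>x. complex_of_real (f x - s 0 x) * ek (- l) x \<partial>TM)"
      proof (rule integral_cong_AE)
        show "(\<lambda>x. \<Sum>n. e n x) \<in> borel_measurable TM"
          using e_int by measurable
        show "(\<lambda>x. complex_of_real (f x - s 0 x) * ek (- l) x) \<in> borel_measurable TM"
          using f_int by measurable
        show "AE x in TM. (\<Sum>n. e n x) = complex_of_real (f x - s 0 x) * ek (- l) x"
          using AE_sum
        proof eventually_elim
          case (elim x)
          then have "(\<lambda>n. d n x) sums (\<Sum>n. d n x)"
            by (rule summable_sums[OF summable_rabs_cancel])
          then have "(\<lambda>n. e n x) sums (complex_of_real (\<Sum>n. d n x) * ek (- l) x)"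
            unfolding e_def by (intro sums_mult2 sums_of_real)
          then show ?case by (simp add: sums_iff f_def)
        qed
      qed
      also have "\<dots> = fcoef (\<lambda>x. f x - s 0 x) l"
        by (simp add: fcoef_ek)
      finally show ?thesis using f_int by (simp add: fcoef_diff)
    qed
    ultimately have "(\<lambda>n. \<Sum>i<n. integral\<^sup>L TM (e i)) \<longlonglongrightarrow> fcoef f l - fcoef (s 0) l"
      by (simp add: sums_def)
    moreover have "(\<Sum>i<n. integral\<^sup>L TM (e i)) = fcoef (s n) l - fcoef (s 0) l" for n
    proof (induction n)
      case (Suc n)
      have "integral\<^sup>L TM (e n) = fcoef (s (Suc n)) l - fcoef (s n) l"
      proof -
        have "integral\<^sup>L TM (e n) = fcoef (d n) l"
          unfolding fcoef_ek e_def ..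
        also have "d n = (\<lambda>x. s (Suc n) x - s n x)"
          by (simp add: d_def fun_eq_iff)
        finally show ?thesis by (simp add: fcoef_diff)
      qed
      then show ?case using Suc by simp
    qed simp
    ultimately have "(\<lambda>n. fcoef (s n) l - fcoef (s 0) l) \<longlonglongrightarrow> fcoef f l - fcoef (s 0) l"
      by simp
    from tendsto_add[OF this tendsto_const[of "fcoef (s 0) l"]]
    have lim1: "(\<lambda>n. fcoef (s n) l) \<longlonglongrightarrow> fcoef f l" by simp
    have lim2: "(\<lambda>n. if k \<in> A n then c k else 0) \<longlonglongrightarrow> c k" for k
    proof (cases "\<exists>N. k \<in> A N")
      case True
      then obtain N where "k \<in> A N" by blast
      then have "k \<in> A n" if "n \<ge> N" for n
        using lift_Suc_mono_le[of A, OF A_mono that] by blast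
      then show ?thesis
        by (intro tendsto_eventually) (auto simp: eventually_sequentially)
    next
      case False
      \<comment> \<open>The singleton of an index that occurs in no \<open>A n\<close> is disjoint
        from all of them, so the tail estimate forces \<open>c k = 0\<close>.\<close>
      have "(cmod (c k))\<^sup>2 \<le> (1/4) ^ n" for n
        using outside[of "{k}" n] False by auto
      moreover have "(\<lambda>n. (1/4::real) ^ n) \<longlonglongrightarrow> 0"
        by (simp add: LIMSEQ_realpow_zero)
      ultimately have "(cmod (c k))\<^sup>2 \<le> 0"
        by (intro LIMSEQ_le_const[of _ 0]) auto
      then have "c k = 0" by simp
      then show ?thesis by (simp cong: if_cong)
    qed
    have "(\<lambda>n. fcoef (s n) l) \<longlonglongrightarrow> (c l + cnj (c (- l))) / 2"
      unfolding s_def fcoef_Re_trigpoly[OF A] by (intro tendsto_intros lim2) simp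
    with lim1 show ?thesis by (rule LIMSEQ_unique)
  qed
  have [measurable]: "f \<in> borel_measurable TM" using f_int by auto
  have "(\<integral>\<^sup>+x. ennreal ((f x)\<^sup>2) \<partial>TM) = (\<integral>\<^sup>+x. liminf (\<lambda>n. ennreal ((s n x)\<^sup>2)) \<partial>TM)"
  proof (rule nn_integral_cong_AE)
    show "AE x in TM. ennreal ((f x)\<^sup>2) = liminf (\<lambda>n. ennreal ((s n x)\<^sup>2))"
      using AE_lim
    proof eventually_elim
      case (elim x)
      then have "(\<lambda>n. ennreal ((s n x)\<^sup>2)) \<longlonglongrightarrow> ennreal ((f x)\<^sup>2)"
        by (intro tendsto_intros tendsto_ennrealI)
      then show ?case by (rule lim_imp_Liminf[OF sequentially_bot, symmetric])
    qed
  qed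
  also have "\<dots> \<le> liminf (\<lambda>n. \<integral>\<^sup>+x. ennreal ((s n x)\<^sup>2) \<partial>TM)"
    by (rule nn_integral_liminf) measurable
  also have "\<dots> \<le> ennreal S"
  proof (rule order_trans[OF Liminf_le_Limsup[OF sequentially_bot] Limsup_bounded], rule always_eventually, rule allI)
    fix n
    have "(\<integral>\<^sup>+x. ennreal ((s n x)\<^sup>2) \<partial>TM) = ennreal ((L2norm (s n))\<^sup>2)"
      using sL2[of n] by (simp add: L2norm_square nn_integral_eq_integral L2fun_def)
    also have "\<dots> \<le> ennreal S"
      unfolding s_def using A by (intro ennreal_leI order_trans[OF Re_norm le_S])
    finally show "(\<integral>\<^sup>+x. ennreal ((s n x)\<^sup>2) \<partial>TM) \<le> ennreal S" .
  qed
  finally have fatou: "(\<integral>\<^sup>+x. ennreal ((f x)\<^sup>2) \<partial>TM) \<le> ennreal S" .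
  have f2: "integrable TM (\<lambda>x. (f x)\<^sup>2)"
    using fatou by (intro integrableI_bounded) (auto simp: less_top[symmetric] top_unique)
  have "S \<ge> 0" using le_S[of "{}"] by simp
  then have "(L2norm f)\<^sup>2 \<le> S"
    using fatou f2 by (simp add: nn_integral_eq_integral L2norm_square)
  moreover have "L2fun f" using f2 by (simp add: L2fun_def)
  ultimately show thesis using that coef S_def by blast
qed

text \<open>For the direction opposite to Bessel, Riesz-Fischer is applied to the coefficients of
  \<open>f\<close>. These are already symmetric because \<open>f\<close> is real, so the resulting
  \<open>g\<close> has the same coefficients, agrees with \<open>f\<close> almost everywhere and
  carries the norm bound.\<close>

theorem Parseval:
  assumes f: "L2fun f"
  shows "(L2norm f)\<^sup>2 = (\<Sum>\<^sub>\<infinity>k. (cmod (fcoef f k))\<^sup>2)"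
proof (rule antisym)
  obtain g where g: "L2fun g" "\<And>k. fcoef g k = (fcoef f k + cnj (fcoef f (- k))) / 2"
    "(L2norm g)\<^sup>2 \<le> (\<Sum>\<^sub>\<infinity>k. (cmod (fcoef f k))\<^sup>2)"
    using Riesz_Fischer[OF Bessel(1)[OF f]] by blast
  have "AE x in TM. f x = g x"
    using f g by (intro fcoef_eq_imp_AE_eq L2fun_integrable) (auto simp: fcoef_minus)
  then have "(\<integral>x. (f x)\<^sup>2 \<partial>TM) = (\<integral>x. (g x)\<^sup>2 \<partial>TM)"
    using f g by (intro integral_cong_AE) (auto simp: L2fun_def)
  then show "(L2norm f)\<^sup>2 \<le> (\<Sum>\<^sub>\<infinity>k. (cmod (fcoef f k))\<^sup>2)"
    using g(3) by (simp add: L2norm_square)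
qed (rule Bessel(2)[OF f])

section \<open>Real-valued synthesis from square-summable coefficients\<close>

definition ell2 :: "(int \<times> int \<Rightarrow> complex) \<Rightarrow> bool" where
  "ell2 c \<longleftrightarrow> (\<lambda>k. (cmod (c k))\<^sup>2) summable_on UNIV"

text \<open>Symmetrising the coefficients makes the synthesis real valued without a condition on \<open>c\<close>.\<close>

definition l2_synth :: "(int \<times> int \<Rightarrow> complex) \<Rightarrow> real \<times> real \<Rightarrow> real" where
  "l2_synth c = (SOME f. L2fun f \<and> (\<forall>k. fcoef f k = (c k + cnj (c (- k))) / 2))"

lemma
  assumes "ell2 c"
  shows L2fun_l2_synth: "L2fun (l2_synth c)" and fcoef_l2_synth: "fcoef (l2_synth c) k = (c k + cnj (c (- k))) / 2"
proof -
  have "\<exists>f. L2fun f \<and> (\<forall>k. fcoef f k = (c k + cnj (c (- k))) / 2)"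
    using Riesz_Fischer assms unfolding ell2_def by metis
  from someI_ex[OF this] show "L2fun (l2_synth c)" "fcoef (l2_synth c) k = (c k + cnj (c (- k))) / 2"
    unfolding l2_synth_def by blast+
qed

lemma norm_add_square_le: "(norm (x + y))\<^sup>2 \<le> 2 * (norm x)\<^sup>2 + 2 * (norm y)\<^sup>2"
  for x y :: "'a::real_normed_vector"
proof -
  have "(norm (x + y))\<^sup>2 \<le> (norm x + norm y)\<^sup>2"
    by (intro power_mono norm_triangle_ineq) auto
  also have "\<dots> \<le> 2 * (norm x)\<^sup>2 + 2 * (norm y)\<^sup>2"
    using sum_squares_bound[of "norm x" "norm y"] by (simp add: power2_sum)
  finally show ?thesis .
qed

lemma ell2_diff:
  assumes "ell2 c" "ell2 d"
  shows "ell2 (\<lambda>k. c k - d k)"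
proof -
  have "(\<lambda>k. 2 * (cmod (c k))\<^sup>2 + 2 * (cmod (d k))\<^sup>2) summable_on UNIV"
    using assms unfolding ell2_def by (intro summable_on_add summable_on_cmult_right)
  then show ?thesis
    unfolding ell2_def
    by (rule summable_on_comparison_test)
       (use norm_add_square_le[of "c _" "- d _"] in auto)
qed

text \<open>By convexity the squared modulus of the mean of \<open>e k\<close> and
  \<open>cnj (e (- k))\<close> is at most the mean of the squared moduli, and reflecting the index
  does not change the sum.\<close>

lemma L2norm_le_of_symmetrised_coef:
  assumes f: "L2fun f" and "ell2 e" and coef: "\<And>k. fcoef f k = (e k + cnj (e (- k))) / 2"
  shows "(L2norm f)\<^sup>2 \<le> (\<Sum>\<^sub>\<infinity>k. (cmod (e k))\<^sup>2)"
proof -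
  have e: "(\<lambda>k. (cmod (e k))\<^sup>2) summable_on UNIV"
    using assms by (simp add: ell2_def)
  have bij: "bij_betw uminus (UNIV :: (int \<times> int) set) UNIV"
    by (simp add: bij_uminus)
  have e': "(\<lambda>k. (cmod (e (- k)))\<^sup>2) summable_on UNIV"
    using e summable_on_reindex_bij_betw[OF bij, of "\<lambda>k. (cmod (e k))\<^sup>2"] by simp
  have e2: "(\<lambda>k. (cmod (e k))\<^sup>2 / 2) summable_on UNIV" and e2': "(\<lambda>k. (cmod (e (- k)))\<^sup>2 / 2) summable_on UNIV"
    using summable_on_cmult_right[OF e, of "1/2"] summable_on_cmult_right[OF e', of "1/2"] by simp_all
  have "(L2norm f)\<^sup>2 = (\<Sum>\<^sub>\<infinity>k. (cmod ((e k + cnj (e (- k))) / 2))\<^sup>2)"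
    unfolding coef[symmetric] by (rule Parseval[OF f])
  also have "\<dots> \<le> (\<Sum>\<^sub>\<infinity>k. (cmod (e k))\<^sup>2 / 2 + (cmod (e (- k)))\<^sup>2 / 2)"
  proof (rule infsum_mono)
    show s: "(\<lambda>k. (cmod (e k))\<^sup>2 / 2 + (cmod (e (- k)))\<^sup>2 / 2) summable_on UNIV"
      by (intro summable_on_add e2 e2')
    show le: "(cmod ((e k + cnj (e (- k))) / 2))\<^sup>2 \<le> (cmod (e k))\<^sup>2 / 2 + (cmod (e (- k)))\<^sup>2 / 2" for k
      using norm_add_square_le[of "e k" "cnj (e (- k))"] by (simp add: norm_divide power_divide)
    show "(\<lambda>k. (cmod ((e k + cnj (e (- k))) / 2))\<^sup>2) summable_on UNIV"
      by (rule summable_on_comparison_test[OF s]) (use le in auto)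
  qed
  also have "\<dots> = (\<Sum>\<^sub>\<infinity>k. (cmod (e k))\<^sup>2)"
  proof -
    have "(\<Sum>\<^sub>\<infinity>k. (cmod (e k))\<^sup>2 / 2 + (cmod (e (- k)))\<^sup>2 / 2) = (\<Sum>\<^sub>\<infinity>k. (cmod (e k))\<^sup>2 / 2) + (\<Sum>\<^sub>\<infinity>k. (cmod (e (- k)))\<^sup>2 / 2)"
      by (intro infsum_add e2 e2')
    also have "(\<Sum>\<^sub>\<infinity>k. (cmod (e (- k)))\<^sup>2 / 2) = (\<Sum>\<^sub>\<infinity>k. (cmod (e k))\<^sup>2 / 2)"
      by (rule infsum_reindex_bij_betw[OF bij, of "\<lambda>k. (cmod (e k))\<^sup>2 / 2"])
    also have "(\<Sum>\<^sub>\<infinity>k. (cmod (e k))\<^sup>2 / 2) = (\<Sum>\<^sub>\<infinity>k. (cmod (e k))\<^sup>2) / 2"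
      using infsum_cmult_right'[of "1/2" "\<lambda>k. (cmod (e k))\<^sup>2" UNIV] by simp
    finally show ?thesis by simp
  qed
  finally show ?thesis .
qed

text \<open>\<open>l2_synth\<close> is chosen by its coefficients alone, so the norm bound is
  recovered from them.\<close>

lemma L2norm_l2_synth: "ell2 c \<Longrightarrow> (L2norm (l2_synth c))\<^sup>2 \<le> (\<Sum>\<^sub>\<infinity>k. (cmod (c k))\<^sup>2)"
  by (rule L2norm_le_of_symmetrised_coef) (simp_all add: L2fun_l2_synth fcoef_l2_synth)

lemma L2norm_l2_synth_diff:
  assumes "ell2 c" "ell2 d"
  shows "(L2norm (\<lambda>x. l2_synth c x - l2_synth d x))\<^sup>2 \<le> (\<Sum>\<^sub>\<infinity>k. (cmod (c k - d k))\<^sup>2)"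
  using assms
  by (intro L2norm_le_of_symmetrised_coef)
     (auto simp: L2fun_l2_synth L2fun_diff ell2_diff fcoef_diff L2fun_integrable fcoef_l2_synth diff_divide_distrib add_divide_distrib)

subsection \<open>The nonlinearity in mean\<close>

definition plap :: "real \<Rightarrow> 'a::real_normed_vector \<Rightarrow> 'a" where
  "plap p a = norm a powr (p - 2) *\<^sub>R a"

lemma plap_0 [simp]: "plap p 0 = 0"
  by (simp add: plap_def)

text \<open>For |b| \<le> |a| the difference is |a|^(p-2) (a - b) + (|a|^(p-2) - |b|^(p-2)) b. The
  second term has norm at most |b|^(p-2) (|a| - |b|), because the power p - 3 is negative and hence
  decreasing in its base.\<close>

lemma norm_plap_diff_le:
  assumes p: "2 < p" "p < 3"
  shows "norm (plap p a - plap p b) \<le> (norm a powr (p - 2) + norm b powr (p - 2)) * norm (a - b)"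
proof -
  have *: "norm (plap p a - plap p b) \<le> (norm a powr (p - 2) + norm b powr (p - 2)) * norm (a - b)"
    if ab: "norm b \<le> norm a" for a b :: 'a
  proof (cases "b = 0")
    case True
    then show ?thesis by (simp add: plap_def)
  next
    case False
    define x y where "x = norm a" and "y = norm b"
    have xy: "0 < y" "y \<le> x" using False ab by (auto simp: x_def y_def)
    have le: "x powr (p - 2) * y \<le> y powr (p - 2) * x"
    proof -
      have "x powr (p - 2) * y = x powr (p - 3) * (x * y)"
        using xy powr_mult_base[of x "p - 3"] by (simp add: mult_ac)
      also have "\<dots> \<le> y powr (p - 3) * (x * y)"
        using xy p by (intro mult_right_mono powr_mono2') auto
      also have "\<dots> = y powr (p - 2) * x"
        using xy powr_mult_base[of y "p - 3"] by (simp add: mult_ac)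
      finally show ?thesis .
    qed
    have "plap p a - plap p b = x powr (p - 2) *\<^sub>R (a - b) + (x powr (p - 2) - y powr (p - 2)) *\<^sub>R b"
      by (simp add: plap_def x_def y_def algebra_simps)
    also have "norm \<dots> \<le> x powr (p - 2) * norm (a - b) + \<bar>x powr (p - 2) - y powr (p - 2)\<bar> * y"
      using norm_triangle_ineq[of "x powr (p - 2) *\<^sub>R (a - b)" "(x powr (p - 2) - y powr (p - 2)) *\<^sub>R b"]
      by (simp add: y_def)
    also have "\<bar>x powr (p - 2) - y powr (p - 2)\<bar> * y = x powr (p - 2) * y - y powr (p - 2) * y"
      using xy p powr_mono2[of "p - 2" y x] by (simp add: left_diff_distrib)
    also have "\<dots> \<le> y powr (p - 2) * (x - y)"
      using le by (simp add: right_diff_distrib)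
    also have "\<dots> \<le> y powr (p - 2) * norm (a - b)"
      unfolding x_def y_def by (intro mult_left_mono norm_triangle_ineq2) auto
    finally show ?thesis by (simp add: x_def y_def algebra_simps)
  qed
  show ?thesis
  proof (cases "norm b \<le> norm a")
    case False
    then show ?thesis using *[of a b] by (simp add: norm_minus_commute add.commute)
  qed (rule *)
qed

lemma powr_le_one_plus:
  fixes x a :: real
  assumes "0 \<le> x" "0 \<le> a" "a \<le> 1"
  shows "x powr a \<le> 1 + x"
proof (cases "x \<le> 1")
  case True
  then have "x powr a \<le> 1" using assms by (intro powr_le1) auto
  then show ?thesis using assms by simp
next
  case False
  then have "x powr a \<le> x powr 1" using assms by (intro powr_mono) auto
  then show ?thesis using False by simp
qed

lemma powr_le_exp: "0 \<le> x \<Longrightarrow> 0 \<le> a \<Longrightarrow> a \<le> 1 \<Longrightarrow> x powr a \<le> exp (x::real)"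
  using powr_le_one_plus[of x a] exp_ge_add_one_self[of x] by linarith

text \<open>Trades the sublinear power for linear growth in the rescaled size
  \<open>s powr (1/4) * y\<close>, whose L^2 norm \<open>S_tilde\<close> controls, at the price of a
  weight in \<open>s\<close>. Linear growth can be integrated by Cauchy-Schwarz from L^2 norms
  alone.\<close>

lemma powr_le_rescaled:
  fixes s y \<theta> :: real
  assumes "0 < s" "0 \<le> y" "0 \<le> \<theta>" "\<theta> \<le> 1"
  shows "y powr \<theta> \<le> s powr (- \<theta> / 4) * (1 + s powr (1/4) * y)"
proof -
  have "s powr (\<theta> / 4) * y powr \<theta> = (s powr (1/4) * y) powr \<theta>"
    using assms by (simp add: powr_mult powr_powr)
  also have "\<dots> \<le> 1 + s powr (1/4) * y"
    using assms by (intro powr_le_one_plus) auto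
  finally have "s powr (- \<theta> / 4) * (s powr (\<theta> / 4) * y powr \<theta>) \<le> s powr (- \<theta> / 4) * (1 + s powr (1/4) * y)"
    by (intro mult_left_mono) auto
  moreover have "s powr (- \<theta> / 4) * (s powr (\<theta> / 4) * y powr \<theta>) = y powr \<theta>"
    using assms by (simp add: mult.assoc[symmetric] powr_add[symmetric])
  ultimately show ?thesis by (simp only:)
qed

lemma borel_measurable_fst_snd:
  fixes G :: "'a \<Rightarrow> real \<times> real"
  assumes "G \<in> borel_measurable M"
  shows "(\<lambda>x. fst (G x)) \<in> borel_measurable M" "(\<lambda>x. snd (G x)) \<in> borel_measurable M"
  by (auto intro!: measurable_compose[OF assms] borel_measurable_continuous_onI continuous_intros)

lemma plap_measurable:
  fixes G :: "'a \<Rightarrow> real \<times> real"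
  assumes [measurable]: "G \<in> borel_measurable M"
  shows "(\<lambda>x. plap p (G x)) \<in> borel_measurable M"
  unfolding plap_def by measurable

lemma L2vec_iff: "L2vec G \<longleftrightarrow> L2fun (\<lambda>x. fst (G x)) \<and> L2fun (\<lambda>x. snd (G x))"
proof
  assume G: "L2vec G"
  then have [measurable]: "G \<in> borel_measurable TM" and int: "integrable TM (\<lambda>x. (norm (G x))\<^sup>2)"
    by (auto simp: L2vec_def)
  note [measurable] = borel_measurable_fst_snd[OF \<open>G \<in> borel_measurable TM\<close>]
  have "integrable TM (\<lambda>x. (fst (G x))\<^sup>2)" "integrable TM (\<lambda>x. (snd (G x))\<^sup>2)"
    by (rule Bochner_Integration.integrable_bound[OF int]; force simp: norm_prod_def)+
  then show "L2fun (\<lambda>x. fst (G x)) \<and> L2fun (\<lambda>x. snd (G x))" by (simp add: L2fun_def)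
next
  assume G: "L2fun (\<lambda>x. fst (G x)) \<and> L2fun (\<lambda>x. snd (G x))"
  then have "(\<lambda>x. (fst (G x), snd (G x))) \<in> borel_measurable TM"
    by (intro borel_measurable_Pair) (auto simp: L2fun_def)
  moreover have "integrable TM (\<lambda>x. (fst (G x))\<^sup>2 + (snd (G x))\<^sup>2)"
    using G by (auto simp: L2fun_def)
  ultimately show "L2vec G" by (simp add: L2vec_def norm_prod_def)
qed

lemma L2normv_nonneg [simp]: "L2normv G \<ge> 0"
  by (simp add: L2normv_def)

lemma L2normv_square:
  assumes "L2vec G"
  shows "(L2normv G)\<^sup>2 = (L2norm (\<lambda>x. fst (G x)))\<^sup>2 + (L2norm (\<lambda>x. snd (G x)))\<^sup>2"
  using assms by (simp add: L2vec_iff L2normv_def L2norm_square norm_prod_def L2fun_def)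

lemma L2vec_diff: "L2vec G \<Longrightarrow> L2vec H \<Longrightarrow> L2vec (\<lambda>x. G x - H x)"
  by (simp add: L2vec_iff L2fun_diff)

lemma L2vec_0 [simp]: "L2vec (\<lambda>x. 0)"
  by (simp add: L2vec_def)

lemma L2normv_0 [simp]: "L2normv (\<lambda>x. 0) = 0"
  by (simp add: L2normv_def)

lemma L2vec_norm: "L2vec G \<Longrightarrow> L2fun (\<lambda>x. norm (G x))"
  by (auto simp: L2vec_def L2fun_def)

lemma L2normv_eq_L2norm: "L2normv G = L2norm (\<lambda>x. norm (G x))"
  by (simp add: L2normv_def L2norm_def)

lemma L2vec_integrable: "L2vec G \<Longrightarrow> integrable TM G"
  using L2fun_integrable[OF L2vec_norm[of G]] by (simp add: L2vec_def integrable_norm_iff)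

text \<open>The pointwise Lipschitz bound together with \<open>powr_le_rescaled\<close> gives the
  majorant \<open>b\<close>, integrated by Cauchy-Schwarz on a space of measure 1. In
  \<open>2 + 2 * \<Lambda>\<close>, \<open>G\<close> and \<open>H\<close> each contribute
  \<open>1 + \<Lambda>\<close>.\<close>

lemma plap_diff_L1:
  assumes p: "2 < p" "p < 3" and G: "L2vec G" and H: "L2vec H" and s: "0 < s"
    and GL: "s powr (1/4) * L2normv G \<le> \<Lambda>" and HL: "s powr (1/4) * L2normv H \<le> \<Lambda>"
  shows "integrable TM (\<lambda>x. plap p (G x) - plap p (H x))"
    and "(\<integral>x. norm (plap p (G x) - plap p (H x)) \<partial>TM) \<le> s powr (- (p - 2) / 4) * (2 + 2 * \<Lambda>) * L2normv (\<lambda>x. G x - H x)"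
proof -
  define w where "w x = norm (G x - H x)" for x
  define b where "b x = s powr (- (p - 2) / 4) * (2 * w x + s powr (1/4) * (norm (G x) * w x) + s powr (1/4) * (norm (H x) * w x))" for x
  have wL2: "L2fun w" unfolding w_def by (intro L2vec_norm L2vec_diff G H)
  have prod_int: "integrable TM (\<lambda>x. norm (K x) * w x)"
    and prod_le: "(\<integral>x. norm (K x) * w x \<partial>TM) \<le> L2normv K * L2norm w" if "L2vec K" for K
  proof -
    show "integrable TM (\<lambda>x. norm (K x) * w x)"
      using L2vec_norm[OF that] wL2 by (intro integrable_mult_square_integrable) (auto simp: L2fun_def)
    have "(\<integral>x. \<bar>norm (K x) * w x\<bar> \<partial>TM) \<le> sqrt (\<integral>x. (norm (K x))\<^sup>2 \<partial>TM) * sqrt (\<integral>x. (w x)\<^sup>2 \<partial>TM)"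
      using L2vec_norm[OF that] wL2 by (intro Cauchy_Schwarz_integral_abs) (auto simp: L2fun_def)
    then show "(\<integral>x. norm (K x) * w x \<partial>TM) \<le> L2normv K * L2norm w"
      by (simp add: L2normv_def L2norm_def abs_mult w_def)
  qed
  have w_int: "integrable TM w" by (rule L2fun_integrable[OF wL2])
  have b_int: "integrable TM b"
    unfolding b_def using w_int prod_int[OF G] prod_int[OF H] by simp
  have le_b: "norm (plap p (G x) - plap p (H x)) \<le> b x" for x
  proof -
    have "norm (plap p (G x) - plap p (H x)) \<le> (norm (G x) powr (p - 2) + norm (H x) powr (p - 2)) * w x"
      unfolding w_def by (rule norm_plap_diff_le[OF p])
    also have "\<dots> \<le> (s powr (- (p - 2) / 4) * (1 + s powr (1/4) * norm (G x)) + s powr (- (p - 2) / 4) * (1 + s powr (1/4) * norm (H x))) * w x"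
      using p s by (intro mult_right_mono add_mono powr_le_rescaled) (auto simp: w_def)
    also have "\<dots> = b x" by (simp add: b_def algebra_simps)
    finally show ?thesis .
  qed
  have meas: "(\<lambda>x. plap p (G x) - plap p (H x)) \<in> borel_measurable TM"
    using G H by (intro borel_measurable_diff plap_measurable) (auto simp: L2vec_def)
  show int: "integrable TM (\<lambda>x. plap p (G x) - plap p (H x))"
    by (rule Bochner_Integration.integrable_bound[OF b_int meas]) (use le_b in \<open>force intro: order_trans[OF _ abs_ge_self]\<close>)
  have "(\<integral>x. norm (plap p (G x) - plap p (H x)) \<partial>TM) \<le> (\<integral>x. b x \<partial>TM)"
    using int b_int le_b by (intro integral_mono) auto
  also have "\<dots> = s powr (- (p - 2) / 4) * (2 * (\<integral>x. w x \<partial>TM) + s powr (1/4) * (\<integral>x. norm (G x) * w x \<partial>TM) + s powr (1/4) * (\<integral>x. norm (H x) * w x \<partial>TM))"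
    unfolding b_def using w_int prod_int[OF G] prod_int[OF H] by simp
  also have "\<dots> \<le> s powr (- (p - 2) / 4) * (2 * L2norm w + s powr (1/4) * (L2normv G * L2norm w) + s powr (1/4) * (L2normv H * L2norm w))"
  proof -
    have "(\<integral>x. w x \<partial>TM) \<le> L2norm w"
      using integral_abs_le_L2norm[OF wL2] by (simp add: w_def)
    then show ?thesis
      using prod_le[OF G] prod_le[OF H] by (intro mult_left_mono add_mono) auto
  qed
  also have "\<dots> = s powr (- (p - 2) / 4) * (2 + s powr (1/4) * L2normv G + s powr (1/4) * L2normv H) * L2norm w"
    by (simp add: algebra_simps)
  also have "\<dots> \<le> s powr (- (p - 2) / 4) * (2 + 2 * \<Lambda>) * L2norm w"
    using GL HL by (intro mult_right_mono mult_left_mono) auto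
  finally show "(\<integral>x. norm (plap p (G x) - plap p (H x)) \<partial>TM) \<le> s powr (- (p - 2) / 4) * (2 + 2 * \<Lambda>) * L2normv (\<lambda>x. G x - H x)"
    by (simp add: L2normv_eq_L2norm w_def[abs_def])
qed

lemma plap_L1:
  assumes p: "2 < p" "p < 3" and G: "L2vec G"
  shows "integrable TM (\<lambda>x. plap p (G x))"
  using plap_diff_L1(1)[OF p G L2vec_0, of 1 "L2normv G"] by simp

section \<open>Fourier coefficients of the divergence of the flux\<close>

definition ksq :: "int \<times> int \<Rightarrow> real" where
  "ksq k = (of_int (fst k))\<^sup>2 + (of_int (snd k))\<^sup>2"

lemma knorm4_ksq: "knorm4 k = (ksq k)\<^sup>2"
  by (simp add: knorm4_def ksq_def)

lemma knorm4_nonneg [simp]: "knorm4 k \<ge> 0"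
  by (simp add: knorm4_ksq)

lemma ksq_nonneg [simp]: "ksq k \<ge> 0"
  by (simp add: ksq_def)

lemma ksq_0_iff [simp]: "ksq k = 0 \<longleftrightarrow> k = 0"
  by (simp add: ksq_def prod_eq_iff sum_power2_eq_zero_iff)

lemma ksq_zero [simp]: "ksq 0 = 0"
  by simp

lemma ksq_pos: "k \<noteq> 0 \<Longrightarrow> ksq k > 0"
  using ksq_nonneg[of k] ksq_0_iff[of k] by linarith

definition divcoef :: "real \<Rightarrow> (real \<times> real \<Rightarrow> real \<times> real) \<Rightarrow> int \<times> int \<Rightarrow> complex" where
  "divcoef p G k = 2 * pi * \<i> * of_int (fst k) * fcoef (\<lambda>x. fst (plap p (G x))) k +
      2 * pi * \<i> * of_int (snd k) * fcoef (\<lambda>x. snd (plap p (G x))) k"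

lemma duh_coef_eq: "duh_coef p u t s k = complex_of_real (exp (- (t - s) * knorm4 k)) * divcoef p (wgrad (u s)) k"
  by (simp add: duh_coef_def divcoef_def nonlin_def plap_def)

lemma divcoef_0 [simp]: "divcoef p G 0 = 0"
  by (simp add: divcoef_def)

lemma divcoef_zero_fun [simp]: "divcoef p (\<lambda>x. 0) k = 0"
  by (simp add: divcoef_def fcoef_def)

lemma divcoef_minus: "divcoef p G (- k) = cnj (divcoef p G k)"
  by (simp add: divcoef_def fcoef_minus)

lemma fcoef_cong_AE:
  assumes "f \<in> borel_measurable TM" "g \<in> borel_measurable TM" "AE x in TM. f x = g x"
  shows "fcoef f k = fcoef g k"
  unfolding fcoef_ek
proof (rule integral_cong_AE)
  show "AE x in TM. complex_of_real (f x) * ek (- k) x = complex_of_real (g x) * ek (- k) x"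
    using assms(3) by eventually_elim simp
qed (use assms(1,2) in measurable)

text \<open>Since \<open>wgrad\<close> is a chosen representative, what enters the Duhamel formula
  has to be insensitive to null sets.\<close>

lemma divcoef_cong_AE:
  assumes "G \<in> borel_measurable TM" "H \<in> borel_measurable TM" "AE x in TM. G x = H x"
  shows "divcoef p G k = divcoef p H k"
proof -
  have "fcoef (\<lambda>x. fst (plap p (G x))) k = fcoef (\<lambda>x. fst (plap p (H x))) k"
    by (intro fcoef_cong_AE borel_measurable_fst_snd plap_measurable assms(1,2)) (use assms(3) in eventually_elim, simp)
  moreover have "fcoef (\<lambda>x. snd (plap p (G x))) k = fcoef (\<lambda>x. snd (plap p (H x))) k"
    by (intro fcoef_cong_AE borel_measurable_fst_snd plap_measurable assms(1,2)) (use assms(3) in eventually_elim, simp)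
  ultimately show ?thesis by (simp add: divcoef_def)
qed

text \<open>A coefficient of the flux is bounded by the L^1 norm, and the divergence contributes the
  sum of the moduli of the two frequencies, at most \<open>2 * sqrt (ksq k)\<close>. The parameter
  \<open>s\<close> need not be a time: any positive number for which the two bounds hold is
  admissible.\<close>

lemma norm_divcoef_diff_le:
  assumes p: "2 < p" "p < 3" and G: "L2vec G" and H: "L2vec H" and s: "0 < s"
    and GL: "s powr (1/4) * L2normv G \<le> \<Lambda>" and HL: "s powr (1/4) * L2normv H \<le> \<Lambda>"
  shows "cmod (divcoef p G k - divcoef p H k) \<le>
    4 * pi * sqrt (ksq k) * (s powr (- (p - 2) / 4) * (2 + 2 * \<Lambda>) * L2normv (\<lambda>x. G x - H x))"
proof -
  define D where "D x = plap p (G x) - plap p (H x)" for x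
  define I where "I = (\<integral>x. norm (D x) \<partial>TM)"
  have D: "integrable TM D" unfolding D_def by (rule plap_diff_L1(1)[OF assms])
  have comp: "cmod (fcoef (\<lambda>x. fst (D x)) k) \<le> I" "cmod (fcoef (\<lambda>x. snd (D x)) k) \<le> I"
  proof -
    have le: "\<bar>fst a\<bar> \<le> norm a" "\<bar>snd a\<bar> \<le> norm a" for a :: "real \<times> real"
      by (auto simp: norm_prod_def)
    show "cmod (fcoef (\<lambda>x. fst (D x)) k) \<le> I" "cmod (fcoef (\<lambda>x. snd (D x)) k) \<le> I"
      unfolding I_def using D
      by (auto intro!: order_trans[OF norm_fcoef_le] integral_mono le)
  qed
  have eq: "divcoef p G k - divcoef p H k = 2 * pi * \<i> * of_int (fst k) * fcoef (\<lambda>x. fst (D x)) k +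
      2 * pi * \<i> * of_int (snd k) * fcoef (\<lambda>x. snd (D x)) k"
    using plap_L1[OF p G] plap_L1[OF p H]
    by (simp add: divcoef_def D_def fcoef_diff algebra_simps)
  have "cmod (divcoef p G k - divcoef p H k) \<le> 2 * pi * \<bar>of_int (fst k)\<bar> * I + 2 * pi * \<bar>of_int (snd k)\<bar> * I"
    unfolding eq using comp
    by (intro order_trans[OF norm_triangle_ineq] add_mono) (auto simp: norm_mult intro!: mult_left_mono)
  also have "\<dots> = 2 * pi * (\<bar>of_int (fst k)\<bar> + \<bar>of_int (snd k)\<bar>) * I"
    by (simp add: algebra_simps)
  also have "\<dots> \<le> 2 * pi * (2 * sqrt (ksq k)) * I"
  proof -
    have "\<bar>of_int (fst k)\<bar> \<le> sqrt (ksq k)" "\<bar>of_int (snd k)\<bar> \<le> sqrt (ksq k)"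
      by (auto simp: ksq_def intro!: real_le_rsqrt)
    then show ?thesis by (intro mult_right_mono mult_left_mono) (auto simp: I_def)
  qed
  also have "\<dots> = 4 * pi * sqrt (ksq k) * I" by simp
  also have "\<dots> \<le> 4 * pi * sqrt (ksq k) * (s powr (- (p - 2) / 4) * (2 + 2 * \<Lambda>) * L2normv (\<lambda>x. G x - H x))"
    unfolding I_def D_def by (intro mult_left_mono plap_diff_L1(2)[OF assms]) auto
  finally show ?thesis .
qed

text \<open>The case \<open>H = 0\<close>, where the bound on \<open>L2normv G\<close> turns the
  exponent -(p-2)/4 into -(p-1)/4.\<close>

lemma norm_divcoef_le:
  assumes p: "2 < p" "p < 3" and G: "L2vec G" and s: "0 < s"
    and GL: "s powr (1/4) * L2normv G \<le> \<Lambda>"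
  shows "cmod (divcoef p G k) \<le> 4 * pi * sqrt (ksq k) * ((2 + 2 * \<Lambda>) * \<Lambda> * s powr (- (p - 1) / 4))"
proof -
  have L0: "0 \<le> \<Lambda>" using GL by (rule order_trans[rotated]) simp
  have "L2normv G \<le> \<Lambda> * s powr (- (1/4))"
    using GL s by (simp add: powr_minus field_simps)
  then have "s powr (- (p - 2) / 4) * (2 + 2 * \<Lambda>) * L2normv G \<le> s powr (- (p - 2) / 4) * (2 + 2 * \<Lambda>) * (\<Lambda> * s powr (- (1/4)))"
    using L0 by (intro mult_left_mono) auto
  also have "\<dots> = (2 + 2 * \<Lambda>) * \<Lambda> * (s powr (- (p - 2) / 4) * s powr (- (1/4)))"
    by (simp add: mult_ac)
  also have "s powr (- (p - 2) / 4) * s powr (- (1/4)) = s powr (- (p - 1) / 4)"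
    unfolding powr_add[symmetric] by (rule arg_cong[where f = "(powr) s"]) (simp add: field_simps)
  finally have "4 * pi * sqrt (ksq k) * (s powr (- (p - 2) / 4) * (2 + 2 * \<Lambda>) * L2normv G) \<le> 4 * pi * sqrt (ksq k) * ((2 + 2 * \<Lambda>) * \<Lambda> * s powr (- (p - 1) / 4))"
    by (intro mult_left_mono) auto
  moreover have "cmod (divcoef p G k) \<le> 4 * pi * sqrt (ksq k) * (s powr (- (p - 2) / 4) * (2 + 2 * \<Lambda>) * L2normv G)"
    using norm_divcoef_diff_le[OF p G L2vec_0 s GL] L0 by simp
  ultimately show ?thesis by linarith
qed

subsection \<open>Weak gradients and heat kernel weights\<close>

lemma wgrad_AE_eq:
  assumes "is_wgrad f G" "is_wgrad f H"
  shows "AE x in TM. G x = H x"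
proof -
  have "AE x in TM. fst (G x) = fst (H x)" "AE x in TM. snd (G x) = snd (H x)"
    using assms by (auto intro!: fcoef_eq_imp_AE_eq simp: is_wgrad_def)
  then show ?thesis
    by eventually_elim (simp add: prod_eq_iff)
qed

lemma is_wgrad_wgrad: "has_wgrad f \<Longrightarrow> is_wgrad f (wgrad f)"
  unfolding has_wgrad_def wgrad_def by (simp only: some_eq_ex)

lemma L2normv_square_sum:
  assumes G: "L2vec G"
  shows "(\<lambda>k. (cmod (fcoef (\<lambda>x. fst (G x)) k))\<^sup>2 + (cmod (fcoef (\<lambda>x. snd (G x)) k))\<^sup>2) summable_on UNIV"
    "(L2normv G)\<^sup>2 = (\<Sum>\<^sub>\<infinity>k. (cmod (fcoef (\<lambda>x. fst (G x)) k))\<^sup>2 + (cmod (fcoef (\<lambda>x. snd (G x)) k))\<^sup>2)"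
  using G unfolding L2normv_square[OF G] L2vec_iff
  by (auto intro!: summable_on_add Bessel simp: Parseval infsum_add Bessel)

lemma wgrad_diff_Parseval:
  assumes "is_wgrad f G" "is_wgrad g H" "L2vec G" "L2vec H"
  shows "(\<lambda>k. 4 * pi\<^sup>2 * ksq k * (cmod (fcoef f k - fcoef g k))\<^sup>2) summable_on UNIV"
    and "(L2normv (\<lambda>x. G x - H x))\<^sup>2 = (\<Sum>\<^sub>\<infinity>k. 4 * pi\<^sup>2 * ksq k * (cmod (fcoef f k - fcoef g k))\<^sup>2)"
proof -
  have int: "integrable TM G" "integrable TM H" using assms by (auto simp: is_wgrad_def)
  have "(cmod (fcoef (\<lambda>x. fst (G x - H x)) k))\<^sup>2 + (cmod (fcoef (\<lambda>x. snd (G x - H x)) k))\<^sup>2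
     = 4 * pi\<^sup>2 * ksq k * (cmod (fcoef f k - fcoef g k))\<^sup>2" for k
  proof -
    have e: "fcoef (\<lambda>x. fst (G x - H x)) k = 2 * pi * \<i> * of_int (fst k) * (fcoef f k - fcoef g k)"
      "fcoef (\<lambda>x. snd (G x - H x)) k = 2 * pi * \<i> * of_int (snd k) * (fcoef f k - fcoef g k)"
      using assms(1,2) int by (auto simp: fcoef_diff is_wgrad_def right_diff_distrib simp del: split_paired_All)
    show ?thesis
      unfolding e norm_mult power_mult_distrib ksq_def by (simp add: algebra_simps)
  qed
  then show "(\<lambda>k. 4 * pi\<^sup>2 * ksq k * (cmod (fcoef f k - fcoef g k))\<^sup>2) summable_on UNIV"
    and "(L2normv (\<lambda>x. G x - H x))\<^sup>2 = (\<Sum>\<^sub>\<infinity>k. 4 * pi\<^sup>2 * ksq k * (cmod (fcoef f k - fcoef g k))\<^sup>2)"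
    using L2normv_square_sum[OF L2vec_diff[OF assms(3,4)]] by simp_all
qed

text \<open>The weight \<open>|k|\<^bsup>-1-2\<delta>\<^esup>\<close>; it vanishes at \<open>k = 0\<close> because \<open>0 powr a = 0\<close>.\<close>

definition mode_weight :: "real \<Rightarrow> int \<times> int \<Rightarrow> real" where
  "mode_weight \<delta> k = ksq k powr (- (1 + 2 * \<delta>) / 2)"

lemma mode_weight_nonneg [simp]: "mode_weight \<delta> k \<ge> 0"
  by (simp add: mode_weight_def)

lemma mode_weight_0 [simp]: "mode_weight \<delta> 0 = 0"
  by (simp add: mode_weight_def)

lemma mode_weight_pos: "k \<noteq> 0 \<Longrightarrow> mode_weight \<delta> k > 0"
  by (simp add: mode_weight_def)

text \<open>The maximum with 1 gives \<open>m = 0\<close> the value 1 instead of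
  \<open>0 powr (- r) = 0\<close>, as a majorant on the coordinate axes of the lattice
  requires.\<close>

lemma summable_on_int_powr:
  assumes "r > (1::real)"
  shows "(\<lambda>m::int. max 1 \<bar>of_int m\<bar> powr (- r)) summable_on UNIV"
proof -
  have "summable (\<lambda>n. real n powr (- r))"
    using assms by (simp add: summable_real_powr_iff)
  then have "(\<lambda>n. real n powr (- r)) summable_on UNIV"
    by (subst summable_on_UNIV_nonneg_real_iff) auto
  then have nat: "(\<lambda>n. max 1 (real n) powr (- r)) summable_on UNIV"
  proof -
    assume *: "(\<lambda>n. real n powr (- r)) summable_on UNIV"
    then have "(\<lambda>n. real n powr (- r)) summable_on (UNIV - {0})"
      by (rule summable_on_subset_banach) auto
    then have "(\<lambda>n. max 1 (real n) powr (- r)) summable_on (UNIV - {0})"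
      by (rule summable_on_cong[THEN iffD1, rotated]) (auto simp: max_def)
    then have "(\<lambda>n. max 1 (real n) powr (- r)) summable_on insert 0 (UNIV - {0})"
      by (subst summable_on_insert_iff)
    then show ?thesis by (simp add: insert_absorb insert_Diff_if)
  qed
  have "(\<lambda>m::int. max 1 \<bar>of_int m\<bar> powr (- r)) summable_on range int"
    using nat by (subst summable_on_reindex) (auto simp: o_def)
  moreover have "(\<lambda>m::int. max 1 \<bar>of_int m\<bar> powr (- r)) summable_on range (\<lambda>n. - int n)"
    using nat by (subst summable_on_reindex) (auto simp: o_def inj_on_def)
  ultimately have "(\<lambda>m::int. max 1 \<bar>of_int m\<bar> powr (- r)) summable_on (range int \<union> range (\<lambda>n. - int n))"
    by (rule summable_on_union)
  moreover have "range int \<union> range (\<lambda>n. - int n) = UNIV"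
    by (auto simp: image_iff) (metis int_cases2)
  ultimately show ?thesis by simp
qed

text \<open>The squared weight is \<open>ksq k powr (- (1 + 2 * \<delta>))\<close>. Off the origin
  the product of the two truncated frequencies \<open>max 1 m\<close> and \<open>max 1 n\<close> is
  at most \<open>ksq k\<close>, so a product of two convergent one-dimensional sums
  dominates.\<close>

lemma mode_weight_square_summable:
  assumes "\<delta> > 0"
  shows "(\<lambda>k. (mode_weight \<delta> k)\<^sup>2) summable_on UNIV"
proof -
  define h :: "int \<Rightarrow> real" where "h m = max 1 \<bar>of_int m\<bar> powr (- (1 + 2 * \<delta>))" for m
  have h: "h summable_on UNIV" unfolding h_def using assms by (intro summable_on_int_powr) auto
  have "(\<lambda>(m, n). h m * h n) summable_on (UNIV \<times> UNIV)"
  proof (rule summable_on_SigmaI[where g = "\<lambda>m. h m * infsum h UNIV"])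
    show "((\<lambda>n. (case (m, n) of (m, n) \<Rightarrow> h m * h n)) has_sum h m * infsum h UNIV) UNIV" for m
      using h by (auto intro!: has_sum_cmult_right)
    show "(\<lambda>m. h m * infsum h UNIV) summable_on UNIV"
      using h by (intro summable_on_cmult_left) auto
  qed (auto simp: h_def)
  then have s: "(\<lambda>k. h (fst k) * h (snd k)) summable_on UNIV"
    by (simp add: case_prod_unfold)
  show ?thesis
  proof (rule summable_on_comparison_test[OF s])
    fix k :: "int \<times> int"
    show "(mode_weight \<delta> k)\<^sup>2 \<le> h (fst k) * h (snd k)"
    proof (cases "k = 0")
      case False
      define m n where "m = \<bar>real_of_int (fst k)\<bar>" and "n = \<bar>real_of_int (snd k)\<bar>"
      have ksq: "ksq k = m\<^sup>2 + n\<^sup>2" by (simp add: m_def n_def ksq_def)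
      have mn: "m = 0 \<or> m \<ge> 1" "n = 0 \<or> n \<ge> 1" "m \<noteq> 0 \<or> n \<noteq> 0"
        using False unfolding m_def n_def by (auto simp: prod_eq_iff)
      have sq: "x \<le> x\<^sup>2" if "x \<ge> 1" for x :: real
        using that by (simp add: power2_eq_square)
      have "max 1 m * max 1 n \<le> m\<^sup>2 + n\<^sup>2"
      proof (cases "m = 0 \<or> n = 0")
        case True
        then show ?thesis using mn sq[of m] sq[of n] by (auto simp: max_def)
      next
        case False
        then have "m \<ge> 1" "n \<ge> 1" using mn by auto
        then have "max 1 m * max 1 n = m * n" by simp
        moreover have "2 * (m * n) \<le> m\<^sup>2 + n\<^sup>2" using sum_squares_bound[of m n] by simp
        moreover have "0 \<le> m * n" by (simp add: m_def n_def)
        ultimately show ?thesis by linarith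
      qed
      then have "ksq k powr (- (1 + 2 * \<delta>)) \<le> (max 1 m * max 1 n) powr (- (1 + 2 * \<delta>))"
        unfolding ksq using assms by (intro powr_mono2') (auto simp: zero_less_mult_iff less_max_iff_disj)
      also have "\<dots> = h (fst k) * h (snd k)"
        by (simp add: powr_mult h_def m_def n_def)
      finally show ?thesis
        by (simp add: mode_weight_def power2_eq_square flip: powr_add)
    qed (simp add: h_def)
  qed auto
qed

text \<open>\<open>m\<close> stands for |k|^2 and \<open>j\<close> for the number of derivatives on
  the kernel. The bound \<open>x powr a \<le> exp x\<close> at \<open>x = \<tau> * m\<^sup>2\<close>
  is used with the exponent \<open>a\<close> for which the powers of \<open>m\<close> balance;
  \<open>a \<le> 1\<close> is the last hypothesis.\<close>

lemma heat_kernel_bound: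
  fixes m \<tau> j \<delta> :: real
  assumes "m \<ge> 0" "\<tau> > 0" "0 < \<delta>" "0 < j" "j + 1 + 2 * \<delta> \<le> 4"
  shows "m powr (j / 2) * exp (- \<tau> * m\<^sup>2) \<le> m powr (- (1 + 2 * \<delta>) / 2) * \<tau> powr (- (j + 1 + 2 * \<delta>) / 4)"
proof (cases "m = 0")
  case False
  then have m: "m > 0" using assms by simp
  define a where "a = (j + 1 + 2 * \<delta>) / 4"
  have "(\<tau> * m\<^sup>2) powr a \<le> exp (\<tau> * m\<^sup>2)"
    using assms by (intro powr_le_exp) (auto simp: a_def)
  also have "(\<tau> * m\<^sup>2) powr a = \<tau> powr a * m powr (2 * a)"
    using assms m by (simp add: powr_mult powr_powr flip: powr_numeral)
  finally have "\<tau> powr a * m powr (2 * a) * (exp (- \<tau> * m\<^sup>2) * (\<tau> powr (- a) * m powr (- (1 + 2 * \<delta>) / 2)))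
      \<le> exp (\<tau> * m\<^sup>2) * (exp (- \<tau> * m\<^sup>2) * (\<tau> powr (- a) * m powr (- (1 + 2 * \<delta>) / 2)))"
    by (intro mult_right_mono) auto
  moreover have "exp (\<tau> * m\<^sup>2) * (exp (- \<tau> * m\<^sup>2) * (\<tau> powr (- a) * m powr (- (1 + 2 * \<delta>) / 2))) = \<tau> powr (- a) * m powr (- (1 + 2 * \<delta>) / 2)"
    by (simp add: exp_minus)
  moreover have "\<tau> powr a * m powr (2 * a) * (exp (- \<tau> * m\<^sup>2) * (\<tau> powr (- a) * m powr (- (1 + 2 * \<delta>) / 2)))
     = (\<tau> powr a * \<tau> powr (- a)) * (m powr (2 * a) * m powr (- (1 + 2 * \<delta>) / 2)) * exp (- \<tau> * m\<^sup>2)"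
    by (simp only: mult_ac)
  moreover have "\<tau> powr a * \<tau> powr (- a) = 1"
    using assms by (simp flip: powr_add)
  moreover have "m powr (2 * a) * m powr (- (1 + 2 * \<delta>) / 2) = m powr (j / 2)"
    unfolding powr_add[symmetric] a_def by (rule arg_cong[where f = "\<lambda>z. m powr z"]) (simp add: field_simps)
  moreover have "\<tau> powr (- a) = \<tau> powr (- (j + 1 + 2 * \<delta>) / 4)"
    unfolding a_def minus_divide_left ..
  ultimately show ?thesis by (simp only: mult_1 mult.commute)
qed (use assms in auto)

text \<open>Two derivatives: the divergence, and the gradient whose norm is estimated.\<close>

lemma heat_kernel_grad:
  assumes "\<tau> > 0" "0 < \<delta>" "\<delta> \<le> 1/2"
  shows "ksq k * exp (- \<tau> * knorm4 k) \<le> mode_weight \<delta> k * \<tau> powr (- (3/4 + \<delta>/2))"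
proof -
  have "ksq k powr (2 / 2) * exp (- \<tau> * (ksq k)\<^sup>2) \<le> ksq k powr (- (1 + 2 * \<delta>) / 2) * \<tau> powr (- (2 + 1 + 2 * \<delta>) / 4)"
    using assms by (intro heat_kernel_bound) auto
  moreover have "- (2 + 1 + 2 * \<delta>) / 4 = - (3/4 + \<delta>/2)" by (simp add: field_simps)
  moreover have "ksq k powr (2 / 2) = ksq k" by simp
  ultimately show ?thesis unfolding mode_weight_def knorm4_ksq by (simp only:)
qed

text \<open>One derivative: the divergence alone, for L^2 norms of the Duhamel integrand.\<close>

lemma heat_kernel_div:
  assumes "\<tau> > 0" "0 < \<delta>" "\<delta> \<le> 1/2"
  shows "sqrt (ksq k) * exp (- \<tau> * knorm4 k) \<le> mode_weight \<delta> k * \<tau> powr (- (1/2 + \<delta>/2))"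
proof -
  have "ksq k powr (1 / 2) * exp (- \<tau> * (ksq k)\<^sup>2) \<le> ksq k powr (- (1 + 2 * \<delta>) / 2) * \<tau> powr (- (1 + 1 + 2 * \<delta>) / 4)"
    using assms by (intro heat_kernel_bound) auto
  moreover have "- (1 + 1 + 2 * \<delta>) / 4 = - (1/2 + \<delta>/2)" by (simp add: field_simps)
  moreover have "ksq k powr (1 / 2) = sqrt (ksq k)" by (simp add: powr_half_sqrt)
  ultimately show ?thesis unfolding mode_weight_def knorm4_ksq by (simp only:)
qed

text \<open>For the linear flow no mode weight is wanted, because the coefficients of
  \<open>u0\<close> are square summable themselves.\<close>

lemma heat_kernel_grad_L2:
  assumes "\<tau> > 0"
  shows "\<tau> powr (1/4) * sqrt (ksq k) * exp (- \<tau> * knorm4 k) \<le> 1"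
proof -
  have "\<tau> powr (1/4) * sqrt (ksq k) = (\<tau> * knorm4 k) powr (1/4)"
    using assms by (simp add: powr_mult knorm4_ksq powr_powr powr_half_sqrt[symmetric] flip: powr_numeral)
  also have "\<dots> \<le> exp (\<tau> * knorm4 k)"
    using assms by (intro powr_le_exp) auto
  finally have "\<tau> powr (1/4) * sqrt (ksq k) * exp (- \<tau> * knorm4 k) \<le> exp (\<tau> * knorm4 k) * exp (- \<tau> * knorm4 k)"
    by (rule mult_right_mono) simp
  then show ?thesis by (simp add: exp_minus)
qed

section \<open>Time integrals with singularities at both ends\<close>

lemma has_integral_beta_kernel:
  fixes a b t :: real
  assumes "a < 1" "b < 1" "t > 0"
  shows "((\<lambda>s. (t - s) powr (- a) * s powr (- b)) has_integral Beta (1 - b) (1 - a) * t powr (1 - a - b)) {0..t}"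
proof -
  have "((\<lambda>x. x powr ((1 - b) - 1) * (1 - x) powr ((1 - a) - 1)) has_integral Beta (1 - b) (1 - a)) {0..1}"
    using assms by (intro has_integral_Beta_real) auto
  from has_integral_stretch_real[OF this, of "1 / t"]
  have "((\<lambda>s. (s / t) powr (- b) * (1 - s / t) powr (- a)) has_integral t * Beta (1 - b) (1 - a)) ((\<lambda>x. x * t) ` {0..1})"
    using assms by simp
  also have "(\<lambda>x. x * t) ` {0..1} = {0..t}"
    using assms by (simp add: image_mult_atLeastAtMost_if mult.commute[of _ t])
  finally have "((\<lambda>s. t powr (- a - b) * ((s / t) powr (- b) * (1 - s / t) powr (- a))) has_integral t powr (- a - b) * (t * Beta (1 - b) (1 - a))) {0..t}"
    by (rule has_integral_mult_right)
  moreover have "t powr (- a - b) * (t * Beta (1 - b) (1 - a)) = Beta (1 - b) (1 - a) * t powr (1 - a - b)"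
    using assms powr_mult_base[of t "- a - b"] by (simp add: algebra_simps)
  moreover have "t powr (- a - b) * ((s / t) powr (- b) * (1 - s / t) powr (- a)) = (t - s) powr (- a) * s powr (- b)"
    if "s \<in> {0..t}" for s
  proof -
    have "(1 - s / t) = (t - s) / t" using assms by (simp add: field_simps)
    then have "t powr (- a - b) * ((s / t) powr (- b) * (1 - s / t) powr (- a)) = t powr (- a - b) * (s powr (- b) / t powr (- b) * ((t - s) powr (- a) / t powr (- a)))"
      using that assms by (simp add: powr_divide)
    also have "\<dots> = (t powr (- a) * t powr (- b)) * (s powr (- b) / t powr (- b) * ((t - s) powr (- a) / t powr (- a)))"
      by (simp flip: powr_add)
    also have "\<dots> = (t - s) powr (- a) * s powr (- b)" using assms by simp
    finally show ?thesis .
  qed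
  ultimately show ?thesis
    by (metis (no_types, lifting) has_integral_cong)
qed

subsection \<open>Uniqueness\<close>

lemma AE_lebesgue_on_Icc_not_in:
  assumes "finite X"
  shows "AE s in lebesgue_on {a..b::real}. s \<notin> X"
proof -
  have "X \<in> null_sets lebesgue"
    using assms negligible_finite negligible_iff_null_sets by blast
  from AE_not_in[OF this] show ?thesis
    by (subst AE_restrict_space_iff) auto
qed

lemma AE_lebesgue_on_singleton: "AE s in lebesgue_on {0..0::real}. P s"
  using AE_lebesgue_on_Icc_not_in[of "{0}" 0 0] AE_space[of "lebesgue_on {0..0::real}"]
  by (auto elim: eventually_elim2)

lemma beta_kernel_integrable:
  fixes a b t :: real
  assumes "a < 1" "b < 1" "t > 0"
  shows "integrable (lebesgue_on {0..t}) (\<lambda>s. (t - s) powr (- a) * s powr (- b))"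
    "(\<integral>s. (t - s) powr (- a) * s powr (- b) \<partial>lebesgue_on {0..t}) = Beta (1 - b) (1 - a) * t powr (1 - a - b)"
proof -
  note hi = has_integral_beta_kernel[OF assms]
  have "(\<lambda>s. (t - s) powr (- a) * s powr (- b)) absolutely_integrable_on {0..t}"
    using hi by (intro nonnegative_absolutely_integrable_1) auto
  then show int: "integrable (lebesgue_on {0..t}) (\<lambda>s. (t - s) powr (- a) * s powr (- b))"
    by (simp add: integrable_restrict_space set_integrable_def)
  have "(\<integral>s. (t - s) powr (- a) * s powr (- b) \<partial>lebesgue_on {0..t}) = integral {0..t} (\<lambda>s. (t - s) powr (- a) * s powr (- b))"
    by (rule lebesgue_integral_eq_integral[OF int]) auto
  then show "(\<integral>s. (t - s) powr (- a) * s powr (- b) \<partial>lebesgue_on {0..t}) = Beta (1 - b) (1 - a) * t powr (1 - a - b)"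
    using hi by (simp add: integral_unique)
qed

text \<open>The bound is demanded only inside the interval: at both ends the kernel is 0 by the
  convention \<open>0 powr x = 0\<close>, and two points form a null set.\<close>

lemma beta_kernel_dominated:
  fixes f :: "real \<Rightarrow> 'a::euclidean_space"
  assumes ab: "a < 1" "b < 1" and t: "t > 0" and f: "f \<in> borel_measurable (lebesgue_on {0..t})"
    and le: "\<And>s. 0 < s \<Longrightarrow> s < t \<Longrightarrow> norm (f s) \<le> C * ((t - s) powr (- a) * s powr (- b))"
  shows "integrable (lebesgue_on {0..t}) f"
    and "norm (\<integral>s. f s \<partial>lebesgue_on {0..t}) \<le> C * (Beta (1 - b) (1 - a) * t powr (1 - a - b))"
proof -
  let ?M = "lebesgue_on {0..t}"
  let ?g = "\<lambda>s. C * ((t - s) powr (- a) * s powr (- b))"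
  have g: "integrable ?M ?g" using beta_kernel_integrable(1)[OF ab t] by simp
  have AE: "AE s in ?M. norm (f s) \<le> ?g s"
    using AE_lebesgue_on_Icc_not_in[of "{0, t}" 0 t] AE_space[of ?M]
  proof (rule eventually_elim2)
    show "\<lbrakk>s \<notin> {0, t}; s \<in> space ?M\<rbrakk> \<Longrightarrow> norm (f s) \<le> ?g s" for s
      using le[of s] by auto
  qed simp
  show int: "integrable ?M f"
    by (rule Bochner_Integration.integrable_bound[OF g f])
       (use AE in \<open>auto elim!: eventually_mono intro: order_trans[OF _ abs_ge_self]\<close>)
  have "norm (\<integral>s. f s \<partial>?M) \<le> (\<integral>s. norm (f s) \<partial>?M)" by (rule integral_norm_bound)
  also have "\<dots> \<le> (\<integral>s. ?g s \<partial>?M)"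
    using int g AE by (intro integral_mono_AE) auto
  also have "\<dots> = C * (Beta (1 - b) (1 - a) * t powr (1 - a - b))"
    using beta_kernel_integrable(2)[OF ab t] by simp
  finally show "norm (\<integral>s. f s \<partial>?M) \<le> C * (Beta (1 - b) (1 - a) * t powr (1 - a - b))" .
qed

lemma exp_neg_le_powr:
  fixes x a :: real
  assumes "x > 0" "0 \<le> a" "a \<le> 1"
  shows "exp (- x) \<le> x powr (- a)"
  using powr_le_exp[of x a] assms by (simp add: exp_minus powr_minus le_imp_inverse_le)

lemma Beta_real_nonneg: "0 < a \<Longrightarrow> 0 < b \<Longrightarrow> Beta a b \<ge> (0::real)"
  by (simp add: Beta_def Gamma_real_pos less_imp_le)

text \<open>The two Duhamel integrals combine into one once each integrand is integrable, which the
  gradient bounds supply mode by mode.\<close>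

lemma mild_solution_coef_diff:
  assumes p: "2 < p" "p < 3"
    and u: "mild_solution p T u0 u" and v: "mild_solution p T u0 v"
    and u2: "\<And>s. s \<in> {0<..T} \<Longrightarrow> L2vec (wgrad (u s))" and v2: "\<And>s. s \<in> {0<..T} \<Longrightarrow> L2vec (wgrad (v s))"
    and uL: "\<And>s. s \<in> {0<..T} \<Longrightarrow> s powr (1/4) * L2normv (wgrad (u s)) \<le> \<Lambda>"
    and vL: "\<And>s. s \<in> {0<..T} \<Longrightarrow> s powr (1/4) * L2normv (wgrad (v s)) \<le> \<Lambda>"
    and t: "t \<in> {0<..T}"
  shows "(\<lambda>s. duh_coef p v t s k - duh_coef p u t s k) \<in> borel_measurable (lebesgue_on {0..t})"
    and "fcoef (u t) k - fcoef (v t) k = (\<integral>s. duh_coef p v t s k - duh_coef p u t s k \<partial>lebesgue_on {0..t})"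
proof -
  have mu: "(\<lambda>s. duh_coef p u t s k) \<in> borel_measurable (lebesgue_on {0..t})"
    and mv: "(\<lambda>s. duh_coef p v t s k) \<in> borel_measurable (lebesgue_on {0..t})"
    using u v t by (auto simp: mild_solution_def duhamel_bochner_def simp del: split_paired_All)
  then show "(\<lambda>s. duh_coef p v t s k - duh_coef p u t s k) \<in> borel_measurable (lebesgue_on {0..t})"
    by (rule borel_measurable_diff[rotated])
  have int: "integrable (lebesgue_on {0..t}) (\<lambda>s. duh_coef p w t s k)"
    if m: "(\<lambda>s. duh_coef p w t s k) \<in> borel_measurable (lebesgue_on {0..t})"
      and w2: "\<And>s. s \<in> {0<..T} \<Longrightarrow> L2vec (wgrad (w s))"
      and wL: "\<And>s. s \<in> {0<..T} \<Longrightarrow> s powr (1/4) * L2normv (wgrad (w s)) \<le> \<Lambda>" for w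
  \<comment> \<open>For a single fixed \<open>k\<close> the semigroup factor is simply bounded by 1,
    hence \<open>a = 0\<close>; only the singularity at \<open>s = 0\<close> remains.\<close>
  proof (rule beta_kernel_dominated(1)[of 0 "(p - 1) / 4", OF _ _ _ m])
    show "cmod (duh_coef p w t s k) \<le> 4 * pi * sqrt (ksq k) * ((2 + 2 * \<Lambda>) * \<Lambda>) * ((t - s) powr (- 0) * s powr (- ((p - 1) / 4)))"
      if s: "0 < s" "s < t" for s
    proof -
      have sT: "s \<in> {0<..T}" using s t by auto
      have "cmod (duh_coef p w t s k) = exp (- (t - s) * knorm4 k) * cmod (divcoef p (wgrad (w s)) k)"
        unfolding duh_coef_eq by (simp add: norm_mult)
      also have "\<dots> \<le> 1 * cmod (divcoef p (wgrad (w s)) k)"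
        using s by (intro mult_right_mono) (auto simp: mult_nonpos_nonneg)
      also have "\<dots> \<le> 4 * pi * sqrt (ksq k) * ((2 + 2 * \<Lambda>) * \<Lambda> * s powr (- (p - 1) / 4))"
        using norm_divcoef_le[OF p w2[OF sT] s(1) wL[OF sT]] by simp
      finally show ?thesis using s by (simp add: algebra_simps minus_divide_left)
    qed
  qed (use p t in auto)
  have "fcoef (u t) k - fcoef (v t) k = (\<integral>s. duh_coef p v t s k \<partial>lebesgue_on {0..t}) - (\<integral>s. duh_coef p u t s k \<partial>lebesgue_on {0..t})"
    using u v t unfolding mild_solution_def by (auto simp del: split_paired_All)
  then show "fcoef (u t) k - fcoef (v t) k = (\<integral>s. duh_coef p v t s k - duh_coef p u t s k \<partial>lebesgue_on {0..t})"
    using int[OF mu u2 uL] int[OF mv v2 vL] by simp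
qed

lemma L2norm_diff_eq_0:
  assumes "L2fun f" "L2fun g" "\<And>k. fcoef f k = fcoef g k"
  shows "L2norm (\<lambda>x. f x - g x) = 0"
proof -
  have "(L2norm (\<lambda>x. f x - g x))\<^sup>2 = 0"
    using assms by (simp add: Parseval L2fun_diff fcoef_diff L2fun_integrable)
  then show ?thesis by simp
qed

text \<open>No supremum is formed. The distance \<open>\<omega>\<close> of the gradients is compared
  with any admissible multiple \<open>\<Omega>\<close> of the weight
  \<open>t powr (- (1/4)) * exp (\<mu> * t)\<close>; one pass through the Duhamel formula halves
  \<open>\<Omega>\<close>, and iterating from an a priori bound makes \<open>\<omega>\<close>
  vanish.\<close>

lemma mild_solution_unique:
  assumes p: "2 < p" "p < 3"
    and u: "mild_solution p T u0 u" and v: "mild_solution p T u0 v"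
    and Su: "S_tilde T u" and Sv: "S_tilde T v" and t: "t \<in> {0..T}"
  shows "L2norm (\<lambda>x. v t x - u t x) = 0"
proof -
  define \<delta> where "\<delta> = (3 - p) / 4"
  have \<delta>: "0 < \<delta>" "\<delta> < 1/4" using p by (auto simp: \<delta>_def)
  obtain Cu Cv where "\<forall>t\<in>{0<..T}. t powr (1/4) * L2normv (wgrad (u t)) \<le> Cu"
    "\<forall>t\<in>{0<..T}. t powr (1/4) * L2normv (wgrad (v t)) \<le> Cv"
    using Su Sv unfolding S_tilde_def by blast
  then obtain \<Lambda> where \<Lambda>: "\<Lambda> \<ge> 0"
    and uL: "\<And>s. s \<in> {0<..T} \<Longrightarrow> s powr (1/4) * L2normv (wgrad (u s)) \<le> \<Lambda>"
    and vL: "\<And>s. s \<in> {0<..T} \<Longrightarrow> s powr (1/4) * L2normv (wgrad (v s)) \<le> \<Lambda>"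
    using that[of "max 0 (max Cu Cv)"] by (fastforce simp: le_max_iff_disj)
  have u2: "L2vec (wgrad (u s))" and v2: "L2vec (wgrad (v s))"
    and gu: "is_wgrad (u s) (wgrad (u s))" and gv: "is_wgrad (v s) (wgrad (v s))" if "s \<in> {0<..T}" for s
    using Su Sv that by (auto simp: S_tilde_def intro: is_wgrad_wgrad)
  define Q where "Q = sqrt (\<Sum>\<^sub>\<infinity>k. (mode_weight \<delta> k)\<^sup>2)"
  \<comment> \<open>The exponent is \<open>3/4 + \<delta>\<close> and not the
    \<open>3/4 + \<delta>/2\<close> of the heat kernel: the other \<open>\<delta>/2\<close> is paid
    for the exponential weight. By the choice of \<open>\<delta>\<close> the integral then
    reproduces exactly \<open>t powr (- (1/4))\<close>.\<close>
  define B where "B = Beta (1 - (p - 1) / 4) (1 - (3/4 + \<delta>))"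
  define c where "c = 2 * pi * Q * (4 * pi * (2 + 2 * \<Lambda>) * B)"
  \<comment> \<open>Chosen so that
    \<open>c * \<mu> powr (- (\<delta> / 2)) \<le> 1 / 2\<close>.\<close>
  define \<mu> where "\<mu> = (2 * \<bar>c\<bar> + 1) powr (2 / \<delta>)"
  define \<omega> where "\<omega> s = L2normv (\<lambda>x. wgrad (u s) x - wgrad (v s) x)" for s
  have \<mu>: "\<mu> > 0" by (simp add: \<mu>_def)
  have "\<mu> powr (- (\<delta> / 2)) = 1 / (2 * \<bar>c\<bar> + 1)"
    unfolding \<mu>_def powr_powr using \<delta> by (simp add: powr_minus inverse_eq_divide)
  then have "c * \<mu> powr (- (\<delta> / 2)) \<le> \<bar>c\<bar> * (1 / (2 * \<bar>c\<bar> + 1))"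
    by (simp only:) (intro mult_right_mono, auto)
  also have "\<dots> \<le> 1 / 2" by (simp add: field_simps)
  finally have c\<mu>: "c * \<mu> powr (- (\<delta> / 2)) \<le> 1 / 2" .
  have B_pos: "B \<ge> 0"
    unfolding B_def using p \<delta> by (intro Beta_real_nonneg) auto
  have mode: "sqrt (ksq k) * cmod (fcoef (u t) k - fcoef (v t) k) \<le>
      mode_weight \<delta> k * (4 * pi * (2 + 2 * \<Lambda>) * B * \<mu> powr (- (\<delta> / 2)) * \<Omega> * exp (\<mu> * t) * t powr (- (1/4)))"
    if \<Omega>: "\<And>s. s \<in> {0<..T} \<Longrightarrow> \<omega> s \<le> \<Omega> * s powr (- (1/4)) * exp (\<mu> * s)" and t: "t \<in> {0<..T}" for \<Omega> t k
  proof -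
    note diff = mild_solution_coef_diff[OF p u v u2 v2 uL vL t, of k]
    define f where "f s = complex_of_real (sqrt (ksq k)) * (duh_coef p v t s k - duh_coef p u t s k)" for s
    define C where "C = mode_weight \<delta> k * (4 * pi * (2 + 2 * \<Lambda>) * \<mu> powr (- (\<delta> / 2)) * \<Omega> * exp (\<mu> * t))"
    have f_meas: "f \<in> borel_measurable (lebesgue_on {0..t})"
      unfolding f_def using diff(1) by (intro borel_measurable_times) auto
    have f_le: "norm (f s) \<le> C * ((t - s) powr (- (3/4 + \<delta>)) * s powr (- ((p - 1) / 4)))" if s: "0 < s" "s < t" for s
    proof -
      have sT: "s \<in> {0<..T}" using s t by auto
      have \<Omega>0: "0 \<le> \<Omega> * s powr (- (1/4)) * exp (\<mu> * s)"
        using \<Omega>[OF sT] unfolding \<omega>_def by (rule order_trans[OF L2normv_nonneg])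
      have "norm (f s) = sqrt (ksq k) * (exp (- (t - s) * knorm4 k) * cmod (divcoef p (wgrad (v s)) k - divcoef p (wgrad (u s)) k))"
        unfolding f_def duh_coef_eq by (simp add: norm_mult flip: right_diff_distrib)
      also have "\<dots> \<le> sqrt (ksq k) * (exp (- (t - s) * knorm4 k) * (4 * pi * sqrt (ksq k) * (s powr (- (p - 2) / 4) * (2 + 2 * \<Lambda>) * \<omega> s)))"
        unfolding \<omega>_def norm_minus_commute[of "divcoef p (wgrad (v s)) k"]
        by (intro mult_left_mono norm_divcoef_diff_le p u2 v2 uL vL sT s) auto
      also have "\<dots> = (ksq k * exp (- (t - s) * knorm4 k)) * (4 * pi * (s powr (- (p - 2) / 4) * (2 + 2 * \<Lambda>) * \<omega> s))"
        using real_sqrt_mult_self[of "ksq k"] by (simp add: mult_ac)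
      also have "\<dots> \<le> (mode_weight \<delta> k * (t - s) powr (- (3/4 + \<delta>/2))) * (4 * pi * (s powr (- (p - 2) / 4) * (2 + 2 * \<Lambda>) * (\<Omega> * s powr (- (1/4)) * exp (\<mu> * s))))"
        using s \<delta> \<Lambda> \<Omega>[OF sT] \<Omega>0
        by (intro mult_mono heat_kernel_grad mult_left_mono mult_nonneg_nonneg) (auto simp: \<omega>_def)
      \<comment> \<open>The weight at time \<open>s\<close> is split into the weight at time
        \<open>t\<close>, which leaves the integral, and a decaying factor in \<open>t - s\<close>,
        which is exchanged for a small power of \<open>\<mu>\<close>.\<close>
      also have "\<dots> = mode_weight \<delta> k * (4 * pi * (2 + 2 * \<Lambda>) * \<Omega> * exp (\<mu> * t)) * (s powr (- (p - 2) / 4) * s powr (- (1/4))) * ((t - s) powr (- (3/4 + \<delta>/2)) * exp (- (\<mu> * (t - s))))"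
      proof -
        have "exp (\<mu> * s) = exp (\<mu> * t) * exp (- (\<mu> * (t - s)))"
          by (simp add: right_diff_distrib flip: exp_add)
        then show ?thesis by (simp add: mult_ac)
      qed
      also have "s powr (- (p - 2) / 4) * s powr (- (1/4)) = s powr (- ((p - 1) / 4))"
        unfolding powr_add[symmetric] by (rule arg_cong[where f = "(powr) s"]) (simp add: field_simps)
      also have "mode_weight \<delta> k * (4 * pi * (2 + 2 * \<Lambda>) * \<Omega> * exp (\<mu> * t)) * s powr (- ((p - 1) / 4)) * ((t - s) powr (- (3/4 + \<delta>/2)) * exp (- (\<mu> * (t - s))))
        \<le> mode_weight \<delta> k * (4 * pi * (2 + 2 * \<Lambda>) * \<Omega> * exp (\<mu> * t)) * s powr (- ((p - 1) / 4)) * ((t - s) powr (- (3/4 + \<delta>/2)) * (\<mu> * (t - s)) powr (- (\<delta> / 2)))"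
      proof (intro mult_left_mono)
        have "0 \<le> \<Omega>" using \<Omega>0 s by (simp add: zero_le_mult_iff)
        then show "0 \<le> mode_weight \<delta> k * (4 * pi * (2 + 2 * \<Lambda>) * \<Omega> * exp (\<mu> * t)) * s powr (- ((p - 1) / 4))"
          using \<Lambda> by (intro mult_nonneg_nonneg) auto
        show "exp (- (\<mu> * (t - s))) \<le> (\<mu> * (t - s)) powr - (\<delta> / 2)"
          using s \<mu> \<delta> by (intro exp_neg_le_powr) auto
      qed auto
      also have "(t - s) powr (- (3/4 + \<delta>/2)) * (\<mu> * (t - s)) powr (- (\<delta> / 2)) = \<mu> powr (- (\<delta> / 2)) * (t - s) powr (- (3/4 + \<delta>))"
      proof -
        have "(\<mu> * (t - s)) powr (- (\<delta> / 2)) = \<mu> powr (- (\<delta> / 2)) * (t - s) powr (- (\<delta> / 2))"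
          by (rule powr_mult)
        moreover have "(t - s) powr (- (3/4 + \<delta>/2)) * (t - s) powr (- (\<delta> / 2)) = (t - s) powr (- (3/4 + \<delta>))"
          unfolding powr_add[symmetric] by (rule arg_cong[where f = "(powr) (t - s)"]) (simp add: field_simps)
        ultimately show ?thesis by (simp add: mult_ac)
      qed
      finally show ?thesis by (simp add: C_def mult_ac)
    qed
    have "norm (\<integral>s. f s \<partial>lebesgue_on {0..t}) \<le> C * (B * t powr (1 - (3/4 + \<delta>) - (p - 1) / 4))"
      unfolding B_def using p \<delta> t by (intro beta_kernel_dominated(2) f_meas f_le) auto
    also have "1 - (3/4 + \<delta>) - (p - 1) / 4 = - (1/4)"
      by (simp add: \<delta>_def field_simps)
    also have "(\<integral>s. f s \<partial>lebesgue_on {0..t}) = complex_of_real (sqrt (ksq k)) * (fcoef (u t) k - fcoef (v t) k)"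
      by (simp only: f_def diff(2) integral_mult_right_zero)
    finally show ?thesis by (simp add: C_def norm_mult mult_ac)
  qed
  have step: "\<omega> t \<le> (c * \<mu> powr (- (\<delta> / 2))) * \<Omega> * t powr (- (1/4)) * exp (\<mu> * t)"
    if \<Omega>: "\<And>s. s \<in> {0<..T} \<Longrightarrow> \<omega> s \<le> \<Omega> * s powr (- (1/4)) * exp (\<mu> * s)" and t: "t \<in> {0<..T}" for \<Omega> t
  proof -
    define E where "E = 4 * pi * (2 + 2 * \<Lambda>) * B * \<mu> powr (- (\<delta> / 2)) * \<Omega> * exp (\<mu> * t) * t powr (- (1/4))"
    have E0: "E \<ge> 0"
    proof -
      have "0 \<le> \<Omega> * t powr (- (1/4)) * exp (\<mu> * t)"
        using \<Omega>[OF t] unfolding \<omega>_def by (rule order_trans[OF L2normv_nonneg])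
      then have "0 \<le> (4 * pi * (2 + 2 * \<Lambda>) * B * \<mu> powr (- (\<delta> / 2))) * (\<Omega> * t powr (- (1/4)) * exp (\<mu> * t))"
        using \<Lambda> B_pos by (intro mult_nonneg_nonneg[of "_ * _ * _ * _ * _"]) auto
      then show ?thesis by (simp add: E_def mult_ac)
    qed
    have le: "4 * pi\<^sup>2 * ksq k * (cmod (fcoef (u t) k - fcoef (v t) k))\<^sup>2 \<le> 4 * pi\<^sup>2 * E\<^sup>2 * (mode_weight \<delta> k)\<^sup>2" for k
    proof -
      have "(sqrt (ksq k) * cmod (fcoef (u t) k - fcoef (v t) k))\<^sup>2 \<le> (mode_weight \<delta> k * E)\<^sup>2"
        unfolding E_def by (intro power_mono mode \<Omega> t) auto
      then have "4 * pi\<^sup>2 * (sqrt (ksq k) * cmod (fcoef (u t) k - fcoef (v t) k))\<^sup>2 \<le> 4 * pi\<^sup>2 * (mode_weight \<delta> k * E)\<^sup>2"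
        by (intro mult_left_mono) auto
      then show ?thesis by (simp add: power_mult_distrib mult_ac)
    qed
    have "(\<omega> t)\<^sup>2 = (\<Sum>\<^sub>\<infinity>k. 4 * pi\<^sup>2 * ksq k * (cmod (fcoef (u t) k - fcoef (v t) k))\<^sup>2)"
      unfolding \<omega>_def by (rule wgrad_diff_Parseval(2)[OF gu gv u2 v2]) (rule t)+
    also have "\<dots> \<le> (\<Sum>\<^sub>\<infinity>k. 4 * pi\<^sup>2 * E\<^sup>2 * (mode_weight \<delta> k)\<^sup>2)"
      using le \<delta> by (intro infsum_mono wgrad_diff_Parseval(1)[OF gu gv u2 v2] t summable_on_cmult_right mode_weight_square_summable)
    also have "\<dots> = 4 * pi\<^sup>2 * E\<^sup>2 * (\<Sum>\<^sub>\<infinity>k. (mode_weight \<delta> k)\<^sup>2)"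
      by (rule infsum_cmult_right')
    also have "\<dots> = (2 * pi * Q * E)\<^sup>2"
      by (simp add: Q_def power_mult_distrib infsum_nonneg)
    finally have "\<omega> t \<le> 2 * pi * Q * E"
      by (rule power2_le_imp_le) (use E0 in \<open>auto simp: Q_def infsum_nonneg\<close>)
    then show ?thesis by (simp only: E_def c_def mult_ac)
  qed
  \<comment> \<open>The induction starts from a crude bound: the gradients alone give
    \<open>2 * \<Lambda>\<close>, and the exponential is at least 1.\<close>
  have iter: "\<omega> t \<le> (4 * \<Lambda> * (1/2) ^ n) * t powr (- (1/4)) * exp (\<mu> * t)" if "t \<in> {0<..T}" for n t
    using that
  proof (induction n arbitrary: t)
    case 0
    have "(\<omega> t)\<^sup>2 = (\<integral>x. (norm (wgrad (u t) x - wgrad (v t) x))\<^sup>2 \<partial>TM)"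
      by (simp add: \<omega>_def L2normv_def)
    also have "\<dots> \<le> (\<integral>x. 2 * (norm (wgrad (u t) x))\<^sup>2 + 2 * (norm (wgrad (v t) x))\<^sup>2 \<partial>TM)"
    proof (rule integral_mono)
      show "integrable TM (\<lambda>x. (norm (wgrad (u t) x - wgrad (v t) x))\<^sup>2)"
        using L2vec_diff[OF u2 v2, OF 0 0] by (simp add: L2vec_def)
      show "integrable TM (\<lambda>x. 2 * (norm (wgrad (u t) x))\<^sup>2 + 2 * (norm (wgrad (v t) x))\<^sup>2)"
        using u2[OF 0] v2[OF 0] by (simp add: L2vec_def)
      show "(norm (wgrad (u t) x - wgrad (v t) x))\<^sup>2 \<le> 2 * (norm (wgrad (u t) x))\<^sup>2 + 2 * (norm (wgrad (v t) x))\<^sup>2" for x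
        using norm_add_square_le[of "wgrad (u t) x" "- wgrad (v t) x"] by simp
    qed
    also have "\<dots> = 2 * (L2normv (wgrad (u t)))\<^sup>2 + 2 * (L2normv (wgrad (v t)))\<^sup>2"
      using u2[OF 0] v2[OF 0] by (simp add: L2vec_def L2normv_def)
    also have "\<dots> \<le> 2 * (\<Lambda> * t powr (- (1/4)))\<^sup>2 + 2 * (\<Lambda> * t powr (- (1/4)))\<^sup>2"
      using uL[OF 0] vL[OF 0] 0
      by (intro add_mono mult_left_mono power_mono) (auto simp: powr_minus field_simps)
    also have "\<dots> = (2 * \<Lambda> * t powr (- (1/4)))\<^sup>2"
      by (simp add: power_mult_distrib)
    finally have "\<omega> t \<le> 2 * \<Lambda> * t powr (- (1/4))"
      by (rule power2_le_imp_le) (use \<Lambda> in auto)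
    also have "\<dots> \<le> 4 * \<Lambda> * t powr (- (1/4))"
      using \<Lambda> by (intro mult_right_mono) auto
    also have "\<dots> = 4 * \<Lambda> * t powr (- (1/4)) * 1" by simp
    also have "\<dots> \<le> 4 * \<Lambda> * t powr (- (1/4)) * exp (\<mu> * t)"
      using \<Lambda> \<mu> 0 by (intro mult_left_mono) auto
    finally show ?case by simp
  next
    case (Suc n)
    have "\<omega> t \<le> (c * \<mu> powr (- (\<delta> / 2))) * (4 * \<Lambda> * (1/2) ^ n) * t powr (- (1/4)) * exp (\<mu> * t)"
      by (rule step[OF Suc.IH Suc.prems])
    also have "\<dots> \<le> (1 / 2) * (4 * \<Lambda> * (1/2) ^ n) * t powr (- (1/4)) * exp (\<mu> * t)"
      using c\<mu> \<Lambda> by (intro mult_right_mono) auto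
    finally show ?case by simp
  qed
  have \<omega>0: "\<omega> s \<le> 0 * s powr (- (1/4)) * exp (\<mu> * s)" if "s \<in> {0<..T}" for s
  proof (rule LIMSEQ_le_const)
    show "(\<lambda>n. (4 * \<Lambda> * (1/2) ^ n) * s powr (- (1/4)) * exp (\<mu> * s)) \<longlonglongrightarrow> 0 * s powr (- (1/4)) * exp (\<mu> * s)"
      by (intro tendsto_mult_right tendsto_mult_right_zero LIMSEQ_realpow_zero) auto
  qed (use iter[OF that] in auto)
  \<comment> \<open>With \<open>\<Omega> = 0\<close> the estimate \<open>mode\<close> removes every
    difference with \<open>k \<noteq> 0\<close>; the zero modes agree because a divergence has mean
    zero. At \<open>t = 0\<close> the Duhamel integrals run over a null set.\<close>
  have "fcoef (v t) k = fcoef (u t) k" for k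
  proof (cases "t = 0")
    case True
    have "(\<integral>s. f s \<partial>lebesgue_on {0..0}) = 0" for f :: "real \<Rightarrow> complex"
      by (rule integral_eq_zero_AE) (rule AE_lebesgue_on_singleton)
    then show ?thesis
      using u v t True unfolding mild_solution_def by (auto simp del: split_paired_All)
  next
    case False
    then have t': "t \<in> {0<..T}" using t by auto
    show ?thesis
    proof (cases "k = 0")
      case True
      then show ?thesis
        using mild_solution_coef_diff(2)[OF p u v u2 v2 uL vL t', of 0] by (simp add: duh_coef_eq)
    next
      case False
      have "sqrt (ksq k) * cmod (fcoef (u t) k - fcoef (v t) k) \<le> 0"
        using mode[OF \<omega>0 t', of k] by simp
      then show ?thesis using ksq_pos[OF False] by (simp add: mult_le_0_iff)
    qed
  qed
  then show ?thesis
    using u v t by (intro L2norm_diff_eq_0) (auto simp: mild_solution_def C_L2_def)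
qed

subsection \<open>The fixed point equation for the Fourier modes\<close>

lemma continuous_on_infsum_dominated:
  fixes f :: "'k \<Rightarrow> 'a::topological_space \<Rightarrow> real"
  assumes "\<And>k. continuous_on Y (f k)" "\<And>k s. s \<in> Y \<Longrightarrow> \<bar>f k s\<bar> \<le> M k" "M summable_on UNIV"
  shows "continuous_on Y (\<lambda>s. \<Sum>\<^sub>\<infinity>k. f k s)"
proof (rule uniform_limit_theorem)
  show "uniform_limit Y (\<lambda>X s. \<Sum>k\<in>X. f k s) (\<lambda>s. \<Sum>\<^sub>\<infinity>k. f k s) (finite_subsets_at_top UNIV)"
    by (rule Weierstrass_m_test_general[where M = M]) (use assms in auto)
  show "\<forall>\<^sub>F X in finite_subsets_at_top UNIV. continuous_on Y (\<lambda>s. \<Sum>k\<in>X. f k s)"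
    using assms(1) by (intro always_eventually allI continuous_on_sum)
qed simp

lemma continuous_on_greaterThanAtMostI:
  fixes f :: "real \<Rightarrow> 'a::topological_space"
  assumes "\<And>a. 0 < a \<Longrightarrow> continuous_on {a..T} f"
  shows "continuous_on {0<..T} f"
  unfolding continuous_on_def
proof
  fix t assume t: "t \<in> {0<..T}"
  then have "(f \<longlongrightarrow> f t) (at t within {t/2..T})"
    using assms[of "t/2"] by (auto simp: continuous_on_def)
  moreover have "at t within {t/2..T} = at t within {0<..T}"
    by (rule at_within_nhd[of _ "{t/2<..}"]) (use t in auto)
  ultimately show "(f \<longlongrightarrow> f t) (at t within {0<..T})" by simp
qed

lemma borel_measurable_lebesgue_on_finite_change:
  fixes f g :: "real \<Rightarrow> 'a::{topological_space}"
  assumes "g \<in> borel_measurable (lebesgue_on {a..b})" "finite X" "\<And>s. s \<in> {a..b} \<Longrightarrow> s \<notin> X \<Longrightarrow> f s = g s"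
  shows "f \<in> borel_measurable (lebesgue_on {a..b})"
proof (rule measurable_discrete_difference[of g _ _ "X \<inter> {a..b}"])
  show "{x} \<in> sets (lebesgue_on {a..b})" if "x \<in> X \<inter> {a..b}" for x
    using that by (auto simp: sets_restrict_space intro!: image_eqI[of _ _ "{x}"])
qed (use assms in \<open>auto simp: countable_finite\<close>)

lemma continuous_on_Ioc_borel_measurable:
  fixes f :: "real \<Rightarrow> 'a::euclidean_space"
  assumes "continuous_on {0<..T} f" "t \<le> T"
  shows "f \<in> borel_measurable (lebesgue_on {0..t})"
proof (rule borel_measurable_lebesgue_on_finite_change[of "\<lambda>s. indicator {0<..T} s *\<^sub>R f s" 0 t "{0}"])
  have "(\<lambda>s. indicator {0<..T} s *\<^sub>R f s) \<in> borel_measurable borel"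
    by (rule borel_measurable_continuous_on_indicator) (use assms in auto)
  then show "(\<lambda>s. indicator {0<..T} s *\<^sub>R f s) \<in> borel_measurable (lebesgue_on {0..t})"
    by (intro measurable_restrict_space1 measurable_completion) simp
qed (use assms in auto)

text \<open>The frequency lattice is discrete, so continuity in both variables is continuity of
  every mode. This lets one space of bounded continuous functions carry the supremum over all modes
  and times.\<close>

lemma continuous_on_discrete_fst:
  fixes f :: "(int \<times> int) \<times> real \<Rightarrow> 'a::topological_space"
  assumes "\<And>k. continuous_on UNIV (\<lambda>x. f (k, x))"
  shows "continuous_on UNIV f"
  unfolding continuous_on_open_vimage[OF open_UNIV]
proof (intro allI impI)
  fix B :: "'a set" assume B: "open B"
  have "open ({k} \<times> ((\<lambda>x. f (k, x)) -` B))" for k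
  proof (rule open_Times)
    have "open ({fst k} \<times> {snd k})" by (intro open_Times open_discrete)
    then show "open {k}" by (cases k) simp
    show "open ((\<lambda>x. f (k, x)) -` B)"
      using assms[of k] B by (simp add: continuous_on_open_vimage)
  qed
  then have "open (\<Union>k. {k} \<times> ((\<lambda>x. f (k, x)) -` B))" by blast
  also have "(\<Union>k. {k} \<times> ((\<lambda>x. f (k, x)) -` B)) = f -` B \<inter> UNIV" by auto
  finally show "open (f -` B \<inter> UNIV)" .
qed

definition smoothing_exp :: "real \<Rightarrow> real" where "smoothing_exp p = (3 - p) / 4"

definition qnorm :: "real \<Rightarrow> real" where "qnorm p = sqrt (\<Sum>\<^sub>\<infinity>k. (mode_weight (smoothing_exp p) k)\<^sup>2)"

text \<open>Bound for the rescaled gradient norm when the modes have norm at most 1; the inner 2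
  comes from separating linear and Duhamel parts by \<open>norm_add_square_le\<close>. It sees the
  initial datum only through its norm, and so does the existence time.\<close>

definition grad_radius :: "real \<Rightarrow> real \<Rightarrow> real" where
  "grad_radius p r = 2 * pi * sqrt (2 * (r\<^sup>2 + (qnorm p)\<^sup>2))"

definition beta_grad :: "real \<Rightarrow> real" where
  "beta_grad p = Beta (1 - (p - 1) / 4) (1 - (3/4 + smoothing_exp p / 2))"

text \<open>The modes of the Duhamel term are stored rescaled and in logarithmic time, so that bounded continuous
  functions on the whole line describe weighted bounds on \<open>(0,T]\<close> without any condition at \<open>t = 0\<close>.\<close>

type_synonym modes = "((int \<times> int) \<times> real, complex) bcontfun"

section \<open>Gradient fields built from rescaled modes\<close>

locale mild_data =
  fixes p T :: real and u0 :: "real \<times> real \<Rightarrow> real"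
  assumes p: "2 < p" "p < 3" and T: "0 < T" "T \<le> 1" and u0: "L2fun u0"
begin

abbreviation "\<delta> \<equiv> smoothing_exp p"
abbreviation "q \<equiv> mode_weight (smoothing_exp p)"
abbreviation "\<Lambda> \<equiv> grad_radius p (L2norm u0)"

lemma delta: "0 < \<delta>" "\<delta> < 1/4"
  using p by (auto simp: smoothing_exp_def)

lemma q_sum: "(\<lambda>k. (q k)\<^sup>2) summable_on UNIV"
  by (rule mode_weight_square_summable[OF delta(1)])

lemma qnorm_square: "(qnorm p)\<^sup>2 = (\<Sum>\<^sub>\<infinity>k. (q k)\<^sup>2)"
  by (simp add: qnorm_def infsum_nonneg)

lemma qnorm_nonneg [simp]: "qnorm p \<ge> 0"
  by (simp add: qnorm_def infsum_nonneg)

lemma beta_grad_nonneg [simp]: "beta_grad p \<ge> 0"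
  unfolding beta_grad_def using p delta by (intro Beta_real_nonneg) auto

lemma Lam_nonneg [simp]: "\<Lambda> \<ge> 0"
  by (simp add: grad_radius_def)

text \<open>Undoes the rescaling: norm at most 1 for \<open>E\<close> means that
  \<open>sqrt (ksq k)\<close> times the mode is at most \<open>q k * t powr (- (1/4))\<close>. At
  \<open>k = 0\<close> the factor is 0 because \<open>q 0 = 0\<close>, in accordance with the
  mean-zero divergence.\<close>

definition duhamel_of :: "modes \<Rightarrow> real \<Rightarrow> int \<times> int \<Rightarrow> complex" where
  "duhamel_of E t k = E (k, ln t) * complex_of_real (q k * t powr (- (1/4)) / sqrt (ksq k))"

definition coef_of :: "modes \<Rightarrow> real \<Rightarrow> int \<times> int \<Rightarrow> complex" where
  "coef_of E t k = complex_of_real (exp (- t * knorm4 k)) * fcoef u0 k - duhamel_of E t k"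

definition grad_coef1 :: "modes \<Rightarrow> real \<Rightarrow> int \<times> int \<Rightarrow> complex" where
  "grad_coef1 E t k = 2 * pi * \<i> * of_int (fst k) * coef_of E t k"

definition grad_coef2 :: "modes \<Rightarrow> real \<Rightarrow> int \<times> int \<Rightarrow> complex" where
  "grad_coef2 E t k = 2 * pi * \<i> * of_int (snd k) * coef_of E t k"

text \<open>Synthesis from coefficients imposes no reality condition on \<open>E\<close>. For
  general \<open>E\<close> the prescribed coefficients are attained only up to symmetrisation; at a
  fixed point they are attained exactly.\<close>

definition grad_of :: "modes \<Rightarrow> real \<Rightarrow> real \<times> real \<Rightarrow> real \<times> real" where
  "grad_of E t x = (l2_synth (grad_coef1 E t) x, l2_synth (grad_coef2 E t) x)"

definition duhamel_mode :: "modes \<Rightarrow> real \<Rightarrow> int \<times> int \<Rightarrow> complex" where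
  "duhamel_mode E t k = (\<integral>s. complex_of_real (exp (- (t - s) * knorm4 k)) * divcoef p (grad_of E s) k \<partial>lebesgue_on {0..t})"

text \<open>The rescaling inverse to the one in \<open>duhamel_of\<close>. Capping the time at
  \<open>T\<close> freezes the value afterwards, so estimates on (0,T] cover the whole logarithmic
  line.\<close>

definition PhiF :: "modes \<Rightarrow> (int \<times> int) \<times> real \<Rightarrow> complex" where
  "PhiF E z = complex_of_real (min (exp (snd z)) T powr (1/4) * sqrt (ksq (fst z)) / q (fst z)) * duhamel_mode E (min (exp (snd z)) T) (fst z)"

lemma duhamel_of_diff_le:
  assumes "t > 0"
  shows "sqrt (ksq k) * cmod (duhamel_of E t k - duhamel_of E' t k) \<le> q k * t powr (- (1/4)) * dist E E'"
proof (cases "k = 0")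
  case False
  have "cmod (duhamel_of E t k - duhamel_of E' t k) = dist (E (k, ln t)) (E' (k, ln t)) * (q k * t powr (- (1/4)) / sqrt (ksq k))"
    unfolding duhamel_of_def left_diff_distrib[symmetric] norm_mult norm_of_real dist_norm by simp
  then have "sqrt (ksq k) * cmod (duhamel_of E t k - duhamel_of E' t k) = dist (E (k, ln t)) (E' (k, ln t)) * (q k * t powr (- (1/4)))"
    using ksq_pos[OF False] by simp
  also have "\<dots> \<le> dist E E' * (q k * t powr (- (1/4)))"
    by (intro mult_right_mono dist_bounded) auto
  finally show ?thesis by (simp add: mult_ac)
qed simp

lemma duhamel_of_le:
  assumes "t > 0"
  shows "sqrt (ksq k) * cmod (duhamel_of E t k) \<le> q k * t powr (- (1/4)) * norm E"
  using duhamel_of_diff_le[OF assms, of k E 0] by (simp add: duhamel_of_def)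

text \<open>The linear part is controlled by \<open>heat_kernel_grad_L2\<close>, the Duhamel part by
  the mode weight; both contribute the same power of \<open>t\<close>.\<close>

lemma ksq_coef_of_le:
  assumes t: "t > 0"
  shows "ksq k * (cmod (coef_of E t k))\<^sup>2 \<le> t powr (- (1/2)) * (2 * (cmod (fcoef u0 k))\<^sup>2 + 2 * ((norm E)\<^sup>2 * (q k)\<^sup>2))"
proof -
  have tt: "(t powr (- (1/4)))\<^sup>2 = t powr (- (1/2))"
    using t by (simp add: power2_eq_square flip: powr_add)
  have 1: "sqrt (ksq k) * exp (- t * knorm4 k) \<le> t powr (- (1/4))"
    using heat_kernel_grad_L2[OF t, of k] t by (simp add: powr_minus field_simps)
  have "sqrt (ksq k) * cmod (complex_of_real (exp (- t * knorm4 k)) * fcoef u0 k) \<le> t powr (- (1/4)) * cmod (fcoef u0 k)"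
    using mult_right_mono[OF 1, of "cmod (fcoef u0 k)"] by (simp add: norm_mult mult_ac)
  then have "(sqrt (ksq k) * cmod (complex_of_real (exp (- t * knorm4 k)) * fcoef u0 k))\<^sup>2 \<le> (t powr (- (1/4)) * cmod (fcoef u0 k))\<^sup>2"
    by (intro power_mono) auto
  moreover have "(sqrt (ksq k) * cmod (duhamel_of E t k))\<^sup>2 \<le> (q k * t powr (- (1/4)) * norm E)\<^sup>2"
    by (intro power_mono duhamel_of_le t) auto
  moreover have "ksq k * (cmod (coef_of E t k))\<^sup>2 \<le> ksq k * (2 * (cmod (complex_of_real (exp (- t * knorm4 k)) * fcoef u0 k))\<^sup>2 + 2 * (cmod (duhamel_of E t k))\<^sup>2)"
    using norm_add_square_le[of "complex_of_real (exp (- t * knorm4 k)) * fcoef u0 k" "- duhamel_of E t k"]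
    by (intro mult_left_mono) (auto simp: coef_of_def)
  ultimately show ?thesis
    by (simp add: power_mult_distrib tt algebra_simps)
qed

lemma grad_coef_square: "(cmod (grad_coef1 E t k - grad_coef1 E' s k))\<^sup>2 + (cmod (grad_coef2 E t k - grad_coef2 E' s k))\<^sup>2
    = 4 * pi\<^sup>2 * (ksq k * (cmod (coef_of E t k - coef_of E' s k))\<^sup>2)"
  unfolding grad_coef1_def grad_coef2_def right_diff_distrib[symmetric] norm_mult power_mult_distrib ksq_def
  by (simp add: algebra_simps)

lemma grad_coef_square0: "(cmod (grad_coef1 E t k))\<^sup>2 + (cmod (grad_coef2 E t k))\<^sup>2 = 4 * pi\<^sup>2 * (ksq k * (cmod (coef_of E t k))\<^sup>2)"
  unfolding grad_coef1_def grad_coef2_def norm_mult power_mult_distrib ksq_def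
  by (simp add: algebra_simps)

lemma coef_majorant_summable: "(\<lambda>k. 2 * (cmod (fcoef u0 k))\<^sup>2 + 2 * (C * (q k)\<^sup>2)) summable_on UNIV"
  by (intro summable_on_add summable_on_cmult_right Bessel u0 q_sum)

lemma ksq_coef_of_summable: "t > 0 \<Longrightarrow> (\<lambda>k. 4 * pi\<^sup>2 * (ksq k * (cmod (coef_of E t k))\<^sup>2)) summable_on UNIV"
  by (intro summable_on_cmult_right summable_on_comparison_test[OF summable_on_cmult_right[OF coef_majorant_summable] ksq_coef_of_le]) auto

lemma ell2_grad_coef: "t > 0 \<Longrightarrow> ell2 (grad_coef1 E t)" "t > 0 \<Longrightarrow> ell2 (grad_coef2 E t)"
  unfolding ell2_def
  by (rule summable_on_comparison_test[OF ksq_coef_of_summable[of t E]]; simp add: grad_coef_square0[symmetric])+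

lemma L2vec_grad_of: "t > 0 \<Longrightarrow> L2vec (grad_of E t)"
  by (simp add: L2vec_iff grad_of_def L2fun_l2_synth ell2_grad_coef)

lemma grad_of_bound:
  assumes t: "t > 0" and E: "norm E \<le> 1"
  shows "t powr (1/4) * L2normv (grad_of E t) \<le> \<Lambda>"
proof -
  have "(L2normv (grad_of E t))\<^sup>2 = (L2norm (l2_synth (grad_coef1 E t)))\<^sup>2 + (L2norm (l2_synth (grad_coef2 E t)))\<^sup>2"
    using L2normv_square[OF L2vec_grad_of[OF t, of E]] by (simp add: grad_of_def)
  also have "\<dots> \<le> (\<Sum>\<^sub>\<infinity>k. (cmod (grad_coef1 E t k))\<^sup>2) + (\<Sum>\<^sub>\<infinity>k. (cmod (grad_coef2 E t k))\<^sup>2)"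
    by (intro add_mono L2norm_l2_synth ell2_grad_coef t)
  also have "\<dots> = (\<Sum>\<^sub>\<infinity>k. (cmod (grad_coef1 E t k))\<^sup>2 + (cmod (grad_coef2 E t k))\<^sup>2)"
    using ell2_grad_coef[OF t, of E] unfolding ell2_def by (intro infsum_add[symmetric])
  also have "\<dots> \<le> (\<Sum>\<^sub>\<infinity>k. 4 * pi\<^sup>2 * (t powr (- (1/2)) * (2 * (cmod (fcoef u0 k))\<^sup>2 + 2 * (1 * (q k)\<^sup>2))))"
  proof (rule infsum_mono)
    show "(\<lambda>k. (cmod (grad_coef1 E t k))\<^sup>2 + (cmod (grad_coef2 E t k))\<^sup>2) summable_on UNIV"
      using ksq_coef_of_summable[OF t, of E] by (simp add: grad_coef_square0)
    show "(\<lambda>k. 4 * pi\<^sup>2 * (t powr (- (1/2)) * (2 * (cmod (fcoef u0 k))\<^sup>2 + 2 * (1 * (q k)\<^sup>2)))) summable_on UNIV"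
      by (intro summable_on_cmult_right coef_majorant_summable)
    fix k
    have "ksq k * (cmod (coef_of E t k))\<^sup>2 \<le> t powr (- (1/2)) * (2 * (cmod (fcoef u0 k))\<^sup>2 + 2 * ((norm E)\<^sup>2 * (q k)\<^sup>2))"
      by (rule ksq_coef_of_le[OF t])
    also have "\<dots> \<le> t powr (- (1/2)) * (2 * (cmod (fcoef u0 k))\<^sup>2 + 2 * (1 * (q k)\<^sup>2))"
      using E by (intro mult_left_mono add_mono mult_right_mono) (auto simp: power_le_one)
    finally show "(cmod (grad_coef1 E t k))\<^sup>2 + (cmod (grad_coef2 E t k))\<^sup>2 \<le> 4 * pi\<^sup>2 * (t powr (- (1/2)) * (2 * (cmod (fcoef u0 k))\<^sup>2 + 2 * (1 * (q k)\<^sup>2)))"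
      unfolding grad_coef_square0 by (intro mult_left_mono) auto
  qed
  also have "\<dots> = 4 * pi\<^sup>2 * (t powr (- (1/2)) * (2 * (\<Sum>\<^sub>\<infinity>k. (cmod (fcoef u0 k))\<^sup>2) + 2 * (\<Sum>\<^sub>\<infinity>k. (q k)\<^sup>2)))"
    unfolding infsum_cmult_right'
    by (subst infsum_add) (auto intro!: summable_on_cmult_right Bessel u0 q_sum simp: infsum_cmult_right')
  also have "\<dots> = t powr (- (1/2)) * \<Lambda>\<^sup>2"
  proof -
    have "\<Lambda>\<^sup>2 = 4 * pi\<^sup>2 * (2 * (L2norm u0)\<^sup>2 + 2 * (qnorm p)\<^sup>2)"
      by (simp add: grad_radius_def power_mult_distrib)
    then show ?thesis by (simp add: Parseval[OF u0] qnorm_square)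
  qed
  also have "\<dots> = (t powr (- (1/4)) * \<Lambda>)\<^sup>2"
    using t by (simp add: power_mult_distrib power2_eq_square flip: powr_add)
  finally have "L2normv (grad_of E t) \<le> t powr (- (1/4)) * \<Lambda>"
    by (rule power2_le_imp_le) simp
  then have "t powr (1/4) * L2normv (grad_of E t) \<le> t powr (1/4) * (t powr (- (1/4)) * \<Lambda>)"
    by (intro mult_left_mono) auto
  also have "\<dots> = \<Lambda>" using t by (simp add: powr_minus)
  finally show ?thesis .
qed

lemma grad_of_diff_square_le:
  assumes t: "t > 0" and s: "s > 0"
  shows "(L2normv (\<lambda>x. grad_of E t x - grad_of E' s x))\<^sup>2 \<le> (\<Sum>\<^sub>\<infinity>k. 4 * pi\<^sup>2 * (ksq k * (cmod (coef_of E t k - coef_of E' s k))\<^sup>2))"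
proof -
  have "(L2normv (\<lambda>x. grad_of E t x - grad_of E' s x))\<^sup>2 = (L2norm (\<lambda>x. l2_synth (grad_coef1 E t) x - l2_synth (grad_coef1 E' s) x))\<^sup>2 + (L2norm (\<lambda>x. l2_synth (grad_coef2 E t) x - l2_synth (grad_coef2 E' s) x))\<^sup>2"
    using L2normv_square[OF L2vec_diff[OF L2vec_grad_of[OF t, of E] L2vec_grad_of[OF s, of E']]] by (simp add: grad_of_def)
  also have "\<dots> \<le> (\<Sum>\<^sub>\<infinity>k. (cmod (grad_coef1 E t k - grad_coef1 E' s k))\<^sup>2) + (\<Sum>\<^sub>\<infinity>k. (cmod (grad_coef2 E t k - grad_coef2 E' s k))\<^sup>2)"
    by (intro add_mono L2norm_l2_synth_diff ell2_grad_coef t s)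
  also have "\<dots> = (\<Sum>\<^sub>\<infinity>k. (cmod (grad_coef1 E t k - grad_coef1 E' s k))\<^sup>2 + (cmod (grad_coef2 E t k - grad_coef2 E' s k))\<^sup>2)"
    using ell2_diff[OF ell2_grad_coef(1)[OF t, of E] ell2_grad_coef(1)[OF s, of E']] ell2_diff[OF ell2_grad_coef(2)[OF t, of E] ell2_grad_coef(2)[OF s, of E']]
    unfolding ell2_def by (intro infsum_add[symmetric])
  finally show ?thesis by (simp only: grad_coef_square)
qed

text \<open>The linear parts cancel, so only weighted Duhamel modes remain and the square sum of the
  weights appears as \<open>qnorm p\<close>.\<close>

lemma grad_of_diff_le:
  assumes t: "t > 0"
  shows "L2normv (\<lambda>x. grad_of E t x - grad_of E' t x) \<le> 2 * pi * qnorm p * dist E E' * t powr (- (1/4))"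
proof -
  have le: "4 * pi\<^sup>2 * (ksq k * (cmod (coef_of E t k - coef_of E' t k))\<^sup>2) \<le> 4 * pi\<^sup>2 * (t powr (- (1/4)) * dist E E')\<^sup>2 * (q k)\<^sup>2" for k
  proof -
    have "cmod (coef_of E t k - coef_of E' t k) = cmod (duhamel_of E t k - duhamel_of E' t k)"
      by (simp add: coef_of_def norm_minus_commute)
    then have "(sqrt (ksq k) * cmod (coef_of E t k - coef_of E' t k))\<^sup>2 \<le> (q k * t powr (- (1/4)) * dist E E')\<^sup>2"
      using duhamel_of_diff_le[OF t, of k E E'] by (intro power_mono) auto
    then have "4 * pi\<^sup>2 * (sqrt (ksq k) * cmod (coef_of E t k - coef_of E' t k))\<^sup>2 \<le> 4 * pi\<^sup>2 * (q k * t powr (- (1/4)) * dist E E')\<^sup>2"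
      by (intro mult_left_mono) auto
    then show ?thesis by (simp add: power_mult_distrib mult_ac)
  qed
  have "(L2normv (\<lambda>x. grad_of E t x - grad_of E' t x))\<^sup>2 \<le> (\<Sum>\<^sub>\<infinity>k. 4 * pi\<^sup>2 * (ksq k * (cmod (coef_of E t k - coef_of E' t k))\<^sup>2))"
    by (rule grad_of_diff_square_le[OF t t])
  also have "\<dots> \<le> (\<Sum>\<^sub>\<infinity>k. 4 * pi\<^sup>2 * (t powr (- (1/4)) * dist E E')\<^sup>2 * (q k)\<^sup>2)"
  proof (rule infsum_mono)
    show s: "(\<lambda>k. 4 * pi\<^sup>2 * (t powr (- (1/4)) * dist E E')\<^sup>2 * (q k)\<^sup>2) summable_on UNIV"
      by (intro summable_on_cmult_right q_sum)
    show "(\<lambda>k. 4 * pi\<^sup>2 * (ksq k * (cmod (coef_of E t k - coef_of E' t k))\<^sup>2)) summable_on UNIV"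
      by (rule summable_on_comparison_test[OF s le]) auto
  qed (rule le)
  also have "\<dots> = 4 * pi\<^sup>2 * (t powr (- (1/4)) * dist E E')\<^sup>2 * (qnorm p)\<^sup>2"
    by (simp only: infsum_cmult_right' qnorm_square)
  also have "\<dots> = (2 * pi * qnorm p * dist E E' * t powr (- (1/4)))\<^sup>2"
    by (simp add: power_mult_distrib)
  finally show ?thesis
    by (rule power2_le_imp_le) auto
qed

lemma continuous_on_coef_of:
  assumes "a > 0"
  shows "continuous_on {a..} (\<lambda>t. coef_of E t k)"
proof -
  have "continuous_on {a..} (\<lambda>t. E (k, ln t))"
    by (rule continuous_on_compose2[OF continuous_on_apply_bcontfun[of UNIV E]])
       (use assms in \<open>auto intro!: continuous_intros\<close>)
  then have "continuous_on {a..} (\<lambda>t. complex_of_real (exp (- t * knorm4 k)) * fcoef u0 k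
      - E (k, ln t) * r * complex_of_real (t powr (- (1/4))))" for r
    using assms by (auto intro!: continuous_intros)
  from this[of "complex_of_real (q k / sqrt (ksq k))"] show ?thesis
    by (simp add: coef_of_def duhamel_of_def mult_ac)
qed

text \<open>For times at least \<open>a > 0\<close> the Parseval series of the difference has a
  summable majorant independent of time, so it inherits continuity from its terms.\<close>

lemma grad_of_continuous:
  assumes a: "a > 0" and t: "t \<ge> a"
  shows "((\<lambda>s. L2normv (\<lambda>x. grad_of E s x - grad_of E t x)) \<longlongrightarrow> 0) (at t within {a..})"
proof -
  define h where "h s = (\<Sum>\<^sub>\<infinity>k. 4 * pi\<^sup>2 * (ksq k * (cmod (coef_of E s k - coef_of E t k))\<^sup>2))" for s
  define M where "M k = 2 * (cmod (fcoef u0 k))\<^sup>2 + 2 * ((norm E)\<^sup>2 * (q k)\<^sup>2)" for k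
  have "continuous_on {a..} h"
    unfolding h_def
  proof (rule continuous_on_infsum_dominated)
    show "(\<lambda>k. 4 * pi\<^sup>2 * (4 * (a powr (- (1/2)) * M k))) summable_on UNIV"
      unfolding M_def by (intro summable_on_cmult_right coef_majorant_summable)
    fix k
    show "continuous_on {a..} (\<lambda>s. 4 * pi\<^sup>2 * (ksq k * (cmod (coef_of E s k - coef_of E t k))\<^sup>2))"
      by (intro continuous_intros continuous_on_coef_of a)
    fix s assume s: "s \<in> {a..}"
    have M0: "M k \<ge> 0" by (simp add: M_def)
    have *: "ksq k * (cmod (coef_of E r k))\<^sup>2 \<le> a powr (- (1/2)) * M k" if "r \<ge> a" for r
    proof -
      have "ksq k * (cmod (coef_of E r k))\<^sup>2 \<le> r powr (- (1/2)) * M k"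
        unfolding M_def using that a by (intro ksq_coef_of_le) auto
      also have "\<dots> \<le> a powr (- (1/2)) * M k"
        using that a M0 by (intro mult_right_mono powr_mono2') auto
      finally show ?thesis .
    qed
    have "ksq k * (cmod (coef_of E s k - coef_of E t k))\<^sup>2 \<le> ksq k * (2 * (cmod (coef_of E s k))\<^sup>2 + 2 * (cmod (coef_of E t k))\<^sup>2)"
      using norm_add_square_le[of "coef_of E s k" "- coef_of E t k"] by (intro mult_left_mono) auto
    also have "\<dots> \<le> 4 * (a powr (- (1/2)) * M k)"
      using *[of s] *[of t] s t by (simp add: algebra_simps)
    finally show "\<bar>4 * pi\<^sup>2 * (ksq k * (cmod (coef_of E s k - coef_of E t k))\<^sup>2)\<bar> \<le> 4 * pi\<^sup>2 * (4 * (a powr (- (1/2)) * M k))"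
      by (simp add: abs_mult mult_ac)
  qed
  then have "(h \<longlongrightarrow> h t) (at t within {a..})"
    using t by (auto simp: continuous_on_def)
  moreover have "h t = 0" by (simp add: h_def)
  ultimately have lim: "((\<lambda>s. sqrt (h s)) \<longlongrightarrow> 0) (at t within {a..})"
    using tendsto_real_sqrt[of h 0] by simp
  have "\<forall>\<^sub>F s in at t within {a..}. norm (L2normv (\<lambda>x. grad_of E s x - grad_of E t x)) \<le> sqrt (h s)"
    unfolding eventually_at_filter
  proof (intro always_eventually allI impI)
    fix s assume "s \<in> {a..}"
    then show "norm (L2normv (\<lambda>x. grad_of E s x - grad_of E t x)) \<le> sqrt (h s)"
      unfolding h_def real_norm_def abs_of_nonneg[OF L2normv_nonneg] using a t by (intro real_le_rsqrt grad_of_diff_square_le) auto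
  qed
  then show ?thesis
    using lim by (rule Lim_null_comparison)
qed

lemma continuous_on_divcoef_grad_of:
  assumes E: "norm E \<le> 1"
  shows "continuous_on {0<..T} (\<lambda>s. divcoef p (grad_of E s) k)"
proof (rule continuous_on_greaterThanAtMostI)
  fix a :: real assume a: "a > 0"
  define \<Lambda>' where "\<Lambda>' = \<Lambda> * a powr (- (1/4))"
  \<comment> \<open>The free parameter \<open>s\<close> of \<open>norm_divcoef_diff_le\<close> is
    set to 1: two different times are compared, and a common bound for the gradients on
    \<open>{a..}\<close> is all that is needed.\<close>
  have bound: "1 powr (1/4) * L2normv (grad_of E r) \<le> \<Lambda>'" if "r \<ge> a" for r
  proof -
    have r: "r > 0" using a that by simp
    have "L2normv (grad_of E r) \<le> \<Lambda> * r powr (- (1/4))"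
      using grad_of_bound[OF r E] r by (simp add: powr_minus field_simps)
    also have "\<dots> \<le> \<Lambda>'"
      unfolding \<Lambda>'_def using a that by (intro mult_left_mono powr_mono2') auto
    finally show ?thesis by simp
  qed
  have "continuous_on {a..} (\<lambda>s. divcoef p (grad_of E s) k)"
    unfolding continuous_on_def
  proof
    fix t assume t: "t \<in> {a..}"
    have "((\<lambda>s. 4 * pi * sqrt (ksq k) * (1 powr (- (p - 2) / 4) * (2 + 2 * \<Lambda>') * L2normv (\<lambda>x. grad_of E s x - grad_of E t x))) \<longlongrightarrow> 0) (at t within {a..})"
      using grad_of_continuous[OF a, of t E] t by (intro tendsto_mult_right_zero) auto
    moreover have "\<forall>\<^sub>F s in at t within {a..}. norm (divcoef p (grad_of E s) k - divcoef p (grad_of E t) k) \<le> 4 * pi * sqrt (ksq k) * (1 powr (- (p - 2) / 4) * (2 + 2 * \<Lambda>') * L2normv (\<lambda>x. grad_of E s x - grad_of E t x))"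
      unfolding eventually_at_filter
    proof (intro always_eventually allI impI)
      fix s assume "s \<in> {a..}"
      then show "norm (divcoef p (grad_of E s) k - divcoef p (grad_of E t) k) \<le> 4 * pi * sqrt (ksq k) * (1 powr (- (p - 2) / 4) * (2 + 2 * \<Lambda>') * L2normv (\<lambda>x. grad_of E s x - grad_of E t x))"
        using a t by (intro norm_divcoef_diff_le p L2vec_grad_of bound) auto
    qed
    ultimately have "((\<lambda>s. divcoef p (grad_of E s) k - divcoef p (grad_of E t) k) \<longlongrightarrow> 0) (at t within {a..})"
      by (rule Lim_null_comparison[rotated])
    then show "((\<lambda>s. divcoef p (grad_of E s) k) \<longlongrightarrow> divcoef p (grad_of E t) k) (at t within {a..})"
      by (rule LIM_zero_cancel)
  qed
  then show "continuous_on {a..T} (\<lambda>s. divcoef p (grad_of E s) k)"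
    by (rule continuous_on_subset) auto
qed

end

text \<open>Enumerating the lattice turns the unordered sum into a measurable series; the endpoints,
  where summability is not assumed, are a finite change.\<close>

lemma borel_measurable_infsum_Icc:
  fixes f :: "int \<times> int \<Rightarrow> real \<Rightarrow> real"
  assumes t: "t > 0" and m: "\<And>k. f k \<in> borel_measurable (lebesgue_on {0..t})"
    and nn: "\<And>k s. f k s \<ge> 0" and s: "\<And>s. 0 < s \<Longrightarrow> s < t \<Longrightarrow> (\<lambda>k. f k s) summable_on UNIV"
  shows "(\<lambda>s. \<Sum>\<^sub>\<infinity>k. f k s) \<in> borel_measurable (lebesgue_on {0..t})"
proof -
  obtain e :: "nat \<Rightarrow> int \<times> int" where e: "bij e"
    using countableE_infinite[of "UNIV :: (int \<times> int) set"] bij_betw_inv by (metis countableI_type finite_prod infinite_UNIV_int UNIV_Times_UNIV finite_cartesian_productD1 UNIV_not_empty)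
  have "(\<lambda>s. \<Sum>n. f (e n) s) \<in> borel_measurable (lebesgue_on {0..t})"
    using m by measurable
  then show ?thesis
  proof (rule borel_measurable_lebesgue_on_finite_change[of _ _ _ "{0, t}"])
    fix r assume "r \<in> {0..t}" "r \<notin> {0, t}"
    then have "(\<lambda>k. f k r) summable_on UNIV" by (intro s) auto
    then have "(\<lambda>n. f (e n) r) summable_on UNIV"
      using summable_on_reindex_bij_betw[OF e, of "\<lambda>k. f k r"] by simp
    then have "(\<lambda>n. f (e n) r) sums (\<Sum>\<^sub>\<infinity>n. f (e n) r)"
      by (intro has_sum_imp_sums has_sum_infsum)
    then show "(\<Sum>\<^sub>\<infinity>k. f k r) = (\<Sum>n. f (e n) r)"
      using infsum_reindex_bij_betw[OF e, of "\<lambda>k. f k r"] by (simp add: sums_iff)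
  qed simp
qed

lemma complete_UNIV_bcontfun: "complete (UNIV :: ('a::topological_space, 'b::complete_space) bcontfun set)"
proof (rule completeI)
  fix f :: "nat \<Rightarrow> ('a, 'b) bcontfun"
  assume "Cauchy f"
  then have "uniformly_Cauchy_on UNIV f"
    unfolding Cauchy_def uniformly_Cauchy_on_def by (meson dist_bounded le_less_trans)
  then obtain g where "uniform_limit UNIV f g sequentially"
    using Cauchy_uniformly_convergent unfolding uniformly_convergent_on_def by blast
  from uniform_limit_bcontfunE[OF this sequentially_bot]
  show "\<exists>l\<in>UNIV. f \<longlonglongrightarrow> l" by (metis UNIV_I)
qed

section \<open>Duhamel estimates and the contraction\<close>

context mild_data
begin

definition duhamel_integrand :: "modes \<Rightarrow> real \<Rightarrow> int \<times> int \<Rightarrow> real \<Rightarrow> complex" where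
  "duhamel_integrand E t k s = complex_of_real (exp (- (t - s) * knorm4 k)) * divcoef p (grad_of E s) k"

lemma duhamel_mode_eq: "duhamel_mode E t k = (\<integral>s. duhamel_integrand E t k s \<partial>lebesgue_on {0..t})"
  by (simp add: duhamel_mode_def duhamel_integrand_def)

lemma continuous_on_duhamel_integrand: "norm E \<le> 1 \<Longrightarrow> continuous_on {0<..T} (duhamel_integrand E t k)"
  unfolding duhamel_integrand_def by (intro continuous_intros continuous_on_divcoef_grad_of)

lemma duhamel_integrand_measurable:
  "norm E \<le> 1 \<Longrightarrow> t \<le> T \<Longrightarrow> duhamel_integrand E t k \<in> borel_measurable (lebesgue_on {0..t})"
  by (rule continuous_on_Ioc_borel_measurable[OF continuous_on_duhamel_integrand])

lemma divcoef_grad_of_le: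
  assumes "norm E \<le> 1" "s > 0"
  shows "cmod (divcoef p (grad_of E s) k) \<le> 4 * pi * sqrt (ksq k) * ((2 + 2 * \<Lambda>) * \<Lambda> * s powr (- ((p - 1) / 4)))"
  using norm_divcoef_le[OF p L2vec_grad_of[OF assms(2)] assms(2) grad_of_bound[OF assms(2,1)]]
  by (simp add: minus_divide_left)

lemma divcoef_grad_of_diff_le:
  assumes E: "norm E \<le> 1" "norm E' \<le> 1" and s: "s > 0"
  shows "cmod (divcoef p (grad_of E s) k - divcoef p (grad_of E' s) k) \<le>
    4 * pi * sqrt (ksq k) * ((2 + 2 * \<Lambda>) * (2 * pi * qnorm p * dist E E') * s powr (- ((p - 1) / 4)))"
proof -
  have "cmod (divcoef p (grad_of E s) k - divcoef p (grad_of E' s) k) \<le>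
    4 * pi * sqrt (ksq k) * (s powr (- (p - 2) / 4) * (2 + 2 * \<Lambda>) * L2normv (\<lambda>x. grad_of E s x - grad_of E' s x))"
    using s E by (intro norm_divcoef_diff_le p L2vec_grad_of grad_of_bound)
  also have "\<dots> \<le> 4 * pi * sqrt (ksq k) * (s powr (- (p - 2) / 4) * (2 + 2 * \<Lambda>) * (2 * pi * qnorm p * dist E E' * s powr (- (1/4))))"
    using s by (intro mult_left_mono grad_of_diff_le) auto
  also have "\<dots> = 4 * pi * sqrt (ksq k) * ((2 + 2 * \<Lambda>) * (2 * pi * qnorm p * dist E E') * (s powr (- (p - 2) / 4) * s powr (- (1/4))))"
    by (simp only: mult_ac)
  also have "s powr (- (p - 2) / 4) * s powr (- (1/4)) = s powr (- ((p - 1) / 4))"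
    unfolding powr_add[symmetric] by (rule arg_cong[where f = "(powr) s"]) (simp add: field_simps)
  finally show ?thesis .
qed

text \<open>The factor \<open>sqrt (ksq k)\<close> of the gradient and the one in the bound for
  \<open>z\<close>, which stems from the divergence, combine to \<open>ksq k\<close>, and the kernel
  turns this into the mode weight.\<close>

lemma grad_kernel_le:
  assumes "0 < s" "s < t" "A \<ge> 0" "cmod z \<le> 4 * pi * sqrt (ksq k) * (A * s powr (- ((p - 1) / 4)))"
  shows "cmod (complex_of_real (sqrt (ksq k)) * (complex_of_real (exp (- (t - s) * knorm4 k)) * z)) \<le>
    q k * (4 * pi * A) * ((t - s) powr (- (3/4 + \<delta>/2)) * s powr (- ((p - 1) / 4)))"
proof -
  have "cmod (complex_of_real (sqrt (ksq k)) * (complex_of_real (exp (- (t - s) * knorm4 k)) * z)) = (sqrt (ksq k) * exp (- (t - s) * knorm4 k)) * cmod z"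
    by (simp add: norm_mult)
  also have "\<dots> \<le> (sqrt (ksq k) * exp (- (t - s) * knorm4 k)) * (4 * pi * sqrt (ksq k) * (A * s powr (- ((p - 1) / 4))))"
    by (intro mult_left_mono assms) auto
  also have "\<dots> = (ksq k * exp (- (t - s) * knorm4 k)) * (4 * pi * A * s powr (- ((p - 1) / 4)))"
    using real_sqrt_mult_self[of "ksq k"] by (simp add: mult_ac)
  also have "\<dots> \<le> (q k * (t - s) powr (- (3/4 + \<delta>/2))) * (4 * pi * A * s powr (- ((p - 1) / 4)))"
    using assms delta by (intro mult_right_mono heat_kernel_grad) auto
  finally show ?thesis by (simp only: mult_ac)
qed

text \<open>Without the gradient only one factor \<open>sqrt (ksq k)\<close> has to be absorbed, so
  the singularity at \<open>s = t\<close> is milder. This serves the L^2 bound of the solution and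
  the Bochner condition.\<close>

lemma duhamel_integrand_le:
  assumes E: "norm E \<le> 1" and s: "0 < s" "s < t"
  shows "cmod (duhamel_integrand E t k s) \<le> q k * (4 * pi * ((2 + 2 * \<Lambda>) * \<Lambda>)) * ((t - s) powr (- (1/2 + \<delta>/2)) * s powr (- ((p - 1) / 4)))"
proof -
  have "cmod (duhamel_integrand E t k s) = exp (- (t - s) * knorm4 k) * cmod (divcoef p (grad_of E s) k)"
    by (simp add: duhamel_integrand_def norm_mult)
  also have "\<dots> \<le> exp (- (t - s) * knorm4 k) * (4 * pi * sqrt (ksq k) * ((2 + 2 * \<Lambda>) * \<Lambda> * s powr (- ((p - 1) / 4))))"
    by (intro mult_left_mono divcoef_grad_of_le E s) auto
  also have "\<dots> = (sqrt (ksq k) * exp (- (t - s) * knorm4 k)) * (4 * pi * ((2 + 2 * \<Lambda>) * \<Lambda>) * s powr (- ((p - 1) / 4)))"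
    by (simp only: mult_ac)
  also have "\<dots> \<le> (q k * (t - s) powr (- (1/2 + \<delta>/2))) * (4 * pi * ((2 + 2 * \<Lambda>) * \<Lambda>) * s powr (- ((p - 1) / 4)))"
    using s delta by (intro mult_right_mono heat_kernel_div mult_nonneg_nonneg) auto
  finally show ?thesis by (simp only: mult_ac)
qed

definition beta_L2 :: real where
  "beta_L2 = Beta (1 - (p - 1) / 4) (1 - (1/2 + \<delta> / 2))"

lemma duhamel_integrand_integrable:
  assumes "norm E \<le> 1" "t \<in> {0<..T}"
  shows "integrable (lebesgue_on {0..t}) (duhamel_integrand E t k)"
  by (rule beta_kernel_dominated(1)[OF _ _ _ duhamel_integrand_measurable duhamel_integrand_le]) (use assms p delta in auto)

lemma duhamel_mode_le:
  assumes E: "norm E \<le> 1" and t: "t \<in> {0<..T}"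
  shows "cmod (duhamel_mode E t k) \<le> q k * (4 * pi * ((2 + 2 * \<Lambda>) * \<Lambda>)) * (beta_L2 * t powr (\<delta> / 2))"
proof -
  have "cmod (duhamel_mode E t k) \<le> q k * (4 * pi * ((2 + 2 * \<Lambda>) * \<Lambda>)) * (beta_L2 * t powr (1 - (1/2 + \<delta>/2) - (p - 1) / 4))"
    unfolding duhamel_mode_eq beta_L2_def
    by (rule beta_kernel_dominated(2)[OF _ _ _ duhamel_integrand_measurable duhamel_integrand_le]) (use assms p delta in auto)
  also have "1 - (1/2 + \<delta>/2) - (p - 1) / 4 = \<delta> / 2"
    by (simp add: smoothing_exp_def field_simps)
  finally show ?thesis .
qed

text \<open>The excess over -1/4 is what is left of \<open>\<delta>\<close> after the mode weight
  has taken its half; it becomes the small factor \<open>T powr (\<delta> / 2)\<close>.\<close>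

lemma powr_exponent: "1 - (3/4 + \<delta>/2) - (p - 1) / 4 = \<delta> / 2 - 1/4"
  by (simp add: smoothing_exp_def field_simps)

lemma grad_duhamel_mode_le:
  assumes E: "norm E \<le> 1" and t: "t \<in> {0<..T}"
  shows "sqrt (ksq k) * cmod (duhamel_mode E t k) \<le> q k * (4 * pi * ((2 + 2 * \<Lambda>) * \<Lambda>)) * (beta_grad p * t powr (\<delta> / 2 - 1/4))"
proof -
  have "cmod (\<integral>s. complex_of_real (sqrt (ksq k)) * duhamel_integrand E t k s \<partial>lebesgue_on {0..t}) \<le> q k * (4 * pi * ((2 + 2 * \<Lambda>) * \<Lambda>)) * (beta_grad p * t powr (1 - (3/4 + \<delta>/2) - (p - 1) / 4))"
    unfolding beta_grad_def
  proof (rule beta_kernel_dominated(2))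
    show "(\<lambda>s. complex_of_real (sqrt (ksq k)) * duhamel_integrand E t k s) \<in> borel_measurable (lebesgue_on {0..t})"
      using duhamel_integrand_measurable[OF E, of t k] t by (intro borel_measurable_times) auto
    show "cmod (complex_of_real (sqrt (ksq k)) * duhamel_integrand E t k s) \<le> q k * (4 * pi * ((2 + 2 * \<Lambda>) * \<Lambda>)) * ((t - s) powr (- (3/4 + \<delta>/2)) * s powr (- ((p - 1) / 4)))"
      if "0 < s" "s < t" for s
      unfolding duhamel_integrand_def using that E by (intro grad_kernel_le divcoef_grad_of_le) auto
  qed (use p delta t in auto)
  also have "(\<integral>s. complex_of_real (sqrt (ksq k)) * duhamel_integrand E t k s \<partial>lebesgue_on {0..t}) = complex_of_real (sqrt (ksq k)) * duhamel_mode E t k"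
    by (simp only: duhamel_mode_eq integral_mult_right_zero)
  finally show ?thesis unfolding powr_exponent by (simp add: norm_mult)
qed

lemma grad_duhamel_mode_diff_le:
  assumes E: "norm E \<le> 1" "norm E' \<le> 1" and t: "t \<in> {0<..T}"
  shows "sqrt (ksq k) * cmod (duhamel_mode E t k - duhamel_mode E' t k) \<le>
    q k * (4 * pi * ((2 + 2 * \<Lambda>) * (2 * pi * qnorm p * dist E E'))) * (beta_grad p * t powr (\<delta> / 2 - 1/4))"
proof -
  have "cmod (\<integral>s. complex_of_real (sqrt (ksq k)) * (duhamel_integrand E t k s - duhamel_integrand E' t k s) \<partial>lebesgue_on {0..t})
     \<le> q k * (4 * pi * ((2 + 2 * \<Lambda>) * (2 * pi * qnorm p * dist E E'))) * (beta_grad p * t powr (1 - (3/4 + \<delta>/2) - (p - 1) / 4))"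
    unfolding beta_grad_def
  proof (rule beta_kernel_dominated(2))
    show "(\<lambda>s. complex_of_real (sqrt (ksq k)) * (duhamel_integrand E t k s - duhamel_integrand E' t k s)) \<in> borel_measurable (lebesgue_on {0..t})"
      using duhamel_integrand_measurable[OF E(1), of t k] duhamel_integrand_measurable[OF E(2), of t k] t
      by (intro borel_measurable_times borel_measurable_diff) auto
    show "cmod (complex_of_real (sqrt (ksq k)) * (duhamel_integrand E t k s - duhamel_integrand E' t k s)) \<le>
      q k * (4 * pi * ((2 + 2 * \<Lambda>) * (2 * pi * qnorm p * dist E E'))) * ((t - s) powr (- (3/4 + \<delta>/2)) * s powr (- ((p - 1) / 4)))"
      if "0 < s" "s < t" for s
      unfolding duhamel_integrand_def right_diff_distrib[symmetric] using that E by (intro grad_kernel_le divcoef_grad_of_diff_le) auto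
  qed (use p delta t in auto)
  also have "(\<integral>s. complex_of_real (sqrt (ksq k)) * (duhamel_integrand E t k s - duhamel_integrand E' t k s) \<partial>lebesgue_on {0..t}) = complex_of_real (sqrt (ksq k)) * (duhamel_mode E t k - duhamel_mode E' t k)"
    using duhamel_integrand_integrable[OF E(1) t, of k] duhamel_integrand_integrable[OF E(2) t, of k] by (simp add: duhamel_mode_eq)
  finally show ?thesis unfolding powr_exponent by (simp add: norm_mult)
qed

lemma duhamel_mode_at_0: "duhamel_mode E 0 k = 0"
  unfolding duhamel_mode_def by (rule integral_eq_zero_AE) (rule AE_lebesgue_on_singleton)

text \<open>The semigroup factor splits, so the mode is \<open>exp (- t * knorm4 k)\<close> times
  the indefinite integral of a function \<open>g\<close> that does not involve \<open>t\<close>. The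
  growing exponential in \<open>g\<close> is harmless because \<open>k\<close> is fixed.\<close>

lemma continuous_on_duhamel_mode:
  assumes E: "norm E \<le> 1"
  shows "continuous_on {0..T} (\<lambda>t. duhamel_mode E t k)"
proof -
  define g where "g s = complex_of_real (exp (s * knorm4 k)) * divcoef p (grad_of E s) k" for s
  have fac: "g s = complex_of_real (exp (t * knorm4 k)) * duhamel_integrand E t k s" for s t
    by (simp add: g_def duhamel_integrand_def mult.assoc[symmetric] algebra_simps flip: of_real_mult exp_add)
  have g_int: "integrable (lebesgue_on {0..t}) g" if "t \<in> {0<..T}" for t
    unfolding fac[of _ t] by (intro integrable_mult_right impI duhamel_integrand_integrable E that)
  have "g integrable_on {0..T}"
    using g_int[of T] T by (intro integrable_on_lebesgue_on) auto
  then have cont: "continuous_on {0..T} (\<lambda>t. complex_of_real (exp (- t * knorm4 k)) * integral {0..t} g)"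
    by (intro continuous_intros indefinite_integral_continuous_1)
  have eq: "duhamel_mode E t k = complex_of_real (exp (- t * knorm4 k)) * integral {0..t} g" if t: "t \<in> {0..T}" for t
  proof (cases "t = 0")
    case False
    then have t': "t \<in> {0<..T}" using t by auto
    have "integral {0..t} g = (\<integral>s. g s \<partial>lebesgue_on {0..t})"
      by (rule lebesgue_integral_eq_integral[symmetric, OF g_int[OF t']]) auto
    also have "\<dots> = complex_of_real (exp (t * knorm4 k)) * duhamel_mode E t k"
      unfolding fac[of _ t] duhamel_mode_eq by simp
    finally show ?thesis
      by (simp add: mult.assoc[symmetric] flip: of_real_mult exp_add)
  qed (simp add: duhamel_mode_at_0)
  show ?thesis by (rule continuous_on_eq[OF cont eq[symmetric]])
qed

lemma PhiF_le:
  assumes E: "norm E \<le> 1"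
  shows "norm (PhiF E z) \<le> 4 * pi * ((2 + 2 * \<Lambda>) * \<Lambda>) * beta_grad p * T powr (\<delta> / 2)"
proof (cases "fst z = 0")
  case True
  then show ?thesis by (simp add: PhiF_def)
next
  case False
  define t where "t = min (exp (snd z)) T"
  have t: "t \<in> {0<..T}" using T by (auto simp: t_def)
  have qpos: "q (fst z) > 0" by (rule mode_weight_pos[OF False])
  have "norm (PhiF E z) = t powr (1/4) / q (fst z) * (sqrt (ksq (fst z)) * cmod (duhamel_mode E t (fst z)))"
    using qpos by (simp add: PhiF_def t_def norm_mult norm_divide)
  also have "\<dots> \<le> t powr (1/4) / q (fst z) * (q (fst z) * (4 * pi * ((2 + 2 * \<Lambda>) * \<Lambda>)) * (beta_grad p * t powr (\<delta> / 2 - 1/4)))"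
    using qpos by (intro mult_left_mono grad_duhamel_mode_le E t) auto
  also have "\<dots> = 4 * pi * ((2 + 2 * \<Lambda>) * \<Lambda>) * beta_grad p * (t powr (1/4) * t powr (\<delta> / 2 - 1/4))"
    using qpos by simp
  also have "t powr (1/4) * t powr (\<delta> / 2 - 1/4) = t powr (\<delta> / 2)"
    by (simp flip: powr_add)
  also have "4 * pi * ((2 + 2 * \<Lambda>) * \<Lambda>) * beta_grad p * t powr (\<delta> / 2) \<le> 4 * pi * ((2 + 2 * \<Lambda>) * \<Lambda>) * beta_grad p * T powr (\<delta> / 2)"
    using t delta by (intro mult_left_mono powr_mono2 mult_nonneg_nonneg) auto
  finally show ?thesis .
qed

lemma PhiF_diff_le:
  assumes E: "norm E \<le> 1" "norm E' \<le> 1"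
  shows "norm (PhiF E z - PhiF E' z) \<le> 4 * pi * ((2 + 2 * \<Lambda>) * (2 * pi * qnorm p)) * beta_grad p * T powr (\<delta> / 2) * dist E E'"
proof (cases "fst z = 0")
  case True
  then show ?thesis by (simp add: PhiF_def)
next
  case False
  define t where "t = min (exp (snd z)) T"
  have t: "t \<in> {0<..T}" using T by (auto simp: t_def)
  have qpos: "q (fst z) > 0" by (rule mode_weight_pos[OF False])
  have "norm (PhiF E z - PhiF E' z) = t powr (1/4) / q (fst z) * (sqrt (ksq (fst z)) * cmod (duhamel_mode E t (fst z) - duhamel_mode E' t (fst z)))"
    using qpos unfolding PhiF_def t_def[symmetric] right_diff_distrib[symmetric] norm_mult by (simp add: norm_mult norm_divide)
  also have "\<dots> \<le> t powr (1/4) / q (fst z) * (q (fst z) * (4 * pi * ((2 + 2 * \<Lambda>) * (2 * pi * qnorm p * dist E E'))) * (beta_grad p * t powr (\<delta> / 2 - 1/4)))"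
    using qpos by (intro mult_left_mono grad_duhamel_mode_diff_le E t) auto
  also have "\<dots> = 4 * pi * ((2 + 2 * \<Lambda>) * (2 * pi * qnorm p)) * beta_grad p * (t powr (1/4) * t powr (\<delta> / 2 - 1/4)) * dist E E'"
    using qpos by simp
  also have "t powr (1/4) * t powr (\<delta> / 2 - 1/4) = t powr (\<delta> / 2)"
    by (simp flip: powr_add)
  also have "4 * pi * ((2 + 2 * \<Lambda>) * (2 * pi * qnorm p)) * beta_grad p * t powr (\<delta> / 2) * dist E E'
      \<le> 4 * pi * ((2 + 2 * \<Lambda>) * (2 * pi * qnorm p)) * beta_grad p * T powr (\<delta> / 2) * dist E E'"
    using t delta by (intro mult_right_mono mult_left_mono powr_mono2 mult_nonneg_nonneg) auto
  finally show ?thesis .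
qed

lemma PhiF_bcontfun:
  assumes E: "norm E \<le> 1"
  shows "PhiF E \<in> bcontfun"
proof (rule bcontfun_normI[OF continuous_on_discrete_fst PhiF_le[OF E]])
  fix k
  have "continuous_on UNIV (\<lambda>x. duhamel_mode E (min (exp x) T) k)"
    by (rule continuous_on_compose2[OF continuous_on_duhamel_mode[OF E, of k]])
       (use T in \<open>auto intro!: continuous_intros\<close>)
  moreover have "continuous_on UNIV (\<lambda>x. complex_of_real (min (exp x) T powr (1/4) * r))" for r
    using T by (intro continuous_intros) (auto simp: min_def)
  ultimately show "continuous_on UNIV (\<lambda>x. PhiF E (k, x))"
    unfolding PhiF_def fst_conv snd_conv times_divide_eq_right[symmetric] by (intro continuous_on_mult)
qed


text \<open>Banach's theorem on the closed unit ball of \<open>modes\<close>. \<open>PhiF E\<close>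
  is known to be bounded and continuous only for \<open>norm E \<le> 1\<close>, so
  \<open>\<Phi>\<close> is evaluated only there.\<close>

lemma fixed_point:
  assumes small1: "4 * pi * ((2 + 2 * \<Lambda>) * \<Lambda>) * beta_grad p * T powr (\<delta> / 2) \<le> 1"
    and small2: "4 * pi * ((2 + 2 * \<Lambda>) * (2 * pi * qnorm p)) * beta_grad p * T powr (\<delta> / 2) \<le> 1 / 2"
  obtains E where "norm E \<le> 1" "\<And>t k. t \<in> {0<..T} \<Longrightarrow> duhamel_of E t k = duhamel_mode E t k"
proof -
  define \<Phi> where "\<Phi> E = Bcontfun (PhiF E)" for E
  have app: "apply_bcontfun (\<Phi> E) = PhiF E" if "norm E \<le> 1" for E
    unfolding \<Phi>_def by (rule Bcontfun_inverse[OF PhiF_bcontfun[OF that]])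
  have "\<exists>!E\<in>cball 0 1. \<Phi> E = E"
  proof (rule Banach_fix)
    show "complete (cball (0::modes) 1)"
      by (rule complete_closed_subset[OF closed_cball subset_UNIV complete_UNIV_bcontfun])
    show "\<Phi> ` cball 0 1 \<subseteq> cball 0 1"
    proof clarsimp
      fix E :: modes assume E: "norm E \<le> 1"
      show "norm (\<Phi> E) \<le> 1"
        by (rule norm_bound) (use PhiF_le[OF E] small1 in \<open>auto simp: app[OF E] intro: order_trans\<close>)
    qed
    fix E E' :: modes assume "E \<in> cball 0 1" "E' \<in> cball 0 1"
    then have E: "norm E \<le> 1" "norm E' \<le> 1" by auto
    show "dist (\<Phi> E) (\<Phi> E') \<le> 1 / 2 * dist E E'"
    proof (rule dist_bound)
      fix z
      have "dist (\<Phi> E z) (\<Phi> E' z) = norm (PhiF E z - PhiF E' z)"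
        using E by (simp add: app dist_norm)
      also have "\<dots> \<le> 1 / 2 * dist E E'"
        by (rule order_trans[OF PhiF_diff_le[OF E] mult_right_mono[OF small2]]) simp
      finally show "dist (\<Phi> E z) (\<Phi> E' z) \<le> 1 / 2 * dist E E'" .
    qed
  qed auto
  then obtain E where E: "norm E \<le> 1" "\<Phi> E = E" by auto
  have "duhamel_of E t k = duhamel_mode E t k" if t: "t \<in> {0<..T}" for t k
  \<comment> \<open>Separated because \<open>q 0 = 0\<close> makes the rescaling non-invertible
    there; both sides vanish.\<close>
  proof (cases "k = 0")
    case True
    then show ?thesis by (simp add: duhamel_of_def duhamel_mode_def)
  next
    case False
    have "E (k, ln t) = PhiF E (k, ln t)" using app[OF E(1)] E(2) by simp
    also have "\<dots> = complex_of_real (t powr (1/4) * sqrt (ksq k) / q k) * duhamel_mode E t k"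
      using t by (simp add: PhiF_def min_absorb1)
    finally have "duhamel_of E t k = duhamel_mode E t k * complex_of_real ((t powr (1/4) * sqrt (ksq k) / q k) * (q k * t powr (- (1/4)) / sqrt (ksq k)))"
      by (simp add: duhamel_of_def)
    also have "(t powr (1/4) * sqrt (ksq k) / q k) * (q k * t powr (- (1/4)) / sqrt (ksq k)) = 1"
      using t False ksq_pos[OF False] mode_weight_pos[OF False, of \<delta>] by (simp add: powr_minus)
    finally show ?thesis by simp
  qed
  with E(1) show thesis by (rule that)
qed

section \<open>The solution obtained from a fixed point\<close>

context
  fixes E :: modes
  assumes E: "norm E \<le> 1" and fp: "\<And>t k. t \<in> {0<..T} \<Longrightarrow> duhamel_of E t k = duhamel_mode E t k"
begin

text \<open>Logarithmic time never reaches \<open>t = 0\<close>, so the initial datum is inserted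
  there by hand.\<close>

definition sol :: "real \<Rightarrow> real \<times> real \<Rightarrow> real" where
  "sol t = (if t = 0 then u0 else l2_synth (coef_of E t))"

text \<open>Agrees with \<open>coef_of\<close> on (0,T], but is written with
  \<open>duhamel_mode\<close>, which is continuous up to \<open>t = 0\<close>.\<close>

definition solc :: "real \<Rightarrow> int \<times> int \<Rightarrow> complex" where
  "solc t k = complex_of_real (exp (- t * knorm4 k)) * fcoef u0 k - duhamel_mode E t k"

lemma coef_of_solc: "t \<in> {0<..T} \<Longrightarrow> coef_of E t k = solc t k"
  by (simp add: coef_of_def solc_def fp)

text \<open>\<open>grad_of E s\<close> is a real field, so its divergence coefficients are conjugate
  symmetric. At a fixed point the coefficients of the solution inherit this, and the symmetrisation
  in \<open>l2_synth\<close> leaves them unchanged.\<close>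

lemma duhamel_mode_minus: "duhamel_mode E t (- k) = cnj (duhamel_mode E t k)"
proof -
  have "knorm4 (- k) = knorm4 k" by (simp add: knorm4_def)
  then show ?thesis
    unfolding duhamel_mode_def Bochner_Integration.integral_cnj[symmetric] by (simp add: divcoef_minus)
qed

lemma solc_minus: "solc t (- k) = cnj (solc t k)"
proof -
  have "knorm4 (- k) = knorm4 k" by (simp add: knorm4_def)
  then show ?thesis by (simp add: solc_def duhamel_mode_minus fcoef_minus)
qed

text \<open>A majorant for all times in [0,T] at once, obtained from
  \<open>t powr (\<delta> / 2) \<le> 1\<close>, which uses \<open>T \<le> 1\<close>.\<close>

definition solM :: "int \<times> int \<Rightarrow> real" where
  "solM k = 2 * (cmod (fcoef u0 k))\<^sup>2 + 2 * ((4 * pi * ((2 + 2 * \<Lambda>) * \<Lambda>) * beta_L2)\<^sup>2 * (q k)\<^sup>2)"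

lemma beta_L2_nonneg [simp]: "beta_L2 \<ge> 0"
  unfolding beta_L2_def using p delta by (intro Beta_real_nonneg) auto

lemma solM_summable: "solM summable_on UNIV"
  unfolding solM_def[abs_def] by (rule coef_majorant_summable)

lemma solc_le:
  assumes t: "t \<in> {0..T}"
  shows "(cmod (solc t k))\<^sup>2 \<le> solM k"
proof -
  have "cmod (duhamel_mode E t k) \<le> 4 * pi * ((2 + 2 * \<Lambda>) * \<Lambda>) * beta_L2 * q k"
  proof (cases "t = 0")
    case False
    then have t': "t \<in> {0<..T}" using t by auto
    have "cmod (duhamel_mode E t k) \<le> q k * (4 * pi * ((2 + 2 * \<Lambda>) * \<Lambda>)) * (beta_L2 * t powr (\<delta> / 2))"
      by (rule duhamel_mode_le[OF E t'])
    also have "\<dots> \<le> q k * (4 * pi * ((2 + 2 * \<Lambda>) * \<Lambda>)) * (beta_L2 * 1)"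
      using t' T delta by (intro mult_left_mono mult_nonneg_nonneg powr_le1) auto
    finally show ?thesis by (simp add: mult_ac)
  qed (simp add: duhamel_mode_at_0)
  then have "(cmod (duhamel_mode E t k))\<^sup>2 \<le> (4 * pi * ((2 + 2 * \<Lambda>) * \<Lambda>) * beta_L2 * q k)\<^sup>2"
    by (intro power_mono) auto
  moreover have "(cmod (complex_of_real (exp (- t * knorm4 k)) * fcoef u0 k))\<^sup>2 \<le> (cmod (fcoef u0 k))\<^sup>2"
    using t by (intro power_mono) (auto simp: norm_mult mult_left_le_one_le)
  moreover have "(cmod (solc t k))\<^sup>2 \<le> 2 * (cmod (complex_of_real (exp (- t * knorm4 k)) * fcoef u0 k))\<^sup>2 + 2 * (cmod (duhamel_mode E t k))\<^sup>2"
    using norm_add_square_le[of "complex_of_real (exp (- t * knorm4 k)) * fcoef u0 k" "- duhamel_mode E t k"]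
    by (simp add: solc_def)
  ultimately show ?thesis
    unfolding solM_def power_mult_distrib[of _ "q k", symmetric] by linarith
qed

lemma ell2_coef_of: "t \<in> {0<..T} \<Longrightarrow> ell2 (coef_of E t)"
  unfolding ell2_def by (rule summable_on_comparison_test[OF solM_summable]) (auto simp: coef_of_solc solc_le)

lemma L2fun_sol: "t \<in> {0..T} \<Longrightarrow> L2fun (sol t)"
  by (auto simp: sol_def u0 intro!: L2fun_l2_synth ell2_coef_of)

lemma fcoef_sol:
  assumes "t \<in> {0..T}"
  shows "fcoef (sol t) k = solc t k"
proof (cases "t = 0")
  case True
  then show ?thesis by (simp add: sol_def solc_def duhamel_mode_at_0)
next
  case False
  then have t: "t \<in> {0<..T}" using assms by auto
  then show ?thesis using False by (simp add: sol_def fcoef_l2_synth[OF ell2_coef_of] coef_of_solc solc_minus)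
qed

lemma wgrad_grad_of:
  assumes t: "t \<in> {0<..T}"
  shows "is_wgrad (sol t) (grad_of E t)"
proof -
  have t0: "t > 0" "t \<in> {0..T}" using t by auto
  have "grad_coef1 E t (- k) = cnj (grad_coef1 E t k)" "grad_coef2 E t (- k) = cnj (grad_coef2 E t k)" for k
    using t by (simp_all add: grad_coef1_def grad_coef2_def coef_of_solc solc_minus)
  then have "fcoef (l2_synth (grad_coef1 E t)) k = grad_coef1 E t k" "fcoef (l2_synth (grad_coef2 E t)) k = grad_coef2 E t k" for k
    by (simp_all add: fcoef_l2_synth ell2_grad_coef t0)
  then show ?thesis
    using L2vec_integrable[OF L2vec_grad_of[OF t0(1), of E]]
    by (simp add: is_wgrad_def fcoef_sol[OF t0(2)] grad_of_def[abs_def] grad_coef1_def grad_coef2_def coef_of_solc[OF t])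
qed

lemma has_wgrad_sol: "t \<in> {0<..T} \<Longrightarrow> has_wgrad (sol t)"
  using wgrad_grad_of has_wgrad_def by blast

lemma wgrad_sol_AE: "t \<in> {0<..T} \<Longrightarrow> AE x in TM. wgrad (sol t) x = grad_of E t x"
  by (rule wgrad_AE_eq[OF is_wgrad_wgrad[OF has_wgrad_sol] wgrad_grad_of])

lemma wgrad_sol_measurable: "t \<in> {0<..T} \<Longrightarrow> wgrad (sol t) \<in> borel_measurable TM"
  using is_wgrad_wgrad[OF has_wgrad_sol, of t] unfolding is_wgrad_def by (blast intro: borel_measurable_integrable)

lemma grad_of_measurable: "t > 0 \<Longrightarrow> grad_of E t \<in> borel_measurable TM"
  using L2vec_grad_of by (auto simp: L2vec_def)

text \<open>The definitions speak of the chosen representative \<open>wgrad (sol t)\<close>, the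
  estimates of \<open>grad_of E t\<close>. They agree almost everywhere, and all four notions ignore
  null sets.\<close>

lemma
  assumes t: "t \<in> {0<..T}"
  shows L2vec_wgrad_sol: "L2vec (wgrad (sol t))"
    and L2normv_wgrad_sol: "L2normv (wgrad (sol t)) = L2normv (grad_of E t)"
    and L1normv_wgrad_sol: "L1normv (wgrad (sol t)) = L1normv (grad_of E t)"
    and divcoef_wgrad_sol: "divcoef p (wgrad (sol t)) k = divcoef p (grad_of E t) k"
proof -
  have t0: "t > 0" using t by auto
  note m[measurable] = wgrad_sol_measurable[OF t] grad_of_measurable[OF t0]
  have AE: "AE x in TM. (norm (wgrad (sol t) x))\<^sup>2 = (norm (grad_of E t x))\<^sup>2" "AE x in TM. norm (wgrad (sol t) x) = norm (grad_of E t x)"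
    using wgrad_sol_AE[OF t] by (auto elim!: eventually_mono)
  have "integrable TM (\<lambda>x. (norm (wgrad (sol t) x))\<^sup>2) \<longleftrightarrow> integrable TM (\<lambda>x. (norm (grad_of E t x))\<^sup>2)"
    by (rule integrable_cong_AE[OF _ _ AE(1)]) measurable
  then show "L2vec (wgrad (sol t))"
    using L2vec_grad_of[OF t0, of E] m by (simp add: L2vec_def)
  have "(\<integral>x. (norm (wgrad (sol t) x))\<^sup>2 \<partial>TM) = (\<integral>x. (norm (grad_of E t x))\<^sup>2 \<partial>TM)"
    by (rule integral_cong_AE[OF _ _ AE(1)]) measurable
  then show "L2normv (wgrad (sol t)) = L2normv (grad_of E t)"
    by (simp add: L2normv_def)
  show "L1normv (wgrad (sol t)) = L1normv (grad_of E t)"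
    unfolding L1normv_def by (rule integral_cong_AE[OF _ _ AE(2)]) measurable
  show "divcoef p (wgrad (sol t)) k = divcoef p (grad_of E t) k"
    by (rule divcoef_cong_AE[OF m wgrad_sol_AE[OF t]])
qed

lemma duh_coef_sol: "s \<in> {0<..T} \<Longrightarrow> duh_coef p sol t s k = duhamel_integrand E t k s"
  by (simp add: duh_coef_eq duhamel_integrand_def divcoef_wgrad_sol)

text \<open>By Parseval the squared distance between two times is a series of continuous terms with
  the summable majorant \<open>4 * solM k\<close>, uniformly up to \<open>t = 0\<close>.\<close>

lemma C_L2_sol: "C_L2 T sol"
  unfolding C_L2_def
proof (intro conjI ballI allI impI)
  show "L2fun (sol t)" if "t \<in> {0..T}" for t using that by (rule L2fun_sol)
  fix t e :: real assume t: "t \<in> {0..T}" and e: "e > 0"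
  define h where "h s = (\<Sum>\<^sub>\<infinity>k. (cmod (solc s k - solc t k))\<^sup>2)" for s
  have "continuous_on {0..T} h"
    unfolding h_def
  proof (rule continuous_on_infsum_dominated)
    show "(\<lambda>k. 4 * solM k) summable_on UNIV" by (intro summable_on_cmult_right solM_summable)
    fix k
    show "continuous_on {0..T} (\<lambda>s. (cmod (solc s k - solc t k))\<^sup>2)"
      unfolding solc_def by (intro continuous_intros continuous_on_duhamel_mode E)
    show "\<bar>(cmod (solc s k - solc t k))\<^sup>2\<bar> \<le> 4 * solM k" if "s \<in> {0..T}" for s
      using norm_add_square_le[of "solc s k" "- solc t k"] solc_le[OF that, of k] solc_le[OF t, of k] by simp
  qed
  then obtain d where d: "d > 0" "\<And>s. s \<in> {0..T} \<Longrightarrow> dist s t < d \<Longrightarrow> dist (h s) (h t) < e\<^sup>2"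
    using t e unfolding continuous_on_iff by (metis zero_less_power)
  show "\<exists>d>0. \<forall>s\<in>{0..T}. \<bar>s - t\<bar> < d \<longrightarrow> L2norm (\<lambda>x. sol s x - sol t x) < e"
  proof (intro exI[of _ d] conjI ballI impI d(1))
    fix s assume s: "s \<in> {0..T}" "\<bar>s - t\<bar> < d"
    have "(L2norm (\<lambda>x. sol s x - sol t x))\<^sup>2 = h s"
      unfolding h_def Parseval[OF L2fun_diff[OF L2fun_sol[OF s(1)] L2fun_sol[OF t]]]
      using s t by (simp add: fcoef_diff L2fun_integrable L2fun_sol fcoef_sol)
    moreover have "h t = 0" by (simp add: h_def)
    ultimately have "(L2norm (\<lambda>x. sol s x - sol t x))\<^sup>2 < e\<^sup>2"
      using d(2)[OF s(1)] s(2) by (auto simp: dist_real_def)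
    then show "L2norm (\<lambda>x. sol s x - sol t x) < e"
      by (rule power2_less_imp_less) (use e in simp)
  qed
qed

text \<open>The reverse triangle inequality and the embedding of L^2 into L^1 make the L^1 norm a
  continuous function of the field, which varies continuously away from time 0.\<close>

lemma L1_sol_integrable:
  assumes "0 < a" "a \<le> b" "b \<le> T"
  shows "integrable (lebesgue_on {a..b}) (\<lambda>s. L1normv (wgrad (sol s)))"
proof (rule continuous_imp_integrable_real)
  have "continuous_on {a..} (\<lambda>s. L1normv (grad_of E s))"
    unfolding continuous_on_def
  proof
    fix t assume t: "t \<in> {a..}"
    have "\<forall>\<^sub>F s in at t within {a..}. norm (L1normv (grad_of E s) - L1normv (grad_of E t)) \<le> L2normv (\<lambda>x. grad_of E s x - grad_of E t x)"
      unfolding eventually_at_filter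
    proof (intro always_eventually allI impI)
      fix s assume s: "s \<in> {a..}"
      have G: "L2vec (grad_of E s)" "L2vec (grad_of E t)" using s t assms by (auto intro!: L2vec_grad_of)
      note int = L2vec_integrable[OF G(1)] L2vec_integrable[OF G(2)]
      have "norm (L1normv (grad_of E s) - L1normv (grad_of E t)) = norm (\<integral>x. norm (grad_of E s x) - norm (grad_of E t x) \<partial>TM)"
        using int by (simp add: L1normv_def)
      also have "\<dots> \<le> (\<integral>x. norm (grad_of E s x - grad_of E t x) \<partial>TM)"
        using int by (intro Bochner_Integration.integral_norm_bound_integral) (auto intro: norm_triangle_ineq3)
      also have "\<dots> \<le> L2normv (\<lambda>x. grad_of E s x - grad_of E t x)"
        using integral_abs_le_L2norm[OF L2vec_norm[OF L2vec_diff[OF G]]] by (simp add: L2normv_eq_L2norm)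
      finally show "norm (L1normv (grad_of E s) - L1normv (grad_of E t)) \<le> L2normv (\<lambda>x. grad_of E s x - grad_of E t x)" .
    qed
    from Lim_null_comparison[OF this grad_of_continuous[OF assms(1)]] t
    have "((\<lambda>s. L1normv (grad_of E s) - L1normv (grad_of E t)) \<longlongrightarrow> 0) (at t within {a..})" by simp
    then show "((\<lambda>s. L1normv (grad_of E s)) \<longlongrightarrow> L1normv (grad_of E t)) (at t within {a..})"
      by (rule LIM_zero_cancel)
  qed
  then have "continuous_on {a..b} (\<lambda>s. L1normv (grad_of E s))"
    by (rule continuous_on_subset) auto
  then show "continuous_on {a..b} (\<lambda>s. L1normv (wgrad (sol s)))"
    by (rule continuous_on_eq) (use assms in \<open>auto simp: L1normv_wgrad_sol\<close>)
qed

lemma duh_coef_sol_measurable: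
  assumes "t \<in> {0<..T}"
  shows "(\<lambda>s. duh_coef p sol t s k) \<in> borel_measurable (lebesgue_on {0..t})"
  by (rule borel_measurable_lebesgue_on_finite_change[OF duhamel_integrand_measurable[OF E], of t "{0}"])
     (use assms in \<open>auto simp: duh_coef_sol\<close>)

lemma integral_duh_coef_sol:
  assumes t: "t \<in> {0..T}"
  shows "(\<integral>s. duh_coef p sol t s k \<partial>lebesgue_on {0..t}) = duhamel_mode E t k"
proof (cases "t = 0")
  case True
  then show ?thesis
    by (simp only: duhamel_mode_at_0) (rule integral_eq_zero_AE, rule AE_lebesgue_on_singleton)
next
  case False
  then have t': "t \<in> {0<..T}" using t by auto
  show ?thesis
    unfolding duhamel_mode_eq
  proof (rule integral_cong_AE)
    show "(\<lambda>s. duh_coef p sol t s k) \<in> borel_measurable (lebesgue_on {0..t})"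
      by (rule duh_coef_sol_measurable[OF t'])
    show "duhamel_integrand E t k \<in> borel_measurable (lebesgue_on {0..t})"
      using duhamel_integrand_measurable[OF E] t by auto
    show "AE s in lebesgue_on {0..t}. duh_coef p sol t s k = duhamel_integrand E t k s"
      using AE_lebesgue_on_Icc_not_in[of "{0}" 0 t, simplified] AE_space[of "lebesgue_on {0..t}"]
      by eventually_elim (use t in \<open>auto simp: duh_coef_sol\<close>)
  qed
qed

lemma duhamel_bochner_sol:
  assumes t: "t \<in> {0..T}"
  shows "duhamel_bochner p sol t"
proof (cases "t = 0")
  case True
  \<comment> \<open>Over a single point every function is measurable and equals 0 almost
    everywhere.\<close>
  have meas: "f \<in> borel_measurable (lebesgue_on {0..0})" for f :: "real \<Rightarrow> 'a::real_normed_vector"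
    by (rule borel_measurable_lebesgue_on_finite_change[of "\<lambda>_. 0" _ _ "{0}"]) auto
  have "integrable (lebesgue_on {0..0}) f \<longleftrightarrow> integrable (lebesgue_on {0..0}) (\<lambda>_::real. 0::real)" for f :: "real \<Rightarrow> real"
    by (rule integrable_cong_AE[OF meas meas AE_lebesgue_on_singleton])
  then have int: "integrable (lebesgue_on {0..0}) f" for f :: "real \<Rightarrow> real"
    by simp
  show ?thesis
    unfolding duhamel_bochner_def True by (intro conjI allI AE_lebesgue_on_singleton meas int)
next
  case False
  then have t': "t \<in> {0<..T}" "t > 0" using t by auto
  \<comment> \<open>\<open>A s\<close> collects the part of the bound that does not depend on
    \<open>k\<close>, so summing squares over \<open>k\<close> only produces
    \<open>qnorm p\<close>.\<close>
  define A where "A s = 4 * pi * ((2 + 2 * \<Lambda>) * \<Lambda>) * ((t - s) powr (- (1/2 + \<delta>/2)) * s powr (- ((p - 1) / 4)))" for s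
  have A0: "A s \<ge> 0" for s by (auto simp: A_def)
  have le: "(cmod (duh_coef p sol t s k))\<^sup>2 \<le> (A s)\<^sup>2 * (q k)\<^sup>2" if "0 < s" "s < t" for s k
  proof -
    have "cmod (duh_coef p sol t s k) \<le> A s * q k"
      using duhamel_integrand_le[OF E that, of k] that t' by (simp add: duh_coef_sol A_def mult_ac)
    then have "(cmod (duh_coef p sol t s k))\<^sup>2 \<le> (A s * q k)\<^sup>2"
      by (rule power_mono) simp
    then show ?thesis by (simp add: power_mult_distrib)
  qed
  have summ: "(\<lambda>k. (cmod (duh_coef p sol t s k))\<^sup>2) summable_on UNIV" if "0 < s" "s < t" for s
    by (rule summable_on_comparison_test[OF summable_on_cmult_right[OF q_sum] le[OF that]]) auto
  have "AE s in lebesgue_on {0..t}. s \<notin> {0, t}"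
    by (rule AE_lebesgue_on_Icc_not_in) simp
  then have "AE s in lebesgue_on {0..t}. integrable TM (nonlin p sol s) \<and> (\<lambda>k. (cmod (duh_coef p sol t s k))\<^sup>2) summable_on UNIV"
    using AE_space[of "lebesgue_on {0..t}"]
  proof eventually_elim
    case (elim s)
    then have s: "0 < s" "s < t" "s \<in> {0<..T}" using t by auto
    have "integrable TM (\<lambda>x. plap p (wgrad (sol s) x))"
      by (rule plap_L1[OF p L2vec_wgrad_sol[OF s(3)]])
    then show ?case using summ[OF s(1,2)] by (simp add: nonlin_def plap_def)
  qed
  moreover have "integrable (lebesgue_on {0..t}) (\<lambda>s. sqrt (\<Sum>\<^sub>\<infinity>k. (cmod (duh_coef p sol t s k))\<^sup>2))"
  proof (rule beta_kernel_dominated(1))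
    show "(\<lambda>s. sqrt (\<Sum>\<^sub>\<infinity>k. (cmod (duh_coef p sol t s k))\<^sup>2)) \<in> borel_measurable (lebesgue_on {0..t})"
    proof -
      have "(\<lambda>s. \<Sum>\<^sub>\<infinity>k. (cmod (duh_coef p sol t s k))\<^sup>2) \<in> borel_measurable (lebesgue_on {0..t})"
      proof (rule borel_measurable_infsum_Icc[OF t'(2)])
        show "(\<lambda>s. (cmod (duh_coef p sol t s k))\<^sup>2) \<in> borel_measurable (lebesgue_on {0..t})" for k
          using duh_coef_sol_measurable[OF t'(1), of k] by measurable
      qed (use summ in auto)
      then show ?thesis by measurable
    qed
    show "norm (sqrt (\<Sum>\<^sub>\<infinity>k. (cmod (duh_coef p sol t s k))\<^sup>2)) \<le> 4 * pi * ((2 + 2 * \<Lambda>) * \<Lambda>) * qnorm p * ((t - s) powr (- (1/2 + \<delta>/2)) * s powr (- ((p - 1) / 4)))"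
      if s: "0 < s" "s < t" for s
    proof -
      have "(\<Sum>\<^sub>\<infinity>k. (cmod (duh_coef p sol t s k))\<^sup>2) \<le> (\<Sum>\<^sub>\<infinity>k. (A s)\<^sup>2 * (q k)\<^sup>2)"
        by (intro infsum_mono summ[OF s] le[OF s] summable_on_cmult_right q_sum)
      also have "\<dots> = (A s * qnorm p)\<^sup>2"
        by (simp add: infsum_cmult_right' qnorm_square power_mult_distrib)
      finally have "sqrt (\<Sum>\<^sub>\<infinity>k. (cmod (duh_coef p sol t s k))\<^sup>2) \<le> A s * qnorm p"
        using A0[of s] by (intro real_le_lsqrt) (auto intro!: infsum_nonneg)
      then show ?thesis by (simp add: A_def mult_ac infsum_nonneg)
    qed
  qed (use p delta t' in auto)
  ultimately show ?thesis
    unfolding duhamel_bochner_def using duh_coef_sol_measurable[OF t'(1)] by blast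
qed

lemma mild_solution_sol: "mild_solution p T u0 sol"
  unfolding mild_solution_def
  by (auto simp: C_L2_sol has_wgrad_sol L1_sol_integrable duhamel_bochner_sol fcoef_sol integral_duh_coef_sol solc_def
      simp del: split_paired_All)

lemma S_tilde_sol: "S_tilde T sol"
proof -
  have "t powr (1/4) * L2normv (wgrad (sol t)) \<le> \<Lambda>" if "t \<in> {0<..T}" for t
    using grad_of_bound[OF _ E, of t] that by (simp add: L2normv_wgrad_sol)
  then show ?thesis
    unfolding S_tilde_def using C_L2_sol has_wgrad_sol L2vec_wgrad_sol by blast
qed

end

end

theorem mainTheorem3:
  fixes p :: real
  assumes "2 < p" and "p < 3"
  shows "\<exists>T0 :: real \<Rightarrow> real. (\<forall>r. 0 < T0 r \<and> T0 r \<le> 1) \<and>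
    (\<forall>u0. L2fun u0 \<longrightarrow>
       (\<exists>u. mild_solution p (T0 (L2norm u0)) u0 u \<and> S_tilde (T0 (L2norm u0)) u \<and>
          (\<forall>v. mild_solution p (T0 (L2norm u0)) u0 v \<and> S_tilde (T0 (L2norm u0)) v \<longrightarrow>
               (\<forall>t\<in>{0..T0 (L2norm u0)}. L2norm (\<lambda>x. v t x - u t x) = 0))))"
proof -
  \<comment> \<open>\<open>K\<close> and \<open>L\<close> are the constants of the self-map and
    contraction conditions in \<open>fixed_point\<close>, without the power of the time.\<close>
  define K where "K r = 4 * pi * ((2 + 2 * grad_radius p r) * grad_radius p r) * beta_grad p" for r
  define L where "L r = 4 * pi * ((2 + 2 * grad_radius p r) * (2 * pi * qnorm p)) * beta_grad p" for r
  \<comment> \<open>\<open>H\<close> dominates 1, \<open>K\<close> and \<open>2 * L\<close>. The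
    exponent in \<open>T0\<close> makes \<open>T0 r powr (smoothing_exp p / 2)\<close> equal to
    \<open>1 / H r\<close>, which meets both conditions, and \<open>H r \<ge> 1\<close> gives
    \<open>T0 r \<le> 1\<close>.\<close>
  define H where "H r = 1 + \<bar>K r\<bar> + 2 * \<bar>L r\<bar>" for r
  define T0 where "T0 r = H r powr (- (2 / smoothing_exp p))" for r
  have \<delta>: "smoothing_exp p > 0" using assms by (simp add: smoothing_exp_def)
  have H: "H r \<ge> 1" for r by (simp add: H_def)
  have T0: "0 < T0 r" "T0 r \<le> 1" for r
  proof -
    show "0 < T0 r" using H[of r] by (simp add: T0_def)
    have "H r powr (- (2 / smoothing_exp p)) \<le> H r powr 0" using H[of r] \<delta> by (intro powr_mono) auto
    then show "T0 r \<le> 1" using H[of r] by (simp add: T0_def)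
  qed
  have pw: "T0 r powr (smoothing_exp p / 2) = 1 / H r" for r
    unfolding T0_def powr_powr using \<delta> H[of r] by (simp add: powr_minus inverse_eq_divide)
  have small: "K r * T0 r powr (smoothing_exp p / 2) \<le> 1" "L r * T0 r powr (smoothing_exp p / 2) \<le> 1 / 2" for r
    unfolding pw using H[of r] by (auto simp: divide_simps H_def abs_if)
  have main: "\<exists>u. mild_solution p (T0 (L2norm u0)) u0 u \<and> S_tilde (T0 (L2norm u0)) u \<and>
          (\<forall>v. mild_solution p (T0 (L2norm u0)) u0 v \<and> S_tilde (T0 (L2norm u0)) v \<longrightarrow>
               (\<forall>t\<in>{0..T0 (L2norm u0)}. L2norm (\<lambda>x. v t x - u t x) = 0))" if u0: "L2fun u0" for u0
  proof -
    interpret mild_data p "T0 (L2norm u0)" u0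
      by standard (use assms T0 u0 in auto)
    obtain E where E: "norm E \<le> 1" "\<And>t k. t \<in> {0<..T0 (L2norm u0)} \<Longrightarrow> duhamel_of E t k = duhamel_mode E t k"
      using fixed_point small[of "L2norm u0"] unfolding K_def L_def by blast
    note u = mild_solution_sol[OF E] S_tilde_sol[OF E]
    \<comment> \<open>The contraction compares only fixed points in a ball; a competitor
      \<open>v\<close> with an arbitrary bound in \<open>S_tilde\<close> is covered by the
      exponentially weighted argument.\<close>
    then show ?thesis
      using mild_solution_unique[OF assms u(1) _ u(2)] by blast
  qed
  then show ?thesis using T0 by blast
qed

end
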